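(* Let $\mu,\nu\in\mathcal P$ with $\mu\leq_c\nu$, let $G=G_\mu$ be the left-continuous quantile function of $\mu$, and let $\tilde R=\tilde R_{\mu,\nu}$, $\tilde S=\tilde S_{\mu,\nu}$ on $(0,1)$ be the functions defined in the context. Then: (i) $(\tilde R,\tilde S)$ is second-order left-monotone with respect to $G$ on $(0,1)$: $\tilde R\leq G\leq\tilde S$ on $(0,1)$, and for all $u<v$ in $(0,1)$, $\tilde S(u)\leq\tilde S(v)$ and $\tilde R(v)\notin(\tilde R(u),\tilde S(u))$. (ii) Let $U,V$ be independent uniform random variables on $(0,1)$. Set $X(u,v)=X(u)=G(u)$, and let $Y(u,v)=G(u)$ if $\tilde R(u)=\tilde S(u)$, while if $\tilde R(u)<\tilde S(u)$ let $Y(u,v)=\tilde R(u)$ for $v\leq\frac{\tilde S(u)-G(u)}{\tilde S(u)-\tilde R(u)}$ and $Y(u,v)=\tilde S(u)$ for $v>\frac{\tilde S(u)-G(u)}{\tilde S(u)-\tilde R(u)}$ (with $Y$ arbitrary on the null set where $\tilde R$ or $\tilde S$ is infinite). Then $(X(U),Y(U,V))$ is a martingale with respect to $(\sigma(U),\sigma(U,V))$, $X(U)$ has law $\mu$ and $Y(U,V)$ has law $\nu$. (iii) In particular $\tilde R,\tilde S$ define the lifted left-curtain martingale coupling: for every $u\in(0,1)$ and Borel $B\subseteq\mathbb R$, $\mathbb P(U\leq u,\ Y(U,V)\in B)=S^\nu(\mu_u)(B)$.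
   Context: $\mathcal M$: finite Borel measures on $\mathbb R$ with finite first moment; $\mathcal P$: probability measures in $\mathcal M$. $P_\eta(k)=\int(k-x)^+\eta(dx)$. For $\eta,\chi\in\mathcal M$: $\eta\leq\chi$ means $\eta(A)\le\chi(A)$ for all Borel $A$; $\eta\leq_c\chi$ (resp. $\eta\leq_{cd}\chi$) means $\int f\,d\eta\leq\int f\,d\chi$ for all convex (resp. convex non-increasing) $f:\mathbb R\to\mathbb R$; $\eta\leq_{pcd}\chi$ means the same inequality for all non-negative convex non-increasing $f$. If $\eta\leq_{pcd}\chi$, the shadow $S^\chi(\eta)$ is the unique measure $\theta$ with $\eta\leq_{cd}\theta\leq\chi$ such that $\theta\leq_{cd}\theta'$ whenever $\eta\leq_{cd}\theta'\leq\chi$. $f^c$ is the largest convex function below $f$; $\partial f$ is the subdifferential. For $\eta\in\mathcal M$ with $m=\eta(\mathbb R)$, $G_\eta:(0,m)\to\mathbb R$, $G_\eta(u)=\sup\{k:\eta((-\infty,k])<u\}$ is the left-continuous quantile function, and for $u\in(0,m)$, $\eta_u=\eta|_{(-\infty,G_\eta(u))}+\big(u-\eta((-\infty,G_\eta(u)))\big)\delta_{G_\eta(u)}$. Basic functions. For $\eta\leq_{cd}\chi$ in $\mathcal M$ with common mass $m$, set $D_{\eta,\chi}=P_\chi-P_\eta$ and, for $u\in(0,m)$, $\mathcal E_u=P_\chi-P_{\eta_u}$. Define for $u\in(0,m)$: $S_{\eta,\chi}(u)=\inf\{z\geq G_\eta(u):\mathcal E_u^c(z)=\mathcal E_u(z)\}$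 ($\inf\emptyset=\infty$); $\phi_{\eta,\chi}(u)=\inf\partial(\mathcal E_u^c)(G_\eta(u))$; and $R_{\eta,\chi}(u)=\inf\{k\leq G_\eta(u):D_{\eta,\chi}(k)=\mathcal E_u^c(G_\eta(u))+\phi_{\eta,\chi}(u)(k-G_\eta(u))\}$ (read as $-\infty$ if the set is empty). Glued functions. For $\eta\leq_c\chi$ in $\mathcal M$ with common mass $m$, let $\mathcal I_i=(\ell_i,r_i)$, $i\geq0$, be the (at most countably many) connected components of $\{k:D_{\eta,\chi}(k)>0\}$ (the irreducible components), let $\eta_i=\eta|_{\mathcal I_i}$, $\chi_i=S^\chi(\eta_i)$, $u_i^\ell=\inf\{u\in(0,m):G_\eta(u)>\ell_i\}$, $u_i^r=\sup\{u\in(0,m):G_\eta(u)<r_i\}$, $\mathcal U_i=(u_i^\ell,u_i^r)$, and on $(0,u_i^r-u_i^\ell)$ let $R_i=R_{\eta_i,\chi_i}$, $S_i=S_{\eta_i,\chi_i}$. Let $\mathcal N=\bigcup_i\{u_i^r: G_\eta(u_i^r)<r_i\}$ (restricted to points at which $G_\eta$ is defined). Then $$\tilde R_{\eta,\chi}(u)=\begin{cases}R_i(u-u_i^\ell),&u\in\mathcal U_i,\\ \ell_i,&u=u_i^r\in\mathcal N,\\ G_\eta(u),&\text{otherwise},\end{cases}\qquad \tilde S_{\eta,\chi}(u)=\begin{cases}S_i(u-u_i^\ell),&u\in\mathcal U_i,\\ r_i,&u=u_i^r\in\mathcal N,\\ G_\eta(u),&\text{otherwise}.\end{cases}$$ Infinite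 values can occur only on the countable set $\mathcal N$. *)

theory Defs
  imports "HOL-Probability.Probability"
begin

definition fin_moment :: "real measure \<Rightarrow> bool" where
  "fin_moment \<eta> \<longleftrightarrow> finite_measure \<eta> \<and> sets \<eta> = sets borel \<and> integrable \<eta> (\<lambda>x. x)"

definition prob_fin_moment :: "real measure \<Rightarrow> bool" where
  "prob_fin_moment \<eta> \<longleftrightarrow> fin_moment \<eta> \<and> prob_space \<eta>"

abbreviation mass :: "real measure \<Rightarrow> real" where
  "mass \<eta> \<equiv> measure \<eta> UNIV"

definition put :: "real measure \<Rightarrow> real \<Rightarrow> real" where
  "put \<eta> k = (\<integral>x. max (k - x) 0 \<partial>\<eta>)"

text \<open>
  The integral of a convex \<open>f\<close> against a measure with finite first moment always exists in
  \<open>(-\<infinity>, \<infinity>]\<close>, since the negative part of \<open>f\<close> is dominated by an affine function. The Bochner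
  integral is not usable here, because it is 0 when \<open>f\<close> is not integrable.
\<close>

definition ext_integral :: "real measure \<Rightarrow> (real \<Rightarrow> real) \<Rightarrow> ereal" where
  "ext_integral \<eta> f =
     enn2ereal (\<integral>\<^sup>+x. ennreal (f x) \<partial>\<eta>) - enn2ereal (\<integral>\<^sup>+x. ennreal (- f x) \<partial>\<eta>)"

definition le_c :: "real measure \<Rightarrow> real measure \<Rightarrow> bool" where
  "le_c \<eta> \<xi> \<longleftrightarrow> (\<forall>f. convex_on UNIV f \<longrightarrow> ext_integral \<eta> f \<le> ext_integral \<xi> f)"

definition le_cd :: "real measure \<Rightarrow> real measure \<Rightarrow> bool" where
  "le_cd \<eta> \<xi> \<longleftrightarrow>
     (\<forall>f. convex_on UNIV f \<and> antimono f \<longrightarrow> ext_integral \<eta> f \<le> ext_integral \<xi> f)"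

definition le_pcd :: "real measure \<Rightarrow> real measure \<Rightarrow> bool" where
  "le_pcd \<eta> \<xi> \<longleftrightarrow>
     (\<forall>f. convex_on UNIV f \<and> antimono f \<and> (\<forall>x. 0 \<le> f x) \<longrightarrow>
        ext_integral \<eta> f \<le> ext_integral \<xi> f)"

text \<open>
  Between Borel measures the library order \<open>\<le>\<close> on measures is the setwise order
  (\<open>le_measure\<close>).
\<close>

definition is_shadow :: "real measure \<Rightarrow> real measure \<Rightarrow> real measure \<Rightarrow> bool" where
  "is_shadow \<xi> \<eta> \<theta> \<longleftrightarrow>
     le_pcd \<eta> \<xi> \<and> fin_moment \<theta> \<and> le_cd \<eta> \<theta> \<and> \<theta> \<le> \<xi> \<and>
     (\<forall>\<theta>'. fin_moment \<theta>' \<and> le_cd \<eta> \<theta>' \<and> \<theta>' \<le> \<xi> \<longrightarrow> le_cd \<theta> \<theta>')"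

definition shadow :: "real measure \<Rightarrow> real measure \<Rightarrow> real measure" where
  "shadow \<xi> \<eta> = (THE \<theta>. is_shadow \<xi> \<eta> \<theta>)"

definition convex_minorant :: "(real \<Rightarrow> real) \<Rightarrow> real \<Rightarrow> real" where
  "convex_minorant f = (GREATEST g. convex_on UNIV g \<and> g \<le> f)"

definition subdifferential :: "(real \<Rightarrow> real) \<Rightarrow> real \<Rightarrow> real set" where
  "subdifferential f x = {c. \<forall>y. f x + c * (y - x) \<le> f y}"

text \<open>
  The quantile function is meaningful for \<open>u \<in> (0, mass \<eta>)\<close>, where the set below is nonempty and
  bounded above. For other \<open>u\<close> the value is irrelevant.
\<close>

definition quantile :: "real measure \<Rightarrow> real \<Rightarrow> real" where
  "quantile \<eta> u = Sup {k. measure \<eta> {..k} < u}"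

text \<open>
  \<open>quantile_part \<eta> u\<close> is the measure \<open>\<eta>\<^sub>u\<close>: the leftmost part of \<open>\<eta>\<close> of mass \<open>u\<close>. The library has no
  sum of two measures, hence the explicit \<open>measure_of\<close>.
\<close>

definition quantile_part :: "real measure \<Rightarrow> real \<Rightarrow> real measure" where
  "quantile_part \<eta> u = measure_of UNIV (sets borel)
     (\<lambda>A. emeasure \<eta> (A \<inter> {..<quantile \<eta> u}) +
          ennreal (u - measure \<eta> {..<quantile \<eta> u}) * indicator A (quantile \<eta> u))"

lemma sets_quantile_part [simp]: "sets (quantile_part \<eta> u) = sets borel"
  unfolding quantile_part_def using sets.sigma_sets_eq[of "borel :: real measure"]
  by (simp add: sets_measure_of)

lemma emeasure_quantile_part:
  assumes "sets \<eta> = sets borel" and A: "A \<in> sets borel"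
  shows "emeasure (quantile_part \<eta> u) A =
    emeasure \<eta> (A \<inter> {..<quantile \<eta> u}) +
    ennreal (u - measure \<eta> {..<quantile \<eta> u}) * indicator A (quantile \<eta> u)"
proof -
  let ?G = "quantile \<eta> u"
  let ?c = "ennreal (u - measure \<eta> {..<quantile \<eta> u})"
  let ?f = "\<lambda>A. emeasure \<eta> (A \<inter> {..<?G}) + ?c * indicator A ?G"
  have "countably_additive (sets borel) ?f"
  proof (rule countably_additiveI)
    fix B :: "nat \<Rightarrow> real set"
    assume B: "range B \<subseteq> sets borel" "disjoint_family B" "(\<Union>i. B i) \<in> sets borel"
    have 1: "(\<Sum>i. emeasure \<eta> (B i \<inter> {..<?G})) = emeasure \<eta> (\<Union>i. B i \<inter> {..<?G})"
      by (rule suminf_emeasure) (use B assms in \<open>auto simp: disjoint_family_on_def\<close>)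
    have 2: "(\<Sum>i. ?c * indicator (B i) ?G) = ?c * indicator (\<Union>i. B i) ?G"
      using B(2) by (simp add: suminf_indicator)
    have "(\<Sum>i. ?f (B i)) =
        (\<Sum>i. emeasure \<eta> (B i \<inter> {..<?G})) + (\<Sum>i. ?c * indicator (B i) ?G)"
      by (rule suminf_add[symmetric]) auto
    then show "(\<Sum>i. ?f (B i)) = ?f (\<Union>i. B i)"
      unfolding 1 2 by simp
  qed
  then show ?thesis
    using A sets.sigma_algebra_axioms[of "borel :: real measure"]
    unfolding quantile_part_def
    by (subst emeasure_measure_of_sigma) (auto simp: positive_def)
qed

subsection \<open>Basic functions\<close>

definition put_diff :: "real measure \<Rightarrow> real measure \<Rightarrow> real \<Rightarrow> real" where
  "put_diff \<eta> \<xi> k = put \<xi> k - put \<eta> k"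

definition put_diff_upto :: "real measure \<Rightarrow> real measure \<Rightarrow> real \<Rightarrow> real \<Rightarrow> real" where
  "put_diff_upto \<eta> \<xi> u = put_diff (quantile_part \<eta> u) \<xi>"

text \<open>In \<open>ereal\<close> the infimum of the empty set is \<open>\<infinity>\<close>, as required for \<open>basic_S\<close>.\<close>

definition basic_S :: "real measure \<Rightarrow> real measure \<Rightarrow> real \<Rightarrow> ereal" where
  "basic_S \<eta> \<xi> u =
     Inf (ereal ` {z. quantile \<eta> u \<le> z \<and>
       convex_minorant (put_diff_upto \<eta> \<xi> u) z = put_diff_upto \<eta> \<xi> u z})"

definition basic_phi :: "real measure \<Rightarrow> real measure \<Rightarrow> real \<Rightarrow> real" where
  "basic_phi \<eta> \<xi> u =
     Inf (subdifferential (convex_minorant (put_diff_upto \<eta> \<xi> u)) (quantile \<eta> u))"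

definition basic_R :: "real measure \<Rightarrow> real measure \<Rightarrow> real \<Rightarrow> ereal" where
  "basic_R \<eta> \<xi> u =
     (let K = {k. k \<le> quantile \<eta> u \<and>
                put_diff \<eta> \<xi> k = convex_minorant (put_diff_upto \<eta> \<xi> u) (quantile \<eta> u)
                  + basic_phi \<eta> \<xi> u * (k - quantile \<eta> u)}
      in if K = {} then -\<infinity> else Inf (ereal ` K))"

subsection \<open>Glued functions\<close>

text \<open>
  Irreducible components are used as their own indices: \<open>I\<close> stands for \<open>\<I>\<^sub>i = (\<ell>\<^sub>i, r\<^sub>i)\<close>, and its
  possibly infinite endpoints are \<open>left_end I\<close> and \<open>right_end I\<close>.
\<close>

definition irred_components :: "real measure \<Rightarrow> real measure \<Rightarrow> real set set" where
  "irred_components \<eta> \<xi> = components {k. put_diff \<eta> \<xi> k > 0}"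

definition left_end :: "real set \<Rightarrow> ereal" where
  "left_end I = Inf (ereal ` I)"

definition right_end :: "real set \<Rightarrow> ereal" where
  "right_end I = Sup (ereal ` I)"

definition restrict_measure :: "real measure \<Rightarrow> real set \<Rightarrow> real measure" where
  "restrict_measure \<eta> I = density \<eta> (indicator I)"

definition u_left :: "real measure \<Rightarrow> real set \<Rightarrow> real" where
  "u_left \<eta> I = Inf {u. 0 < u \<and> u < mass \<eta> \<and> left_end I < ereal (quantile \<eta> u)}"

definition u_right :: "real measure \<Rightarrow> real set \<Rightarrow> real" where
  "u_right \<eta> I = Sup {u. 0 < u \<and> u < mass \<eta> \<and> ereal (quantile \<eta> u) < right_end I}"

definition component_R :: "real measure \<Rightarrow> real measure \<Rightarrow> real set \<Rightarrow> real \<Rightarrow> ereal" where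
  "component_R \<eta> \<xi> I = basic_R (restrict_measure \<eta> I) (shadow \<xi> (restrict_measure \<eta> I))"

definition component_S :: "real measure \<Rightarrow> real measure \<Rightarrow> real set \<Rightarrow> real \<Rightarrow> ereal" where
  "component_S \<eta> \<xi> I = basic_S (restrict_measure \<eta> I) (shadow \<xi> (restrict_measure \<eta> I))"

text \<open>
  \<open>in_component \<eta> \<xi> u I\<close> says \<open>u \<in> \<U>\<^sub>i\<close>, and \<open>at_gap \<eta> \<xi> u I\<close> says \<open>u = u\<^sub>i\<^sup>r \<in> \<N>\<close>. For
  \<open>\<eta> \<le>\<^sub>c \<xi>\<close> at most one \<open>I\<close> satisfies either for a given \<open>u\<close>, because \<open>\<eta>\<close> charges every
  irreducible component.
\<close>

definition in_component :: "real measure \<Rightarrow> real measure \<Rightarrow> real \<Rightarrow> real set \<Rightarrow> bool" where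
  "in_component \<eta> \<xi> u I \<longleftrightarrow>
     I \<in> irred_components \<eta> \<xi> \<and> u \<in> {u_left \<eta> I <..< u_right \<eta> I}"

definition at_gap :: "real measure \<Rightarrow> real measure \<Rightarrow> real \<Rightarrow> real set \<Rightarrow> bool" where
  "at_gap \<eta> \<xi> u I \<longleftrightarrow>
     I \<in> irred_components \<eta> \<xi> \<and> u = u_right \<eta> I \<and> u \<in> {0 <..< mass \<eta>} \<and>
     ereal (quantile \<eta> u) < right_end I"

definition glued_R :: "real measure \<Rightarrow> real measure \<Rightarrow> real \<Rightarrow> ereal" where
  "glued_R \<eta> \<xi> u =
     (if \<exists>I. in_component \<eta> \<xi> u I then
        let I = (THE I. in_component \<eta> \<xi> u I) in component_R \<eta> \<xi> I (u - u_left \<eta> I)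
      else if \<exists>I. at_gap \<eta> \<xi> u I then left_end (THE I. at_gap \<eta> \<xi> u I)
      else ereal (quantile \<eta> u))"

definition glued_S :: "real measure \<Rightarrow> real measure \<Rightarrow> real \<Rightarrow> ereal" where
  "glued_S \<eta> \<xi> u =
     (if \<exists>I. in_component \<eta> \<xi> u I then
        let I = (THE I. in_component \<eta> \<xi> u I) in component_S \<eta> \<xi> I (u - u_left \<eta> I)
      else if \<exists>I. at_gap \<eta> \<xi> u I then right_end (THE I. at_gap \<eta> \<xi> u I)
      else ereal (quantile \<eta> u))"

subsection \<open>Monotonicity, martingales and the coupling\<close>

definition second_order_left_monotone ::
  "(real \<Rightarrow> ereal) \<Rightarrow> (real \<Rightarrow> ereal) \<Rightarrow> (real \<Rightarrow> real) \<Rightarrow> real set \<Rightarrow> bool" where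
  "second_order_left_monotone R S G J \<longleftrightarrow>
     (\<forall>u\<in>J. R u \<le> ereal (G u) \<and> ereal (G u) \<le> S u) \<and>
     (\<forall>u\<in>J. \<forall>v\<in>J. u < v \<longrightarrow> S u \<le> S v \<and> R v \<notin> {R u <..< S u})"

definition two_step_martingale ::
  "'w measure \<Rightarrow> 'w measure \<Rightarrow> 'w measure \<Rightarrow> ('w \<Rightarrow> real) \<Rightarrow> ('w \<Rightarrow> real) \<Rightarrow> bool" where
  "two_step_martingale M F1 F2 X Y \<longleftrightarrow>
     subalgebra M F2 \<and> subalgebra F2 F1 \<and>
     X \<in> borel_measurable F1 \<and> Y \<in> borel_measurable F2 \<and>
     integrable M X \<and> integrable M Y \<and>
     (AE \<omega> in M. real_cond_exp M F1 Y \<omega> = X \<omega>)"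

text \<open>
  The target \<open>Y(u,v)\<close> of the lifted coupling. The function \<open>y\<close> supplies the arbitrary values at those
  \<open>u\<close> where \<open>glued_R\<close> or \<open>glued_S\<close> is infinite.
\<close>

definition coupling_Y ::
  "real measure \<Rightarrow> real measure \<Rightarrow> (real \<Rightarrow> real \<Rightarrow> real) \<Rightarrow> real \<Rightarrow> real \<Rightarrow> real" where
  "coupling_Y \<mu> \<nu> y u v =
     (let g = quantile \<mu> u;
          r = real_of_ereal (glued_R \<mu> \<nu> u);
          s = real_of_ereal (glued_S \<mu> \<nu> u)
      in if \<bar>glued_R \<mu> \<nu> u\<bar> = \<infinity> \<or> \<bar>glued_S \<mu> \<nu> u\<bar> = \<infinity> then y u v
         else if r < s then (if v \<le> (s - g) / (s - r) then r else s)
         else g)"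

end

theory Submission
  imports Defs
begin

text \<open>
  The idea is to compare put functions. If \<open>\<eta> \<le>\<^sub>c\<^sub>d \<theta> \<le> \<nu>\<close>, then \<open>P\<^sub>\<nu> - P\<^sub>\<theta>\<close> is convex and lies below \<open>P\<^sub>\<nu> - P\<^sub>\<eta>\<close>.
  Therefore \<open>\<theta>\<close> is the shadow of \<open>\<eta>\<close> in \<open>\<nu>\<close> as soon as \<open>P\<^sub>\<nu> - P\<^sub>\<theta>\<close> is the convex minorant of \<open>P\<^sub>\<nu> - P\<^sub>\<eta>\<close>
  (\<open>shadow_eqI\<close>; put functions decide the orders by \<open>le_cdI\<close>). For the quantile parts of \<open>\<mu>\<close> it has to be shown
  that the law of \<open>Y\<close> on the event \<open>U \<le> u\<close> has the put function \<open>P\<^sub>\<nu> - E\<^sub>u\<^sup>c\<close>, where \<open>E\<^sub>u = P\<^sub>\<nu> - P\<^sub>\<eta>\<close> for the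
  leftmost part \<open>\<eta>\<close> of \<open>\<mu>\<close> of mass \<open>u\<close>, and \<open>E\<^sub>u\<^sup>c\<close> is its convex minorant.

  The points \<open>R(u) \<le> G(u) \<le> S(u)\<close>, if finite, are points where \<open>E\<^sub>u\<^sup>c\<close> agrees with \<open>E\<^sub>u\<close> and between which
  \<open>E\<^sub>u\<^sup>c\<close> is affine. They are defined by a local problem on each irreducible component. Its second
  measure, the shadow of the restriction of \<open>\<mu>\<close>, is the law of the quantile function of \<open>\<nu>\<close> on the levels of
  the component (\<open>shadow_component\<close>), which makes the local problem explicit enough to see that its tangents
  are tangents of \<open>E\<^sub>u\<close> (\<open>component_tangent\<close>). For \<open>u < v\<close> the difference \<open>E\<^sub>u - E\<^sub>v\<close> at \<open>x\<close> is the integral of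
  \<open>(x - G(t))\<^sup>+\<close> over \<open>t\<close> in \<open>(u, v)\<close>. It is convex in \<open>x\<close>, vanishes to the left of \<open>G(u)\<close> and is affine to the right
  of \<open>G(v)\<close>. Comparing the tangents of the levels \<open>u\<close> and \<open>v\<close> by means of these properties gives the second-order
  left-monotonicity (\<open>glued_S_mono\<close>, \<open>glued_R_not_between\<close>).

  For a fixed strike \<open>k\<close>, the value \<open>E\<^sub>u\<^sup>c(k)\<close> decreases in \<open>u\<close>, and an envelope argument shows that its rate is
  the expectation of \<open>(k - Y)\<^sup>+\<close> under the two-point law on \<open>R(u)\<close> and \<open>S(u)\<close> with mean \<open>G(u)\<close>: only the contact
  points matter, and there the change of \<open>E\<^sub>u\<close> is explicit (\<open>minorant_decrease_lower\<close>,
  \<open>minorant_decrease_upper\<close>). By left-monotonicity the rate is continuous in \<open>u\<close> off a countable set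
  (\<open>payoff_continuity\<close>), so integration from level 0 gives \<open>P\<^sub>\<nu>(k) - E\<^sub>u\<^sup>c(k)\<close> (\<open>payoff_nn_integral\<close>), which is
  thus the put function of the law of \<open>Y\<close> on \<open>U \<le> u\<close>. As \<open>u\<close> tends to 1 the minorant tends to 0, so \<open>Y\<close> has law
  \<open>\<nu>\<close>. Consequently the law of \<open>Y\<close> on \<open>U \<le> u\<close> lies below \<open>\<nu>\<close> and is the shadow.
\<close>

section \<open>Convex minorants on the line\<close>

lemma convex_supporting_line:
  fixes f :: "real \<Rightarrow> real"
  assumes "convex_on UNIV f"
  obtains s where "\<And>y. f x + s * (y - x) \<le> f y"
  using convex_le_Inf_differential[OF assms, of x] by auto

lemma convex_on_continuous_at:
  fixes f :: "real \<Rightarrow> real"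
  assumes "convex_on UNIV f"
  shows "continuous_on A f"
  using convex_on_continuous[of UNIV f] assms continuous_on_subset by blast

text \<open>
  The convex minorant is the supremum of the affine minorants, since a convex function is the supremum
  of its supporting lines. One affine minorant is enough for this supremum to be finite, and then the
  \<open>GREATEST\<close> in \<open>convex_minorant_def\<close> is attained.
\<close>

lemma
  fixes f :: "real \<Rightarrow> real"
  assumes line: "\<And>x. c\<^sub>0 + s\<^sub>0 * x \<le> f x"
  shows convex_on_convex_minorant: "convex_on UNIV (convex_minorant f)"
    and convex_minorant_le: "convex_minorant f x \<le> f x"
    and convex_minorant_greatest: "\<And>g x. convex_on UNIV g \<Longrightarrow> (\<And>y. g y \<le> f y) \<Longrightarrow> g x \<le> convex_minorant f x"
    and line_le_convex_minorant: "\<And>c s x. (\<And>y. c + s * y \<le> f y) \<Longrightarrow> c + s * x \<le> convex_minorant f x"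
proof -
  define V where "V x = {c + s * x | c s. \<forall>y. c + s * y \<le> f y}" for x
  define h where "h x = Sup (V x)" for x
  have ne: "V x \<noteq> {}" for x unfolding V_def using line by blast
  have bdd: "bdd_above (V x)" for x unfolding V_def by (rule bdd_aboveI[of _ "f x"]) auto
  have up: "c + s * x \<le> h x" if "\<And>y. c + s * y \<le> f y" for c s x
    unfolding h_def by (rule cSup_upper[OF _ bdd]) (use that in \<open>auto simp: V_def\<close>)
  have hf: "h x \<le> f x" for x
    unfolding h_def by (rule cSup_least[OF ne]) (auto simp: V_def)
  have conv: "convex_on UNIV h"
  proof (rule convex_onI)
    fix t x y :: real assume t: "0 < t" "t < 1"
    show "h ((1 - t) *\<^sub>R x + t *\<^sub>R y) \<le> (1 - t) * h x + t * h y"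
      unfolding h_def[of "(1 - t) *\<^sub>R x + t *\<^sub>R y"]
    proof (rule cSup_least[OF ne])
      fix v assume "v \<in> V ((1 - t) *\<^sub>R x + t *\<^sub>R y)"
      then obtain c s where v: "v = c + s * ((1 - t) * x + t * y)" and cs: "\<And>y. c + s * y \<le> f y"
        unfolding V_def by auto
      have "v = (1 - t) * (c + s * x) + t * (c + s * y)" unfolding v by algebra
      also have "\<dots> \<le> (1 - t) * h x + t * h y"
        by (intro add_mono mult_left_mono up cs) (use t in auto)
      finally show "v \<le> (1 - t) * h x + t * h y" .
    qed
  qed auto
  have great: "g x \<le> h x" if g: "convex_on UNIV g" "\<And>y. g y \<le> f y" for g x
  proof -
    obtain s where s: "\<And>y. g x + s * (y - x) \<le> g y" using convex_supporting_line[OF g(1)] by blast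
    have "(g x - s * x) + s * x \<le> h x"
    proof (rule up)
      fix y show "g x - s * x + s * y \<le> f y" using s[of y] g(2)[of y] by (simp add: algebra_simps)
    qed
    then show ?thesis by simp
  qed
  have eq: "convex_minorant f = h"
    unfolding convex_minorant_def
    by (rule Greatest_equality) (use conv hf great in \<open>auto simp: le_fun_def\<close>)
  show "convex_on UNIV (convex_minorant f)" "convex_minorant f x \<le> f x" using eq conv hf by auto
  show "\<And>g x. convex_on UNIV g \<Longrightarrow> (\<And>y. g y \<le> f y) \<Longrightarrow> g x \<le> convex_minorant f x"
    using eq great by auto
  show "\<And>c s x. (\<And>y. c + s * y \<le> f y) \<Longrightarrow> c + s * x \<le> convex_minorant f x"
    using eq up by auto
qed

text \<open>
  A line that is highest at \<open>k\<close> among the affine minorants of \<open>f\<close> has to touch \<open>f\<close> on the left of \<open>k\<close>: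
  otherwise it can be tilted about a point slightly to the right of \<open>k\<close>, which raises it at \<open>k\<close>. Linear
  growth of the gap at \<open>-\<infinity>\<close> keeps the tilted line below \<open>f\<close>.
\<close>

lemma contact_left:
  fixes f :: "real \<Rightarrow> real"
  assumes cont: "continuous_on UNIV f"
    and line: "\<And>x. c + s * x \<le> f x"
    and best: "\<And>c' s'. (\<And>x. c' + s' * x \<le> f x) \<Longrightarrow> c' + s' * k \<le> c + s * k"
    and growth: "0 < \<delta>" "\<And>x. x \<le> M \<Longrightarrow> \<delta> * (- x) \<le> f x - (c + s * x)"
  shows "\<exists>x\<le>k. f x = c + s * x"
proof (rule ccontr)
  assume no: "\<not> ?thesis"
  define d where "d x = f x - (c + s * x)" for x
  have dpos: "d x > 0" if "x \<le> k" for x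
    using no line[of x] that unfolding d_def by (metis diff_gt_0_iff_gt order_le_imp_less_or_eq)
  have d0: "d x \<ge> 0" for x using line[of x] unfolding d_def by simp
  have dcont: "continuous_on A d" for A unfolding d_def
    by (intro continuous_intros continuous_on_subset[OF cont]) auto
  have "\<forall>\<^sub>F x in at k. d x > d k / 2"
    using dcont[of UNIV] dpos[of k]
    by (intro order_tendstoD(1)[of _ "d k"]) (auto simp: continuous_on_def)
  then obtain e where e: "e > 0" "\<And>x. x \<noteq> k \<Longrightarrow> dist x k < e \<Longrightarrow> d x > d k / 2"
    unfolding eventually_at by auto
  \<comment> \<open>The tilted line turns about \<open>k'\<close>; the gap stays positive up to this point.\<close>
  define k' where "k' = k + e / 2"
  have k': "k < k'" using e by (simp add: k'_def)
  have dpos': "d x > 0" if "x \<le> k'" for x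
  proof (cases "x \<le> k")
    case False
    then have "d x > d k / 2" using that e(1) by (intro e(2)) (auto simp: k'_def dist_real_def)
    then show ?thesis using dpos[of k] by simp
  qed (rule dpos)
  define m where "m = min M (- \<bar>k'\<bar> - 1)"
  have mk: "m < k'" unfolding m_def by linarith
  obtain z where z: "z \<in> {m..k'}" "\<And>y. y \<in> {m..k'} \<Longrightarrow> d z \<le> d y"
    using continuous_attains_inf[of "{m..k'}" d] mk dcont by fastforce
  define \<eta> where "\<eta> = d z"
  have \<eta>: "\<eta> > 0" using dpos' z(1) unfolding \<eta>_def by auto
  \<comment> \<open>The angle is limited by the growth to the left of \<open>m\<close> and by the least gap \<open>\<eta>\<close> on \<open>[m, k']\<close>.\<close>
  define \<epsilon> where "\<epsilon> = min (\<delta> / 2) (\<eta> / (k' - m))"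
  have \<epsilon>: "\<epsilon> > 0" "\<epsilon> \<le> \<delta> / 2" "\<epsilon> * (k' - m) \<le> \<eta>"
    using growth(1) \<eta> mk by (auto simp: \<epsilon>_def min_def field_simps)
  have tilt: "\<epsilon> * (k' - x) \<le> d x" for x
  proof -
    consider "x \<ge> k'" | "m \<le> x" "x \<le> k'" | "x < m" by linarith
    then show ?thesis
    proof cases
      case 1
      then have "\<epsilon> * (k' - x) \<le> 0" using \<epsilon>(1) by (simp add: mult_le_0_iff)
      then show ?thesis using d0[of x] by simp
    next
      case 2
      have "\<epsilon> * (k' - x) \<le> \<epsilon> * (k' - m)" using \<epsilon> 2 by (intro mult_left_mono) auto
      also have "\<dots> \<le> d x" using \<epsilon>(3) z(2)[of x] 2 by (simp add: \<eta>_def)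
      finally show ?thesis .
    next
      case 3
      then have *: "x \<le> M" "k' - x \<le> 2 * (- x)" "0 \<le> -x" by (auto simp: m_def)
      have "\<epsilon> * (k' - x) \<le> \<epsilon> * (2 * (- x))" using \<epsilon> * by (intro mult_left_mono) auto
      also have "\<dots> = (2 * \<epsilon>) * (- x)" by simp
      also have "\<dots> \<le> \<delta> * (- x)" using \<epsilon> * by (intro mult_right_mono) auto
      also have "\<dots> \<le> d x" using growth(2)[OF *(1)] unfolding d_def .
      finally show ?thesis .
    qed
  qed
  have "(c + \<epsilon> * k') + (s - \<epsilon>) * k \<le> c + s * k"
  proof (rule best)
    fix x show "c + \<epsilon> * k' + (s - \<epsilon>) * x \<le> f x"
      using tilt[of x] unfolding d_def by (simp add: algebra_simps)
  qed
  then have "\<epsilon> * (k' - k) \<le> 0" by (simp add: algebra_simps)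
  then show False using \<epsilon>(1) k' by (simp add: mult_le_0_iff)
qed

lemma contact_right:
  fixes f :: "real \<Rightarrow> real"
  assumes cont: "continuous_on UNIV f"
    and line: "\<And>x. c + s * x \<le> f x"
    and best: "\<And>c' s'. (\<And>x. c' + s' * x \<le> f x) \<Longrightarrow> c' + s' * k \<le> c + s * k"
    and growth: "0 < \<delta>" "\<And>x. M \<le> x \<Longrightarrow> \<delta> * x \<le> f x - (c + s * x)"
  shows "\<exists>x\<ge>k. f x = c + s * x"
proof -
  have "\<exists>x\<le>-k. f (- x) = c + (- s) * x"
  proof (rule contact_left[where \<delta> = \<delta> and M = "- M"])
    show "continuous_on UNIV (\<lambda>x. f (- x))"
      by (intro continuous_on_compose2[OF cont] continuous_intros) auto
    show "c + - s * x \<le> f (- x)" for x using line[of "- x"] by simp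
    show "c' + s' * - k \<le> c + - s * - k" if "\<And>x. c' + s' * x \<le> f (- x)" for c' s'
      using best[of c' "- s'"] that[of "- x" for x] by simp
    show "\<delta> * - x \<le> f (- x) - (c + - s * x)" if "x \<le> - M" for x
      using growth(2)[of "- x"] that by simp
  qed (rule growth)
  then obtain x where "x \<le> - k" "f (- x) = c + (- s) * x" by blast
  then show ?thesis by (intro exI[of _ "- x"]) auto
qed

section \<open>Put functions, the convex decreasing order and the shadow\<close>

lemma fin_momentD:
  assumes "fin_moment \<eta>"
  shows "finite_measure \<eta>" "sets \<eta> = sets borel" "space \<eta> = UNIV" "integrable \<eta> (\<lambda>x. x)"
    "integrable \<eta> (\<lambda>x. c :: real)" "integrable \<eta> (\<lambda>x. max (k - x) 0)"
    "integrable \<eta> (\<lambda>x. a + b * x)" "integrable \<eta> (\<lambda>x. max (a + b * x) 0)"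
proof -
  interpret finite_measure \<eta> using assms by (simp add: fin_moment_def)
  show *: "finite_measure \<eta>" "sets \<eta> = sets borel" "integrable \<eta> (\<lambda>x. x)" "integrable \<eta> (\<lambda>x. c :: real)"
    using assms by (auto simp: fin_moment_def)
  show "space \<eta> = UNIV" using sets_eq_imp_space_eq[OF *(2)] by simp
  show a: "integrable \<eta> (\<lambda>x. a + b * x)" for a b using * by auto
  show "integrable \<eta> (\<lambda>x. max (a + b * x) 0)"
    by (intro integrable_max a) simp
  show "integrable \<eta> (\<lambda>x. max (k - x) 0)" using *
    by (intro integrable_max Bochner_Integration.integrable_diff) auto
qed

lemma fin_moment_measurable:
  assumes "fin_moment \<eta>"
  shows "f \<in> borel_measurable borel \<Longrightarrow> f \<in> borel_measurable \<eta>"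
  using fin_momentD(2)[OF assms] by (metis measurable_cong_sets)

lemma convex_on_measurable:
  fixes f :: "real \<Rightarrow> real"
  assumes "convex_on UNIV f"
  shows "f \<in> borel_measurable borel"
  by (intro borel_measurable_continuous_onI convex_on_continuous_at assms)

text \<open>
  Subtracting an integrable lower bound leaves a single nonnegative integral, to which Fatou's lemma
  applies.
\<close>

lemma ext_integral_above_integrable:
  assumes f: "f \<in> borel_measurable \<eta>" and l: "integrable \<eta> l" and le: "\<And>x. l x \<le> f x"
  shows "ext_integral \<eta> f = enn2ereal (\<integral>\<^sup>+x. ennreal (f x - l x) \<partial>\<eta>) + ereal (\<integral>x. l x \<partial>\<eta>)"
proof -
  have lm[measurable]: "l \<in> borel_measurable \<eta>" using l by auto
  note f[measurable]
  let ?N = "\<lambda>g. \<integral>\<^sup>+x. ennreal (g x) \<partial>\<eta>"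
  have fin: "?N l < \<infinity>" "?N (\<lambda>x. - l x) < \<infinity>"
    using l unfolding real_integrable_def by (auto simp: less_top)
  have fin2: "?N (\<lambda>x. - f x) < \<infinity>"
    by (rule le_less_trans[OF _ fin(2)]) (intro nn_integral_mono ennreal_leI, use le in auto)
  have "?N f + ?N (\<lambda>x. - l x) = (\<integral>\<^sup>+x. ennreal (f x) + ennreal (- l x) \<partial>\<eta>)"
    by (rule nn_integral_add[symmetric]) auto
  also have "\<dots> = (\<integral>\<^sup>+x. (ennreal (f x - l x) + ennreal (- f x)) + ennreal (l x) \<partial>\<eta>)"
  proof (rule nn_integral_cong)
    fix x
    consider "0 \<le> l x" | "l x \<le> 0" "0 \<le> f x" | "l x \<le> 0" "f x \<le> 0" using le[of x] by linarith
    then show "ennreal (f x) + ennreal (- l x) = (ennreal (f x - l x) + ennreal (- f x)) + ennreal (l x)"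
      using le[of x] by cases (simp_all add: ennreal_neg flip: ennreal_plus)
  qed
  also have "\<dots> = (?N (\<lambda>x. f x - l x) + ?N (\<lambda>x. - f x)) + ?N l"
    by (subst nn_integral_add, simp, simp, subst nn_integral_add) auto
  finally have eq: "?N f + ?N (\<lambda>x. - l x) = (?N (\<lambda>x. f x - l x) + ?N (\<lambda>x. - f x)) + ?N l" .
  obtain a where a: "?N l = ennreal a" "a \<ge> 0" using fin(1) by (cases "?N l") auto
  obtain b where b: "?N (\<lambda>x. - l x) = ennreal b" "b \<ge> 0" using fin(2) by (cases "?N (\<lambda>x. - l x)") auto
  obtain c where c: "?N (\<lambda>x. - f x) = ennreal c" "c \<ge> 0" using fin2 by (cases "?N (\<lambda>x. - f x)") auto
  have int: "(\<integral>x. l x \<partial>\<eta>) = a - b"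
    using real_lebesgue_integral_def[OF l] a b by simp
  show ?thesis
  proof (cases "?N f")
    case (real p)
    obtain q where q: "?N (\<lambda>x. f x - l x) = ennreal q" "q \<ge> 0"
    proof (cases "?N (\<lambda>x. f x - l x)")
      case top
      then show ?thesis using eq real b by (simp flip: ennreal_plus)
    qed auto
    have "p + b = q + c + a" using eq real q a b c
      by (simp flip: ennreal_plus)
    then show ?thesis unfolding ext_integral_def using real q a b c int by (simp add: enn2ereal_ennreal)
  next
    case top
    then have "?N (\<lambda>x. f x - l x) = top"
      using eq a b c by (cases "?N (\<lambda>x. f x - l x)") (auto simp flip: ennreal_plus)
    then show ?thesis unfolding ext_integral_def using top c int
      by (simp add: enn2ereal_ennreal enn2ereal_top)
  qed
qed

lemma ext_integral_integrable:
  assumes "integrable \<eta> f"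
  shows "ext_integral \<eta> f = ereal (\<integral>x. f x \<partial>\<eta>)"
proof -
  have "ext_integral \<eta> f = enn2ereal (\<integral>\<^sup>+x. ennreal (f x - f x) \<partial>\<eta>) + ereal (\<integral>x. f x \<partial>\<eta>)"
    by (rule ext_integral_above_integrable) (use assms in auto)
  also have "\<dots> = ereal (\<integral>x. f x \<partial>\<eta>)" by (simp add: zero_ennreal.rep_eq)
  finally show ?thesis .
qed

lemma convex_hinge: "convex_on UNIV (\<lambda>x::real. max (a + b * x) 0)"
proof (rule convex_onI)
  fix t x y :: real assume t: "0 < t" "t < 1"
  have "a + b * ((1 - t) * x + t * y) = (1 - t) * (a + b * x) + t * (a + b * y)" by algebra
  also have "\<dots> \<le> (1 - t) * max (a + b * x) 0 + t * max (a + b * y) 0"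
    using t by (intro add_mono mult_left_mono) auto
  finally show "max (a + b * ((1 - t) *\<^sub>R x + t *\<^sub>R y)) 0 \<le> (1 - t) * max (a + b * x) 0 + t * max (a + b * y) 0"
    using t by auto
qed auto

lemma convex_put_payoff: "convex_on UNIV (\<lambda>x::real. max (k - x) 0)"
  using convex_hinge[of k "-1"] by simp

lemma convex_affine: "convex_on UNIV (\<lambda>x::real. a + b * x)"
proof (rule convex_onI)
  fix t x y :: real
  have "a + b * ((1 - t) * x + t * y) = (1 - t) * (a + b * x) + t * (a + b * y)" by algebra
  then show "a + b * ((1 - t) *\<^sub>R x + t *\<^sub>R y) \<le> (1 - t) * (a + b * x) + t * (a + b * y)" by simp
qed auto

lemma le_cdD:
  assumes "le_cd \<eta> \<theta>" "fin_moment \<eta>" "fin_moment \<theta>"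
  shows le_cd_put: "put \<eta> k \<le> put \<theta> k" and le_cd_mass: "mass \<eta> = mass \<theta>"
proof -
  have *: "(\<integral>x. f x \<partial>\<eta>) \<le> (\<integral>x. f x \<partial>\<theta>)"
    if "convex_on UNIV f" "antimono f" "integrable \<eta> f" "integrable \<theta> f" for f :: "real \<Rightarrow> real"
    using assms(1) that unfolding le_cd_def by (metis ext_integral_integrable ereal_less_eq(3))
  show "put \<eta> k \<le> put \<theta> k" unfolding put_def
    by (rule *) (use assms in \<open>auto intro!: convex_put_payoff fin_momentD simp: antimono_def\<close>)
  have "c * mass \<eta> \<le> c * mass \<theta>" for c :: real
    using *[of "\<lambda>_. c"] convex_affine[of c 0] fin_momentD(3,5)[OF assms(2)] fin_momentD(3,5)[OF assms(3)]
    by (auto simp: antimono_def mult.commute)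
  from this[of 1] this[of "-1"] show "mass \<eta> = mass \<theta>" by simp
qed

text \<open>
  The payoff \<open>max (a - b * x) 0\<close> is a multiple of a put payoff, and \<open>a - b * x\<close> is the limit of the payoffs
  \<open>max (a + n - b * x) 0\<close> minus the cash amount \<open>n\<close>. The cash amounts cancel because the masses agree.
\<close>

lemma affine_integral_le:
  assumes \<eta>: "fin_moment \<eta>" and \<theta>: "fin_moment \<theta>" and mass: "mass \<eta> = mass \<theta>"
    and puts: "\<And>k. put \<eta> k \<le> put \<theta> k" and b: "0 \<le> b"
  shows hinge_integral_le: "(\<integral>x. max (a - b * x) 0 \<partial>\<eta>) \<le> (\<integral>x. max (a - b * x) 0 \<partial>\<theta>)"
    and "(\<integral>x. a - b * x \<partial>\<eta>) \<le> (\<integral>x. a - b * x \<partial>\<theta>)"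
proof -
  note sp = fin_momentD(3)[OF \<eta>] fin_momentD(3)[OF \<theta>]
  show hinge: "(\<integral>x. max (a - b * x) 0 \<partial>\<eta>) \<le> (\<integral>x. max (a - b * x) 0 \<partial>\<theta>)" for a
  proof (cases "b = 0")
    case True
    then show ?thesis using mass sp by simp
  next
    case False
    have "max (a - b * x) 0 = b * max (a / b - x) 0" for x
      using b False by (simp add: max_mult_distrib_left right_diff_distrib)
    then show ?thesis using puts[of "a / b"] b unfolding put_def by (simp add: mult_left_mono)
  qed
  have lim: "(\<lambda>n. (\<integral>x. max (a + real n - b * x) 0 \<partial>\<xi>) - real n * mass \<xi>) \<longlonglongrightarrow> (\<integral>x. a - b * x \<partial>\<xi>)"
    if \<xi>: "fin_moment \<xi>" for \<xi>
  proof -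
    have i: "integrable \<xi> (\<lambda>x. max (a + real n - b * x) 0)" for n
      using fin_momentD(8)[OF \<xi>, of "a + real n" "- b"] by simp
    have "(\<lambda>n. \<integral>x. max (a + real n - b * x) 0 - real n \<partial>\<xi>) \<longlonglongrightarrow> (\<integral>x. a - b * x \<partial>\<xi>)"
    proof (rule integral_dominated_convergence[where w = "\<lambda>x. \<bar>a - b * x\<bar>"])
      show "integrable \<xi> (\<lambda>x. \<bar>a - b * x\<bar>)" using fin_momentD(7)[OF \<xi>, of a "- b"]
        by (intro integrable_abs) simp
      show "AE x in \<xi>. (\<lambda>n. max (a + real n - b * x) 0 - real n) \<longlonglongrightarrow> a - b * x"
      proof (intro AE_I2 tendsto_eventually)
        fix x
        show "\<forall>\<^sub>F n in sequentially. max (a + real n - b * x) 0 - real n = a - b * x"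
          using eventually_ge_at_top[of "nat \<lceil>b * x - a\<rceil>"]
          by eventually_elim (auto simp: max_def; linarith)
      qed
      show "AE x in \<xi>. norm (max (a + real n - b * x) 0 - real n) \<le> \<bar>a - b * x\<bar>" for n
        by (intro AE_I2) (auto simp: max_def)
      show "(\<lambda>x. max (a + real n - b * x) 0 - real n) \<in> borel_measurable \<xi>" for n
        by (intro fin_moment_measurable[OF \<xi>]) measurable
    qed (intro fin_moment_measurable[OF \<xi>], measurable)
    moreover have "(\<integral>x. max (a + real n - b * x) 0 - real n \<partial>\<xi>) =
      (\<integral>x. max (a + real n - b * x) 0 \<partial>\<xi>) - real n * mass \<xi>" for n
      using i[of n] fin_momentD(3,5)[OF \<xi>] by (subst Bochner_Integration.integral_diff) auto
    ultimately show ?thesis by simp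
  qed
  show "(\<integral>x. a - b * x \<partial>\<eta>) \<le> (\<integral>x. a - b * x \<partial>\<theta>)"
    by (rule LIMSEQ_le[OF lim[OF \<eta>] lim[OF \<theta>]]) (use hinge[of "a + real n" for n] mass in auto)
qed

text \<open>
  \<open>F N\<close> is the maximum of the tangents \<open>t 0, ..., t N\<close>. Consecutive tangents cross between their points of
  contact, so the maximum is the last tangent plus the positive parts of the consecutive differences.
  As the slopes increase, these positive parts are multiples of put payoffs.
\<close>

lemma tangent_hinges:
  fixes f :: "real \<Rightarrow> real" and p s :: "nat \<Rightarrow> real"
  defines "t \<equiv> \<lambda>i x. f (p i) + s i * (x - p i)"
  defines "F \<equiv> \<lambda>N x. t N x + (\<Sum>i<N. max (t i x - t (Suc i) x) 0)"
  assumes p: "\<And>i. p i < p (Suc i)" and s: "\<And>i y. f (p i) + s i * (y - p i) \<le> f y"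
  shows tangent_slopes: "s i \<le> s (Suc i)"
    and tangent_le_hinges: "j \<le> N \<Longrightarrow> t j x \<le> F N x" and hinges_le: "F N x \<le> f x"
proof -
  show sl: "s i \<le> s (Suc i)" for i
  proof -
    have "s i * (p (Suc i) - p i) \<le> s (Suc i) * (p (Suc i) - p i)"
      using s[of i "p (Suc i)"] s[of "Suc i" "p i"] by (simp add: algebra_simps)
    then show ?thesis using p[of i] by simp
  qed
  have tf: "t i x \<le> f x" for i x unfolding t_def by (rule s)
  have diff: "t i x - t (Suc i) x = t i y - t (Suc i) y + (s (Suc i) - s i) * (y - x)" for i x y
    unfolding t_def by algebra
  have left: "t i x \<ge> t (Suc i) x" if "x \<le> p i" for i x
  proof -
    have "t i (p i) \<ge> t (Suc i) (p i)" using tf[of "Suc i" "p i"] by (simp add: t_def)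
    moreover have "(s (Suc i) - s i) * (p i - x) \<ge> 0" using sl[of i] that by simp
    ultimately show ?thesis using diff[of i x "p i"] by linarith
  qed
  have right: "t i x \<le> t (Suc i) x" if "p (Suc i) \<le> x" for i x
  proof -
    have "t (Suc i) (p (Suc i)) \<ge> t i (p (Suc i))" using tf[of i "p (Suc i)"] by (simp add: t_def)
    moreover have "(s (Suc i) - s i) * (p (Suc i) - x) \<le> 0" using sl[of i] that
      by (simp add: mult_nonneg_nonpos)
    ultimately show ?thesis using diff[of i x "p (Suc i)"] by linarith
  qed
  have step: "F (Suc N) x = F N x + max (t (Suc N) x - t N x) 0" for N x
    unfolding F_def by (simp add: max_def)
  show "j \<le> N \<Longrightarrow> t j x \<le> F N x" for j N
  proof (induction N)
    case 0 then show ?case by (simp add: F_def)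
  next
    case (Suc N)
    show ?case
    proof (cases "j \<le> N")
      case True then show ?thesis using Suc.IH step[of N x] by simp
    next
      case False
      then have "j = Suc N" using Suc.prems by simp
      then show ?thesis unfolding F_def by (simp add: sum_nonneg)
    qed
  qed
  have pm: "p i \<le> p j" if "i \<le> j" for i j
    using lift_Suc_mono_le[of p i j] p that less_imp_le by blast
  show "F N x \<le> f x" for N
  proof (induction N)
    case 0 then show ?case using tf by (simp add: F_def)
  next
    case (Suc N)
    show ?case
    proof (cases "t (Suc N) x \<le> t N x")
      case True then show ?thesis using Suc step[of N x] by simp
    next
      case False
      then have "p N < x" using left[of x N] by linarith
      then have "max (t i x - t (Suc i) x) 0 = 0" if "i < N" for i
        using right[of i x] pm[of "Suc i" N] that by (simp add: max_def)
      then have "F N x = t N x" unfolding F_def by simp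
      then show ?thesis using step[of N x] False tf[of "Suc N" x] by simp
    qed
  qed
qed

text \<open>
  Put functions decide the convex decreasing order between measures of equal mass: a convex decreasing
  function is the pointwise limit from below of maxima of finitely many tangents, whose integrals are
  controlled by puts, and Fatou's lemma passes to the limit.
\<close>

lemma le_cdI:
  assumes \<eta>: "fin_moment \<eta>" and \<theta>: "fin_moment \<theta>" and mass: "mass \<eta> = mass \<theta>"
    and puts: "\<And>k. put \<eta> k \<le> put \<theta> k"
  shows "le_cd \<eta> \<theta>"
  unfolding le_cd_def
proof (intro allI impI, elim conjE)
  fix f :: "real \<Rightarrow> real" assume f: "convex_on UNIV f" "antimono f"
  define sg where "sg x = (SOME s. \<forall>y. f x + s * (y - x) \<le> f y)" for x
  have sg: "f x + sg x * (y - x) \<le> f y" for x y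
  proof -
    have "\<exists>s. \<forall>y. f x + s * (y - x) \<le> f y" using convex_supporting_line[OF f(1)] by metis
    from someI_ex[OF this] show ?thesis unfolding sg_def by blast
  qed
  have sgneg: "sg x \<le> 0" for x
    using sg[of x "x + 1"] antimonoD[OF f(2), of x "x + 1"] by simp
  define l where "l x = f 0 + sg 0 * x" for x
  have lf: "l x \<le> f x" for x using sg[of 0 x] by (simp add: l_def)
  \<comment> \<open>The grid covers \<open>[-(n+1), n+1]\<close> with mesh \<open>1/(n+1)\<close>. It contains 0, so that all approximations lie above
    the tangent \<open>l\<close> at 0, the integrable lower bound for Fatou's lemma.\<close>
  define p where "p n i = (real i - real (Suc n)^2) / real (Suc n)" for n i
  define s where "s n i = sg (p n i)" for n i
  define N where "N n = 2 * (Suc n)^2" for n :: nat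
  define t where "t n i x = f (p n i) + s n i * (x - p n i)" for n i x
  define F where "F n x = t n (N n) x + (\<Sum>i<N n. max (t n i x - t n (Suc i) x) 0)" for n x
  have pS: "p n i < p n (Suc i)" for n i unfolding p_def by (intro divide_strict_right_mono) auto
  have Tsl: "s n i \<le> s n (Suc i)" for n i
    unfolding s_def by (rule tangent_slopes[of "p n" f, OF pS sg])
  have Tge: "j \<le> N n \<Longrightarrow> t n j x \<le> F n x" for j n x
    unfolding F_def t_def s_def by (rule tangent_le_hinges[of "p n" f, OF pS sg])
  have Tle: "F n x \<le> f x" for n x
    unfolding F_def t_def s_def by (rule hinges_le[of "p n" f, OF pS sg])
  have lF: "l x \<le> F n x" for n x
  proof -
    have "p n ((Suc n)^2) = 0" by (simp add: p_def)
    then have "l x = t n ((Suc n)^2) x" by (simp add: l_def t_def s_def)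
    also have "\<dots> \<le> F n x" by (rule Tge) (simp add: N_def)
    finally show ?thesis .
  qed
  have taff: "t n i x = (f (p n i) - s n i * p n i) - (- s n i) * x" for n i x
    by (simp add: t_def algebra_simps)
  have tdiff: "t n i x - t n (Suc i) x = ((f (p n i) - s n i * p n i) - (f (p n (Suc i)) - s n (Suc i) * p n (Suc i)))
      - (s n (Suc i) - s n i) * x" for n i x
    by (simp add: t_def algebra_simps)
  have it: "integrable \<xi> (t n i)" if "fin_moment \<xi>" for \<xi> n i
    using fin_momentD(7)[OF that, of "f (p n i) - s n i * p n i" "s n i"] by (simp add: t_def[abs_def] algebra_simps)
  have ih: "integrable \<xi> (\<lambda>x. max (t n i x - t n (Suc i) x) 0)" if "fin_moment \<xi>" for \<xi> n i
    by (intro integrable_max Bochner_Integration.integrable_diff it that) simp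
  have iF: "integrable \<xi> (F n)" if "fin_moment \<xi>" for \<xi> n
    unfolding F_def[abs_def] using it[OF that] ih[OF that] by (intro Bochner_Integration.integrable_add Bochner_Integration.integrable_sum) auto
  have intF: "(\<integral>x. F n x \<partial>\<xi>) = (\<integral>x. t n (N n) x \<partial>\<xi>) + (\<Sum>i<N n. \<integral>x. max (t n i x - t n (Suc i) x) 0 \<partial>\<xi>)"
    if "fin_moment \<xi>" for \<xi> n
    unfolding F_def using it[OF that] ih[OF that]
    by (subst Bochner_Integration.integral_add) (auto intro!: Bochner_Integration.integrable_sum Bochner_Integration.integral_sum)
  have F_le: "(\<integral>x. F n x \<partial>\<eta>) \<le> (\<integral>x. F n x \<partial>\<theta>)" for n
    unfolding intF[OF \<eta>] intF[OF \<theta>]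
  proof (intro add_mono sum_mono)
    show "(\<integral>x. t n (N n) x \<partial>\<eta>) \<le> (\<integral>x. t n (N n) x \<partial>\<theta>)"
      unfolding taff by (rule affine_integral_le[OF \<eta> \<theta> mass puts]) (use sgneg in \<open>auto simp: s_def\<close>)
    show "(\<integral>x. max (t n i x - t n (Suc i) x) 0 \<partial>\<eta>) \<le> (\<integral>x. max (t n i x - t n (Suc i) x) 0 \<partial>\<theta>)" for i
      unfolding tdiff by (rule hinge_integral_le[OF \<eta> \<theta> mass puts]) (use Tsl in auto)
  qed
  have conv: "(\<lambda>n. F n x) \<longlonglongrightarrow> f x" for x
  proof (rule tendsto_sandwich)
    show "\<forall>\<^sub>F n in sequentially. F n x \<le> f x" using Tle by simp
    show "(\<lambda>n. f x - \<bar>sg (x - 1)\<bar> / real (Suc n)) \<longlonglongrightarrow> f x"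
      using tendsto_diff[OF tendsto_const LIMSEQ_Suc[OF lim_const_over_n[of "\<bar>sg (x - 1)\<bar>"]], of "f x"] by simp
    show "\<forall>\<^sub>F n in sequentially. f x - \<bar>sg (x - 1)\<bar> / real (Suc n) \<le> F n x"
      using eventually_ge_at_top[of "nat \<lceil>\<bar>x\<bar>\<rceil>"]
    proof eventually_elim
      case (elim n)
      then have xn: "\<bar>x\<bar> \<le> real (Suc n)" by linarith
      define m where "m = real (Suc n)"
      have m: "m > 0" "\<bar>x\<bar> \<le> m" using xn by (auto simp: m_def)
      \<comment> \<open>The last grid point that is not to the right of \<open>x\<close>.\<close>
      define i where "i = nat \<lfloor>m * x + m^2\<rfloor>"
      have nn: "0 \<le> m * x + m^2"
      proof -
        have "0 \<le> m * (x + m)" using m by (intro mult_nonneg_nonneg) auto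
        then show ?thesis by (simp add: algebra_simps power2_eq_square)
      qed
      have i: "real i \<le> m * x + m^2" "m * x + m^2 < real i + 1" unfolding i_def using nn by linarith+
      have pi: "p n i = (real i - m^2) / m" by (simp add: p_def m_def)
      have xp: "x - p n i = (m * x + m^2 - real i) / m" unfolding pi using m by (simp add: field_simps)
      have "0 \<le> x - p n i" "x - p n i \<le> 1 / m"
        unfolding xp using i m by (auto intro!: divide_right_mono divide_nonneg_pos)
      then have "p n i \<le> x" "x - p n i \<le> 1 / m" by auto
      have "1 / m \<le> 1" by (simp add: m_def)
      then have "x - 1 \<le> p n i" using \<open>x - p n i \<le> 1 / m\<close> by simp
      have "m * x + m^2 \<le> 2 * m^2" using m mult_left_mono[of x m m] by (simp add: power2_eq_square)
      then have "real i \<le> real (N n)" using i(1) by (simp add: N_def m_def)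
      then have iN: "i \<le> N n" by simp
      have "sg (x - 1) \<le> s n i"
      proof (cases "p n i = x - 1")
        case False
        then have "0 < p n i - (x - 1)" using \<open>x - 1 \<le> p n i\<close> by simp
        moreover have "sg (x - 1) * (p n i - (x - 1)) \<le> s n i * (p n i - (x - 1))"
          using sg[of "x - 1" "p n i"] sg[of "p n i" "x - 1"] by (simp add: s_def algebra_simps)
        ultimately show ?thesis by simp
      qed (simp add: s_def)
      have "- (\<bar>sg (x - 1)\<bar> / m) \<le> - (\<bar>sg (x - 1)\<bar> * (x - p n i))"
        using mult_left_mono[OF \<open>x - p n i \<le> 1 / m\<close>, of "\<bar>sg (x - 1)\<bar>"] by simp
      also have "\<dots> \<le> s n i * (x - p n i)"
        using mult_right_mono[of "- \<bar>sg (x - 1)\<bar>" "s n i" "x - p n i"] \<open>sg (x - 1) \<le> s n i\<close> \<open>p n i \<le> x\<close> by simp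
      finally have "f x - \<bar>sg (x - 1)\<bar> / m \<le> t n i x"
        using antimonoD[OF f(2) \<open>p n i \<le> x\<close>] by (simp add: t_def)
      also have "\<dots> \<le> F n x" by (rule Tge[OF iN])
      finally show ?case by (simp add: m_def)
    qed
  qed auto
  have il: "integrable \<xi> l" if "fin_moment \<xi>" for \<xi>
    unfolding l_def[abs_def] by (rule fin_momentD(7)[OF that])
  have ext: "ext_integral \<xi> f = enn2ereal (\<integral>\<^sup>+x. ennreal (f x - l x) \<partial>\<xi>) + ereal (\<integral>x. l x \<partial>\<xi>)"
    if "fin_moment \<xi>" for \<xi>
    by (intro ext_integral_above_integrable il[OF that] lf fin_moment_measurable[OF that] convex_on_measurable f(1))
  have [measurable]: "f \<in> borel_measurable \<theta>" "f \<in> borel_measurable \<eta>"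
    by (intro fin_moment_measurable[OF \<theta>] fin_moment_measurable[OF \<eta>] convex_on_measurable f(1))+
  have [measurable]: "l \<in> borel_measurable \<theta>" "l \<in> borel_measurable \<eta>"  "F n \<in> borel_measurable \<eta>" for n
    by (intro borel_measurable_integrable il iF \<eta> \<theta>)+
  show "ext_integral \<eta> f \<le> ext_integral \<theta> f"
  proof (cases "\<integral>\<^sup>+x. ennreal (f x - l x) \<partial>\<theta>")
    case top
    then show ?thesis unfolding ext[OF \<theta>] by (simp add: enn2ereal_top)
  next
    case (real q)
    have int\<theta>: "integrable \<theta> (\<lambda>x. f x - l x)"
      by (rule integrableI_nonneg) (use real lf in auto)
    have q: "q = (\<integral>x. f x - l x \<partial>\<theta>)"
    proof -
      have "ennreal q = ennreal (\<integral>x. f x - l x \<partial>\<theta>)"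
        using real nn_integral_eq_integral[OF int\<theta>] lf by simp
      moreover have "0 \<le> (\<integral>x. f x - l x \<partial>\<theta>)" by (rule integral_nonneg_AE) (use lf in auto)
      ultimately show ?thesis using real by (simp add: ennreal_inj)
    qed
    have "(\<integral>x. F n x \<partial>\<eta>) - (\<integral>x. l x \<partial>\<eta>) \<le> q + (\<integral>x. l x \<partial>\<theta>) - (\<integral>x. l x \<partial>\<eta>)" for n
    proof -
      have "(\<integral>x. F n x \<partial>\<theta>) \<le> (\<integral>x. (f x - l x) + l x \<partial>\<theta>)"
        by (intro integral_mono iF \<theta> Bochner_Integration.integrable_add int\<theta> il) (use Tle in auto)
      also have "\<dots> = q + (\<integral>x. l x \<partial>\<theta>)" unfolding q by (rule Bochner_Integration.integral_add[OF int\<theta> il[OF \<theta>]])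
      finally show ?thesis using F_le[of n] by simp
    qed
    note bd = this
    have "(\<integral>\<^sup>+x. ennreal (f x - l x) \<partial>\<eta>) = (\<integral>\<^sup>+x. liminf (\<lambda>n. ennreal (F n x - l x)) \<partial>\<eta>)"
    proof (rule nn_integral_cong)
      fix x
      have "(\<lambda>n. ennreal (F n x - l x)) \<longlonglongrightarrow> ennreal (f x - l x)"
        by (intro tendsto_ennrealI tendsto_intros conv)
      then show "ennreal (f x - l x) = liminf (\<lambda>n. ennreal (F n x - l x))"
        by (rule lim_imp_Liminf[OF sequentially_bot, symmetric])
    qed
    also have "\<dots> \<le> liminf (\<lambda>n. \<integral>\<^sup>+x. ennreal (F n x - l x) \<partial>\<eta>)"
      by (rule nn_integral_liminf) measurable
    also have "\<dots> = liminf (\<lambda>n. ennreal ((\<integral>x. F n x \<partial>\<eta>) - (\<integral>x. l x \<partial>\<eta>)))"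
    proof -
      have "(\<integral>\<^sup>+x. ennreal (F n x - l x) \<partial>\<eta>) = ennreal ((\<integral>x. F n x \<partial>\<eta>) - (\<integral>x. l x \<partial>\<eta>))" for n
        using iF[OF \<eta>] il[OF \<eta>] lF by (subst nn_integral_eq_integral) auto
      then show ?thesis by simp
    qed
    also have "\<dots> \<le> liminf (\<lambda>n. ennreal (q + (\<integral>x. l x \<partial>\<theta>) - (\<integral>x. l x \<partial>\<eta>)))"
      by (intro Liminf_mono always_eventually allI ennreal_leI bd)
    also have "\<dots> = ennreal (q + (\<integral>x. l x \<partial>\<theta>) - (\<integral>x. l x \<partial>\<eta>))" by (simp add: Liminf_const)
    finally have N: "(\<integral>\<^sup>+x. ennreal (f x - l x) \<partial>\<eta>) \<le> ennreal (q + (\<integral>x. l x \<partial>\<theta>) - (\<integral>x. l x \<partial>\<eta>))" .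
    have nn: "0 \<le> q + (\<integral>x. l x \<partial>\<theta>) - (\<integral>x. l x \<partial>\<eta>)"
    proof -
      have "(\<integral>x. l x \<partial>\<eta>) \<le> (\<integral>x. F 0 x \<partial>\<eta>)"
        by (intro integral_mono il iF \<eta> lF)
      then show ?thesis using bd[of 0] by simp
    qed
    have "enn2ereal (\<integral>\<^sup>+x. ennreal (f x - l x) \<partial>\<eta>) \<le> ereal (q + (\<integral>x. l x \<partial>\<theta>) - (\<integral>x. l x \<partial>\<eta>))"
      using N nn unfolding less_eq_ennreal.rep_eq by (simp add: enn2ereal_ennreal)
    then have "ext_integral \<eta> f \<le> ereal (q + (\<integral>x. l x \<partial>\<theta>) - (\<integral>x. l x \<partial>\<eta>)) + ereal (\<integral>x. l x \<partial>\<eta>)"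
      unfolding ext[OF \<eta>] by (rule add_right_mono)
    also have "\<dots> = ext_integral \<theta> f"
      unfolding ext[OF \<theta>] using real by (simp add: enn2ereal_ennreal)
    finally show ?thesis .
  qed
qed

lemma put_increment_bounds:
  assumes \<theta>: "fin_moment \<theta>" and h: "0 < h"
  shows "h * measure \<theta> {..x} \<le> put \<theta> (x + h) - put \<theta> x"
    and "put \<theta> (x + h) - put \<theta> x \<le> h * measure \<theta> {..x + h}"
proof -
  interpret finite_measure \<theta> using fin_momentD(1)[OF \<theta>] .
  have sets: "{..a} \<in> sets \<theta>" for a :: real using fin_momentD(2)[OF \<theta>] by simp
  have ind: "integrable \<theta> (\<lambda>y. h * indicator {..a} y :: real)" "(\<integral>y. h * indicator {..a} y \<partial>\<theta>) = h * measure \<theta> {..a}" for a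
    using sets[of a] fin_momentD(3)[OF \<theta>] by (auto intro!: integrable_real_indicator simp: less_top[symmetric])
  have diff: "put \<theta> (x + h) - put \<theta> x = (\<integral>y. max (x + h - y) 0 - max (x - y) 0 \<partial>\<theta>)"
    unfolding put_def by (rule Bochner_Integration.integral_diff[symmetric]; rule fin_momentD(6)[OF \<theta>])
  have int: "integrable \<theta> (\<lambda>y. max (x + h - y) 0 - max (x - y) 0)"
    by (intro Bochner_Integration.integrable_diff fin_momentD(6)[OF \<theta>])
  show "h * measure \<theta> {..x} \<le> put \<theta> (x + h) - put \<theta> x"
    unfolding diff ind(2)[symmetric] using h
    by (intro integral_mono ind(1) int) (auto simp: indicator_def max_def)
  show "put \<theta> (x + h) - put \<theta> x \<le> h * measure \<theta> {..x + h}"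
    unfolding diff ind(2)[symmetric] using h
    by (intro integral_mono ind(1) int) (auto simp: indicator_def max_def)
qed

text \<open>
  The right derivative of a put function is the distribution function.
\<close>

lemma measure_eqI_put:
  assumes \<theta>: "fin_moment \<theta>" and \<xi>: "fin_moment \<xi>" and mass: "mass \<theta> = mass \<xi>"
    and put: "\<And>k. put \<theta> k = put \<xi> k"
  shows "\<theta> = \<xi>"
proof -
  have le: "measure \<theta> {..x} \<le> measure \<xi> {..x}"
    if \<theta>: "fin_moment \<theta>" and \<xi>: "fin_moment \<xi>" and put: "\<And>k. put \<theta> k = put \<xi> k" for x and \<theta> \<xi>
  proof -
    interpret finite_borel_measure \<xi>
      using fin_momentD(1,2)[OF \<xi>] by (simp add: finite_borel_measure_def finite_borel_measure_axioms_def)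
    have lim: "(cdf \<xi> \<longlongrightarrow> cdf \<xi> x) (at_right x)"
      using cdf_is_right_cont[of x] by (simp add: continuous_within)
    have "measure \<theta> {..x} \<le> cdf \<xi> x"
    proof (rule tendsto_lowerbound[OF lim])
      show "\<forall>\<^sub>F y in at_right x. measure \<theta> {..x} \<le> cdf \<xi> y"
        using eventually_at_right_less[of x]
      proof eventually_elim
        case (elim y)
        have "(y - x) * measure \<theta> {..x} \<le> (y - x) * measure \<xi> {..y}"
        proof -
          have "(y - x) * measure \<theta> {..x} \<le> put \<theta> y - put \<theta> x"
            using put_increment_bounds(1)[OF \<theta>, of "y - x" x] elim by simp
          also have "\<dots> = put \<xi> y - put \<xi> x" by (simp only: put)
          also have "\<dots> \<le> (y - x) * measure \<xi> {..y}"
            using put_increment_bounds(2)[OF \<xi>, of "y - x" x] elim by simp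
          finally show ?thesis .
        qed
        then have "measure \<theta> {..x} \<le> measure \<xi> {..y}" using elim by (simp add: mult_le_cancel_left_pos)
        then show ?case by (simp add: cdf_def)
      qed
    qed simp
    then show ?thesis by (simp add: cdf_def)
  qed
  have cdf: "measure \<theta> {..x} = measure \<xi> {..x}" for x
    using le[OF \<theta> \<xi> put, of x] le[OF \<xi> \<theta> put[symmetric], of x] by simp
  interpret T: finite_measure \<theta> using fin_momentD(1)[OF \<theta>] .
  interpret X: finite_measure \<xi> using fin_momentD(1)[OF \<xi>] .
  have compl: "{x<..} = UNIV - {..x}" for x :: real by auto
  have "measure \<theta> {x<..} = measure \<xi> {x<..}" for x
    unfolding compl using fin_momentD(2,3)[OF \<theta>] fin_momentD(2,3)[OF \<xi>] mass cdf[of x]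
      T.finite_measure_compl[of "{..x}"] X.finite_measure_compl[of "{..x}"] by simp
  then show ?thesis
    using fin_momentD(2)[OF \<theta>] fin_momentD(2)[OF \<xi>]
    by (intro measure_eqI_lessThan) (auto simp: T.emeasure_eq_measure X.emeasure_eq_measure)
qed

text \<open>
  The difference is the put function of the nonnegative measure \<open>\<xi> - \<theta>\<close>.
\<close>

lemma convex_on_put_diff_of_le:
  assumes \<theta>: "fin_moment \<theta>" and \<xi>: "fin_moment \<xi>" and le: "\<theta> \<le> \<xi>"
  shows "convex_on UNIV (\<lambda>k. put \<xi> k - put \<theta> k)"
proof (rule convex_onI)
  fix t x y :: real assume t: "0 < t" "t < 1"
  define z where "z = (1 - t) * x + t * y"
  define f where "f w = ((1 - t) * max (x - w) 0 + t * max (y - w) 0) - max (z - w) 0" for w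
  have f0: "0 \<le> f w" for w
  proof -
    have "max (w' - w) 0 = max (- w + 1 * w') 0" for w' by simp
    then have "max (z - w) 0 \<le> (1 - t) * max (x - w) 0 + t * max (y - w) 0"
      using convex_onD[OF convex_hinge[of "- w" 1], of t x y] t by (simp add: z_def)
    then show ?thesis by (simp add: f_def)
  qed
  have int: "integrable \<zeta> f" and fint: "(\<integral>w. f w \<partial>\<zeta>) = (1 - t) * put \<zeta> x + t * put \<zeta> y - put \<zeta> z"
    if \<zeta>: "fin_moment \<zeta>" for \<zeta>
    unfolding f_def[abs_def] put_def using fin_momentD(6)[OF \<zeta>] by auto
  have "ennreal (\<integral>w. f w \<partial>\<theta>) \<le> ennreal (\<integral>w. f w \<partial>\<xi>)"
    using nn_integral_mono_measure[of \<theta> \<xi> "\<lambda>w. ennreal (f w)"] le fin_momentD(2)[OF \<theta>] fin_momentD(2)[OF \<xi>]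
      nn_integral_eq_integral[OF int[OF \<theta>]] nn_integral_eq_integral[OF int[OF \<xi>]] f0
    by simp
  moreover have "0 \<le> (\<integral>w. f w \<partial>\<xi>)" by (rule integral_nonneg_AE) (use f0 in auto)
  ultimately have "(\<integral>w. f w \<partial>\<theta>) \<le> (\<integral>w. f w \<partial>\<xi>)" by simp
  then show "put \<xi> ((1 - t) *\<^sub>R x + t *\<^sub>R y) - put \<theta> ((1 - t) *\<^sub>R x + t *\<^sub>R y)
      \<le> (1 - t) * (put \<xi> x - put \<theta> x) + t * (put \<xi> y - put \<theta> y)"
    unfolding fint[OF \<theta>] fint[OF \<xi>] by (simp add: z_def algebra_simps)
qed auto

text \<open>
  For every competitor \<open>\<theta>'\<close> of the shadow, \<open>put \<xi> - put \<theta>'\<close> is a convex function below \<open>put \<xi> - put \<eta>\<close>. Hence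
  a measure \<open>\<theta> \<le> \<xi>\<close> for which \<open>put \<xi> - put \<theta>\<close> dominates all such functions has the smallest put function
  among the competitors. In other words, the put function of the shadow is \<open>put \<xi>\<close> minus the convex minorant
  of \<open>put \<xi> - put \<eta>\<close>.
\<close>

lemma shadow_eqI:
  assumes \<eta>: "fin_moment \<eta>" and \<xi>: "fin_moment \<xi>" and \<theta>: "fin_moment \<theta>"
    and mass: "mass \<theta> = mass \<eta>" and le: "\<theta> \<le> \<xi>" and put: "\<And>k. put \<eta> k \<le> put \<theta> k"
    and best: "\<And>g k. convex_on UNIV g \<Longrightarrow> (\<And>x. g x \<le> put \<xi> x - put \<eta> x) \<Longrightarrow> g k \<le> put \<xi> k - put \<theta> k"
  shows "shadow \<xi> \<eta> = \<theta>"
proof -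
  have cd: "le_cd \<eta> \<theta>" by (rule le_cdI[OF \<eta> \<theta> mass[symmetric] put])
  have pcd: "le_pcd \<eta> \<xi>"
    unfolding le_pcd_def
  proof (intro allI impI, elim conjE)
    fix f :: "real \<Rightarrow> real" assume f: "convex_on UNIV f" "antimono f" "\<forall>x. 0 \<le> f x"
    have pos: "ext_integral \<zeta> f = enn2ereal (\<integral>\<^sup>+x. ennreal (f x) \<partial>\<zeta>)" for \<zeta> :: "real measure"
      unfolding ext_integral_def using f(3) by (simp add: ennreal_neg zero_ennreal.rep_eq)
    have "ext_integral \<eta> f \<le> ext_integral \<theta> f" using cd f unfolding le_cd_def by blast
    also have "\<dots> \<le> ext_integral \<xi> f" unfolding pos less_eq_ennreal.rep_eq[symmetric]
      by (rule nn_integral_mono_measure[OF _ le]) (simp add: fin_momentD(2)[OF \<theta>] fin_momentD(2)[OF \<xi>])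
    finally show "ext_integral \<eta> f \<le> ext_integral \<xi> f" .
  qed
  have min: "le_cd \<theta> \<theta>'" if \<theta>': "fin_moment \<theta>'" "le_cd \<eta> \<theta>'" "\<theta>' \<le> \<xi>" for \<theta>'
  proof (rule le_cdI[OF \<theta> \<theta>'(1)])
    show "mass \<theta> = mass \<theta>'" using le_cd_mass[OF \<theta>'(2) \<eta> \<theta>'(1)] mass by simp
    show "put \<theta> k \<le> put \<theta>' k" for k
      using best[OF convex_on_put_diff_of_le[OF \<theta>'(1) \<xi> \<theta>'(3)], of k] le_cd_put[OF \<theta>'(2) \<eta> \<theta>'(1)] by simp
  qed
  have shadow: "is_shadow \<xi> \<eta> \<theta>"
    unfolding is_shadow_def using pcd \<theta> cd le min by blast
  show ?thesis unfolding shadow_def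
  proof (rule the_equality)
    show "is_shadow \<xi> \<eta> \<theta>" by (rule shadow)
  next
    fix \<theta>' assume "is_shadow \<xi> \<eta> \<theta>'"
    then have \<theta>': "fin_moment \<theta>'" "le_cd \<eta> \<theta>'" "\<theta>' \<le> \<xi>" "le_cd \<theta>' \<theta>"
      using \<theta> cd le unfolding is_shadow_def by blast+
    show "\<theta>' = \<theta>"
    proof (intro measure_eqI_put[OF \<theta>'(1) \<theta>])
      show "mass \<theta>' = mass \<theta>" by (rule le_cd_mass[OF \<theta>'(4,1) \<theta>])
      show "put \<theta>' k = put \<theta> k" for k
        using le_cd_put[OF \<theta>'(4,1) \<theta>, of k] le_cd_put[OF min[OF \<theta>'(1-3)] \<theta> \<theta>'(1), of k] by simp
    qed
  qed
qed

lemma put_nonneg: "0 \<le> put \<theta> k"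
  unfolding put_def by (rule integral_nonneg_AE) auto

lemma convex_on_put:
  assumes \<theta>: "fin_moment \<theta>"
  shows "convex_on UNIV (put \<theta>)"
proof (rule convex_onI)
  fix t x y :: real assume t: "0 < t" "t < 1"
  let ?z = "(1 - t) * x + t * y"
  have i: "integrable \<theta> (\<lambda>w. max (k - w) 0)" for k by (rule fin_momentD(6)[OF \<theta>])
  have "put \<theta> ?z \<le> (\<integral>w. (1 - t) * max (x - w) 0 + t * max (y - w) 0 \<partial>\<theta>)"
    unfolding put_def
  proof (rule integral_mono)
    fix w :: real
    have "max (w' - w) 0 = max (- w + 1 * w') 0" for w' by simp
    then show "max (?z - w) 0 \<le> (1 - t) * max (x - w) 0 + t * max (y - w) 0"
      using convex_onD[OF convex_hinge[of "- w" 1], of t x y] t by simp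
  qed (use i in auto)
  also have "\<dots> = (1 - t) * put \<theta> x + t * put \<theta> y" unfolding put_def using i by simp
  finally show "put \<theta> ((1 - t) *\<^sub>R x + t *\<^sub>R y) \<le> (1 - t) * put \<theta> x + t * put \<theta> y" by simp
qed auto

lemma le_cD:
  assumes le: "le_c \<eta> \<xi>" and \<eta>: "fin_moment \<eta>" and \<xi>: "fin_moment \<xi>"
  shows le_c_put: "put \<eta> k \<le> put \<xi> k" and le_c_mean: "(\<integral>x. x \<partial>\<eta>) = (\<integral>x. x \<partial>\<xi>)"
proof -
  have *: "(\<integral>x. f x \<partial>\<eta>) \<le> (\<integral>x. f x \<partial>\<xi>)"
    if "convex_on UNIV f" "integrable \<eta> f" "integrable \<xi> f" for f :: "real \<Rightarrow> real"
    using le that unfolding le_c_def by (metis ext_integral_integrable ereal_less_eq(3))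
  show "put \<eta> k \<le> put \<xi> k" unfolding put_def
    by (rule *) (intro convex_put_payoff fin_momentD(6) \<eta> \<xi>)+
  have "(\<integral>x. x \<partial>\<eta>) \<le> (\<integral>x. x \<partial>\<xi>)"
    using *[of "\<lambda>x. x"] convex_affine[of 0 1] fin_momentD(4)[OF \<eta>] fin_momentD(4)[OF \<xi>] by simp
  moreover have "(\<integral>x. - x \<partial>\<eta>) \<le> (\<integral>x. - x \<partial>\<xi>)"
    using *[of "\<lambda>x. - x"] convex_affine[of 0 "-1"] fin_momentD(4)[OF \<eta>] fin_momentD(4)[OF \<xi>] by simp
  ultimately show "(\<integral>x. x \<partial>\<eta>) = (\<integral>x. x \<partial>\<xi>)" by simp
qed

section \<open>Quantile functions\<close>

text \<open>
  The quantile function is the lower adjoint of the distribution function, because the latter is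
  right-continuous.
\<close>

lemma
  assumes fm: "finite_measure \<eta>" and sets: "sets \<eta> = sets borel" and u: "0 < u" "u < mass \<eta>"
  shows quantile_le_iff: "quantile \<eta> u \<le> x \<longleftrightarrow> u \<le> measure \<eta> {..x}"
proof -
  interpret finite_borel_measure \<eta>
    using fm sets by (simp add: finite_borel_measure_def finite_borel_measure_axioms_def)
  have space: "space \<eta> = UNIV" using sets_eq_imp_space_eq[OF sets] by simp
  define S where "S = {k. cdf \<eta> k < u}"
  have q: "quantile \<eta> u = Sup S" by (simp add: quantile_def S_def cdf_def)
  have mono: "cdf \<eta> x \<le> cdf \<eta> y" if "x \<le> y" for x y using cdf_nondecreasing[OF that] .
  have "\<forall>\<^sub>F k in at_bot. cdf \<eta> k < u" by (rule order_tendstoD(2)[OF cdf_lim_at_bot u(1)])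
  then obtain k\<^sub>0 where "cdf \<eta> k\<^sub>0 < u" by (metis eventually_at_bot_linorder order_refl)
  then have ne: "S \<noteq> {}" by (auto simp: S_def)
  have "\<forall>\<^sub>F k in at_top. u < cdf \<eta> k" by (rule order_tendstoD(1)[OF cdf_lim_at_top]) (use u space in simp)
  then obtain k\<^sub>1 where k1: "u < cdf \<eta> k\<^sub>1" by (metis eventually_at_top_linorder order_refl)
  have bdd: "bdd_above S"
  proof (rule bdd_aboveI[of _ k\<^sub>1])
    fix k assume "k \<in> S"
    then show "k \<le> k\<^sub>1" using k1 mono[of k\<^sub>1 k] by (force simp: S_def)
  qed
  have "Sup S \<le> x \<longleftrightarrow> u \<le> cdf \<eta> x"
  proof
    assume "u \<le> cdf \<eta> x"
    show "Sup S \<le> x"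
    proof (rule cSup_least[OF ne])
      fix k assume "k \<in> S"
      then show "k \<le> x" using \<open>u \<le> cdf \<eta> x\<close> mono[of x k] by (force simp: S_def)
    qed
  next
    assume le: "Sup S \<le> x"
    show "u \<le> cdf \<eta> x"
    proof (rule ccontr)
      assume "\<not> u \<le> cdf \<eta> x"
      moreover have "(cdf \<eta> \<longlongrightarrow> cdf \<eta> x) (at_right x)"
        using cdf_is_right_cont[of x] by (simp add: continuous_within)
      ultimately have "\<forall>\<^sub>F y in at_right x. cdf \<eta> y < u" by (intro order_tendstoD(2)) auto
      then have "\<forall>\<^sub>F y in at_right x. cdf \<eta> y < u \<and> x < y"
        using eventually_at_right_less[of x] by eventually_elim simp
      then obtain y where "cdf \<eta> y < u" "x < y"
        using eventually_happens[of _ "at_right x"] by auto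
      then have "y \<le> Sup S" by (intro cSup_upper bdd) (simp add: S_def)
      then show False using le \<open>x < y\<close> by simp
    qed
  qed
  then show ?thesis by (simp add: q cdf_def)
qed

lemma quantile_mono:
  assumes "finite_measure \<eta>" "sets \<eta> = sets borel" "0 < u" "u \<le> v" "v < mass \<eta>"
  shows "quantile \<eta> u \<le> quantile \<eta> v"
  using quantile_le_iff[OF assms(1,2), of v "quantile \<eta> v"] quantile_le_iff[OF assms(1,2), of u "quantile \<eta> v"] assms
  by simp

text \<open>
  Outside \<open>(0, mass \<eta>)\<close> the quantile function takes unspecified values, but it is constant on each of the two
  half-lines.
\<close>

lemma quantile_measurable [measurable]:
  assumes "finite_measure \<eta>" "sets \<eta> = sets borel"
  shows "quantile \<eta> \<in> borel_measurable borel"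
proof -
  interpret finite_measure \<eta> by fact
  let ?m = "mass \<eta>"
  have space: "space \<eta> = UNIV" using sets_eq_imp_space_eq[OF assms(2)] by simp
  have lo: "quantile \<eta> u = Sup {}" if "u \<le> 0" for u
  proof -
    have "{k. measure \<eta> {..k} < u} = {}"
      using that measure_nonneg[of \<eta>] by (auto simp: not_less intro: order_trans)
    then show ?thesis by (simp add: quantile_def)
  qed
  have hi: "quantile \<eta> u = Sup UNIV" if "?m < u" for u
  proof -
    have "measure \<eta> {..k} < u" for k
      using that finite_measure_mono[of "{..k}" UNIV] assms(2) by simp
    then show ?thesis by (simp add: quantile_def)
  qed
  let ?C = "{{..0}, {0<..<?m}, {?m}, {?m<..}}"
  show ?thesis
  proof (rule measurable_piecewise_restrict[of ?C])
    fix \<Omega> assume "\<Omega> \<in> ?C"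
    then consider "\<Omega> = {..0}" | "\<Omega> = {0<..<?m}" | "\<Omega> = {?m}" | "\<Omega> = {?m<..}" by auto
    then show "quantile \<eta> \<in> borel_measurable (restrict_space borel \<Omega>)"
    proof cases
      case 1
      then show ?thesis using lo by (subst measurable_cong[where g = "\<lambda>_. Sup {}"]) (auto simp: space_restrict_space)
    next
      case 2
      then show ?thesis
        by (auto intro!: borel_measurable_mono_on_fnc mono_onI quantile_mono assms)
    next
      case 3
      then show ?thesis
        by (subst measurable_cong[where g = "\<lambda>_. quantile \<eta> ?m"]) (auto simp: space_restrict_space)
    next
      case 4
      then show ?thesis using hi by (subst measurable_cong[where g = "\<lambda>_. Sup UNIV"]) (auto simp: space_restrict_space)
    qed
  qed auto
qed

definition segment_law :: "(real \<Rightarrow> real) \<Rightarrow> real \<Rightarrow> real \<Rightarrow> real measure" where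
  "segment_law f a b = distr (restrict_space lborel {a<..<b}) borel f"

lemma sets_segment_law [simp]: "sets (segment_law f a b) = sets borel"
  by (simp add: segment_law_def)

lemma emeasure_segment_law:
  assumes [measurable]: "f \<in> borel_measurable borel" "A \<in> sets borel"
  shows "emeasure (segment_law f a b) A = emeasure lborel {t \<in> {a<..<b}. f t \<in> A}"
proof -
  have m: "f \<in> measurable (restrict_space lborel {a<..<b}) borel"
    by (intro measurable_restrict_space1) simp
  show ?thesis unfolding segment_law_def
    by (subst emeasure_distr[OF m]) (auto simp: emeasure_restrict_space space_restrict_space intro!: arg_cong[where f = "emeasure lborel"])
qed

lemma
  fixes g :: "real \<Rightarrow> real"
  assumes [measurable]: "f \<in> borel_measurable borel" "g \<in> borel_measurable borel"
  shows integral_segment_law: "(\<integral>x. g x \<partial>segment_law f a b) = (LINT t:{a<..<b}|lborel. g (f t))"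
    and integrable_segment_law: "integrable (segment_law f a b) g \<longleftrightarrow> set_integrable lborel {a<..<b} (\<lambda>t. g (f t))"
proof -
  have m: "f \<in> measurable (restrict_space lborel {a<..<b}) borel"
    by (intro measurable_restrict_space1) simp
  show "(\<integral>x. g x \<partial>segment_law f a b) = (LINT t:{a<..<b}|lborel. g (f t))"
    unfolding segment_law_def set_lebesgue_integral_def
    by (simp add: integral_distr[OF m] integral_restrict_space)
  show "integrable (segment_law f a b) g \<longleftrightarrow> set_integrable lborel {a<..<b} (\<lambda>t. g (f t))"
    unfolding segment_law_def set_integrable_def
    by (simp add: integrable_distr_eq[OF m] integrable_restrict_space)
qed

lemma mass_segment_law:
  assumes "f \<in> borel_measurable borel" "a \<le> b"
  shows "mass (segment_law f a b) = b - a"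
proof -
  have "{t \<in> {a<..<b}. f t \<in> UNIV} = {a<..<b}" by auto
  then show ?thesis using emeasure_segment_law[OF assms(1), of UNIV a b] assms(2) by (simp add: measure_def)
qed

lemma finite_measure_segment_law:
  assumes "f \<in> borel_measurable borel"
  shows "finite_measure (segment_law f a b)"
proof
  have "{t \<in> {a<..<b}. f t \<in> UNIV} = {a<..<b}" by auto
  then have "emeasure (segment_law f a b) UNIV = emeasure lborel {a<..<b}"
    using emeasure_segment_law[OF assms, of UNIV a b] by simp
  moreover have "emeasure lborel {a<..<b} \<noteq> \<infinity>" by (cases "a \<le> b") auto
  ultimately show "emeasure (segment_law f a b) (space (segment_law f a b)) \<noteq> \<infinity>"
    by (simp add: segment_law_def)
qed

lemma fin_moment_segment_law:
  assumes "f \<in> borel_measurable borel" "set_integrable lborel {a<..<b} f"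
  shows "fin_moment (segment_law f a b)"
  unfolding fin_moment_def
proof (intro conjI)
  show "integrable (segment_law f a b) (\<lambda>x. x)"
    by (rule integrable_segment_law[OF assms(1), THEN iffD2]) (use assms(2) in auto)
qed (use finite_measure_segment_law[OF assms(1)] in auto)

lemma put_segment_law:
  assumes "f \<in> borel_measurable borel"
  shows "put (segment_law f a b) k = (LINT t:{a<..<b}|lborel. max (k - f t) 0)"
  unfolding put_def by (rule integral_segment_law) (use assms in auto)

text \<open>
  By \<open>quantile_le_iff\<close>, the levels whose quantile exceeds \<open>x\<close> form the interval from \<open>measure \<eta> {..x}\<close> to the
  total mass.
\<close>

lemma segment_law_quantile:
  assumes fm: "finite_measure \<eta>" and sets: "sets \<eta> = sets borel"
  shows "segment_law (quantile \<eta>) 0 (mass \<eta>) = \<eta>"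
proof (rule measure_eqI_lessThan)
  interpret finite_measure \<eta> by fact
  have space: "space \<eta> = UNIV" using sets_eq_imp_space_eq[OF sets] by simp
  have [measurable]: "quantile \<eta> \<in> borel_measurable borel" by (rule quantile_measurable[OF fm sets])
  interpret L: finite_measure "segment_law (quantile \<eta>) 0 (mass \<eta>)"
    by (rule finite_measure_segment_law) simp
  show "emeasure (segment_law (quantile \<eta>) 0 (mass \<eta>)) {x<..} < \<infinity>" for x
    by (simp add: L.emeasure_finite less_top[symmetric])
  fix x
  have "{t \<in> {0<..<mass \<eta>}. quantile \<eta> t \<in> {x<..}} = {measure \<eta> {..x}<..<mass \<eta>}"
  proof -
    have "0 < t \<Longrightarrow> t < mass \<eta> \<Longrightarrow> x < quantile \<eta> t \<longleftrightarrow> measure \<eta> {..x} < t" for t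
      using quantile_le_iff[OF fm sets, of t x] by linarith
    moreover have "measure \<eta> {..x} < t \<Longrightarrow> 0 < t" for t
      using measure_nonneg[of \<eta> "{..x}"] by linarith
    ultimately show ?thesis by auto
  qed
  moreover have "measure \<eta> {..x} \<le> mass \<eta>" using sets by (intro finite_measure_mono) auto
  ultimately have "emeasure (segment_law (quantile \<eta>) 0 (mass \<eta>)) {x<..} = ennreal (mass \<eta> - measure \<eta> {..x})"
    by (simp add: emeasure_segment_law)
  also have "mass \<eta> - measure \<eta> {..x} = measure \<eta> (UNIV - {..x})"
    using finite_measure_compl[of "{..x}"] sets space by simp
  also have "UNIV - {..x} = {x<..}" by auto
  finally show "emeasure (segment_law (quantile \<eta>) 0 (mass \<eta>)) {x<..} = emeasure \<eta> {x<..}"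
    by (simp add: emeasure_eq_measure)
qed (use sets in auto)

text \<open>
  To keep the leftmost mass \<open>s\<close> is to keep the levels below \<open>s\<close>. The atom at the quantile of \<open>s\<close> receives exactly
  those levels below \<open>s\<close> that the points on its left have not used up.
\<close>

lemma quantile_part_eq_segment_law:
  assumes fm: "finite_measure \<eta>" and sets: "sets \<eta> = sets borel" and s: "0 < s" "s < mass \<eta>"
  shows "quantile_part \<eta> s = segment_law (quantile \<eta>) 0 s"
proof (rule measure_eqI)
  let ?G = "quantile \<eta>" and ?m = "mass \<eta>"
  let ?g = "?G s"
  have G[measurable]: "?G \<in> borel_measurable borel" by (rule quantile_measurable[OF fm sets])
  interpret finite_measure \<eta> by fact
  have less: "t < s" if "0 < t" "t < ?m" "?G t < ?g" for t
    using quantile_mono[OF fm sets, of s t] that s by force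
  have law: "emeasure \<eta> A = emeasure lborel {t \<in> {0<..<?m}. ?G t \<in> A}" if "A \<in> sets borel" for A
    using emeasure_segment_law[OF G that, of 0 ?m] segment_law_quantile[OF fm sets] by simp
  have cut: "emeasure \<eta> (A \<inter> {..<?g}) = emeasure lborel {t \<in> {0<..<s}. ?G t \<in> A \<and> ?G t < ?g}"
    if "A \<in> sets borel" for A
    using that less s by (subst law) (auto intro!: arg_cong[where f = "emeasure lborel"])
  fix A :: "real set" assume "A \<in> sets (quantile_part \<eta> s)"
  then have A[measurable]: "A \<in> sets borel" by simp
  have fin: "emeasure lborel {t \<in> {0<..<s}. P t} < \<infinity>" for P
  proof -
    have "emeasure lborel {t \<in> {0<..<s}. P t} \<le> emeasure lborel {0<..<s}"
      by (rule emeasure_mono) auto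
    also have "\<dots> < \<infinity>" using s by simp
    finally show ?thesis .
  qed
  have atom: "ennreal (s - measure \<eta> {..<?g}) = emeasure lborel {t \<in> {0<..<s}. ?G t = ?g}"
  proof -
    have "emeasure lborel {t \<in> {0<..<s}. ?G t < ?g} = ennreal (measure \<eta> {..<?g})"
      using cut[of UNIV] by (simp add: emeasure_eq_measure)
    moreover have "emeasure lborel {0<..<s} = emeasure lborel {t \<in> {0<..<s}. ?G t < ?g} + emeasure lborel {t \<in> {0<..<s}. ?G t = ?g}"
    proof (subst plus_emeasure)
      show "emeasure lborel {0<..<s} = emeasure lborel ({t \<in> {0<..<s}. ?G t < ?g} \<union> {t \<in> {0<..<s}. ?G t = ?g})"
        using quantile_mono[OF fm sets, of _ s] s by (intro arg_cong[where f = "emeasure lborel"]) force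
    qed auto
    ultimately have "ennreal s = ennreal (measure \<eta> {..<?g}) + emeasure lborel {t \<in> {0<..<s}. ?G t = ?g}"
      using s by simp
    then show ?thesis
      using fin[of "\<lambda>t. ?G t = ?g"] s
      by (cases "emeasure lborel {t \<in> {0<..<s}. ?G t = ?g}") (auto simp flip: ennreal_plus)
  qed
  have "emeasure (quantile_part \<eta> s) A = emeasure lborel {t \<in> {0<..<s}. ?G t \<in> A \<and> ?G t < ?g} +
      emeasure lborel {t \<in> {0<..<s}. ?G t = ?g} * indicator A ?g"
    using emeasure_quantile_part[OF sets A, of s] cut[OF A] atom by simp
  also have "emeasure lborel {t \<in> {0<..<s}. ?G t = ?g} * indicator A ?g =
      emeasure lborel {t \<in> {0<..<s}. ?G t \<in> A \<and> ?G t = ?g}"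
  proof (cases "?g \<in> A")
    case True
    then have "{t \<in> {0<..<s}. ?G t \<in> A \<and> ?G t = ?g} = {t \<in> {0<..<s}. ?G t = ?g}" by auto
    then show ?thesis using True by simp
  next
    case False
    then have "{t \<in> {0<..<s}. ?G t \<in> A \<and> ?G t = ?g} = {}" by auto
    then show ?thesis using False by (simp only: emeasure_empty) simp
  qed
  also have "emeasure lborel {t \<in> {0<..<s}. ?G t \<in> A \<and> ?G t < ?g} +
      emeasure lborel {t \<in> {0<..<s}. ?G t \<in> A \<and> ?G t = ?g} =
      emeasure lborel ({t \<in> {0<..<s}. ?G t \<in> A \<and> ?G t < ?g} \<union> {t \<in> {0<..<s}. ?G t \<in> A \<and> ?G t = ?g})"
    by (rule plus_emeasure) auto
  also have "{t \<in> {0<..<s}. ?G t \<in> A \<and> ?G t < ?g} \<union> {t \<in> {0<..<s}. ?G t \<in> A \<and> ?G t = ?g} = {t \<in> {0<..<s}. ?G t \<in> A}"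
    using quantile_mono[OF fm sets, of _ s] s by force
  finally show "emeasure (quantile_part \<eta> s) A = emeasure (segment_law ?G 0 s) A"
    by (simp add: emeasure_segment_law)
qed simp

lemma set_integral_split:
  fixes f :: "real \<Rightarrow> real"
  assumes "set_integrable lborel {a<..<c} f" "a \<le> b" "b \<le> c"
  shows "(LINT t:{a<..<c}|lborel. f t) = (LINT t:{a<..<b}|lborel. f t) + (LINT t:{b<..<c}|lborel. f t)"
  using interval_integral_sum[of "ereal a" "ereal b" "ereal c" f] assms
  by (simp add: interval_lebesgue_integral_def interval_lebesgue_integrable_def min_def max_def)

section \<open>Put differences along the levels\<close>

lemma put_at_bot:
  assumes \<theta>: "fin_moment \<theta>"
  shows "(put \<theta> \<longlongrightarrow> 0) at_bot"
  unfolding filterlim_at_bot_mirror put_def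
proof -
  have "((\<lambda>k. \<integral>x. max (- k - x) 0 \<partial>\<theta>) \<longlongrightarrow> (\<integral>x. 0 \<partial>\<theta>)) at_top"
  proof (rule integral_dominated_convergence_at_top[where w = "\<lambda>x. \<bar>x\<bar>"])
    show "AE x in \<theta>. ((\<lambda>k. max (- k - x) 0) \<longlongrightarrow> 0) at_top"
    proof (intro AE_I2 tendsto_eventually)
      fix x :: real
      show "\<forall>\<^sub>F k in at_top. max (- k - x) 0 = 0"
        using eventually_ge_at_top[of "- x"] by eventually_elim simp
    qed
    show "\<forall>\<^sub>F k in at_top. AE x in \<theta>. norm (max (- k - x) 0) \<le> \<bar>x\<bar>"
      using eventually_ge_at_top[of 0]
    proof eventually_elim
      case (elim k)
      then show ?case by (intro AE_I2) (simp add: max_def)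
    qed
    show "integrable \<theta> (\<lambda>x. \<bar>x\<bar>)" by (rule integrable_abs[OF fin_momentD(4)[OF \<theta>]])
    show "(\<lambda>x. max (- k - x) 0) \<in> borel_measurable \<theta>" for k
      by (intro borel_measurable_integrable fin_momentD(6)[OF \<theta>])
  qed simp
  then show "((\<lambda>k. \<integral>x. max (- k - x) 0 \<partial>\<theta>) \<longlongrightarrow> 0) at_top" by simp
qed

lemma put_at_top:
  assumes \<theta>: "fin_moment \<theta>"
  shows "((\<lambda>k. put \<theta> k - (k * mass \<theta> - (\<integral>x. x \<partial>\<theta>))) \<longlongrightarrow> 0) at_top"
proof -
  note i = fin_momentD(4,5,6)[OF \<theta>]
  have "((\<lambda>k. \<integral>x. max (k - x) 0 - (k - x) \<partial>\<theta>) \<longlongrightarrow> (\<integral>x. 0 \<partial>\<theta>)) at_top"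
  proof (rule integral_dominated_convergence_at_top[where w = "\<lambda>x. \<bar>x\<bar>"])
    show "AE x in \<theta>. ((\<lambda>k. max (k - x) 0 - (k - x)) \<longlongrightarrow> 0) at_top"
    proof (intro AE_I2 tendsto_eventually)
      fix x :: real
      show "\<forall>\<^sub>F k in at_top. max (k - x) 0 - (k - x) = 0"
        using eventually_ge_at_top[of x] by eventually_elim simp
    qed
    show "\<forall>\<^sub>F k in at_top. AE x in \<theta>. norm (max (k - x) 0 - (k - x)) \<le> \<bar>x\<bar>"
      using eventually_ge_at_top[of 0]
    proof eventually_elim
      case (elim k)
      then show ?case by (intro AE_I2) (simp add: max_def)
    qed
    show "integrable \<theta> (\<lambda>x. \<bar>x\<bar>)" by (rule integrable_abs[OF i(1)])
    show "(\<lambda>x. max (k - x) 0 - (k - x)) \<in> borel_measurable \<theta>" for k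
      by (intro borel_measurable_integrable Bochner_Integration.integrable_diff i)
  qed simp
  moreover have "(\<integral>x. max (k - x) 0 - (k - x) \<partial>\<theta>) = put \<theta> k - (k * mass \<theta> - (\<integral>x. x \<partial>\<theta>))" for k
    unfolding put_def using i fin_momentD(3)[OF \<theta>] by (simp add: mult.commute)
  ultimately show ?thesis by simp
qed

locale curtain =
  fixes \<mu> \<nu> :: "real measure"
  assumes mu: "prob_fin_moment \<mu>" and nu: "prob_fin_moment \<nu>" and order: "le_c \<mu> \<nu>"
begin

abbreviation "G \<equiv> quantile \<mu>"
abbreviation "H \<equiv> quantile \<nu>"
abbreviation "D \<equiv> put_diff \<mu> \<nu>"

text \<open>
  \<open>J 0 u\<close> is the put function of the quantile part of mass \<open>u\<close>, so \<open>J a b\<close> is the gain of this function between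
  two levels. As an integral over levels it makes sense for the end points 0 and 1 as well, where the
  quantile function is unspecified. \<open>E u\<close> is the function \<open>\<E>\<^sub>u\<close> of the definition of \<open>S\<close>, \<open>R\<close> and \<open>\<phi>\<close>.
\<close>

definition J :: "real \<Rightarrow> real \<Rightarrow> real \<Rightarrow> real" where
  "J a b x = (LINT t:{a<..<b}|lborel. max (x - G t) 0)"

definition E :: "real \<Rightarrow> real \<Rightarrow> real" where
  "E u x = put \<nu> x - J 0 u x"

definition minorant :: "real \<Rightarrow> real \<Rightarrow> real" where
  "minorant u = convex_minorant (E u)"

lemma fin_moments: "fin_moment \<mu>" "fin_moment \<nu>"
  using mu nu by (auto simp: prob_fin_moment_def)

lemma masses [simp]: "mass \<mu> = 1" "mass \<nu> = 1"
  using mu nu fin_momentD(3)[OF fin_moments(1)] fin_momentD(3)[OF fin_moments(2)]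
  by (auto simp: prob_fin_moment_def dest!: prob_space.prob_space)

lemmas finites = fin_momentD(1)[OF fin_moments(1)] fin_momentD(1)[OF fin_moments(2)]
lemmas borels = fin_momentD(2)[OF fin_moments(1)] fin_momentD(2)[OF fin_moments(2)]

lemma G_measurable [measurable]: "G \<in> borel_measurable borel"
  and H_measurable [measurable]: "H \<in> borel_measurable borel"
  by (intro quantile_measurable finites borels)+

lemma G_mono: "0 < u \<Longrightarrow> u \<le> v \<Longrightarrow> v < 1 \<Longrightarrow> G u \<le> G v"
  using quantile_mono[OF finites(1) borels(1)] by simp

lemma G_le_iff: "0 < u \<Longrightarrow> u < 1 \<Longrightarrow> G u \<le> x \<longleftrightarrow> u \<le> measure \<mu> {..x}"
  using quantile_le_iff[OF finites(1) borels(1)] by simp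

lemma laws: "segment_law G 0 1 = \<mu>" "segment_law H 0 1 = \<nu>"
  using segment_law_quantile[OF finites(1) borels(1)] segment_law_quantile[OF finites(2) borels(2)] by auto

lemma integrable_subsegment:
  fixes f :: "real \<Rightarrow> real"
  assumes "set_integrable lborel {0<..<1} f" "0 \<le> a" "b \<le> 1"
  shows "set_integrable lborel {a<..<b} f"
  by (rule set_integrable_subset[OF assms(1)]) (use assms in auto)

lemma G_integrable: "0 \<le> a \<Longrightarrow> b \<le> 1 \<Longrightarrow> set_integrable lborel {a<..<b} G"
  and H_integrable: "0 \<le> a \<Longrightarrow> b \<le> 1 \<Longrightarrow> set_integrable lborel {a<..<b} H"
proof -
  have "set_integrable lborel {0<..<1} G"
    by (rule integrable_segment_law[THEN iffD1]) (simp_all add: laws fin_momentD(4)[OF fin_moments(1)])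
  then show "0 \<le> a \<Longrightarrow> b \<le> 1 \<Longrightarrow> set_integrable lborel {a<..<b} G" by (rule integrable_subsegment)
  have "set_integrable lborel {0<..<1} H"
    by (rule integrable_segment_law[THEN iffD1]) (simp_all add: laws fin_momentD(4)[OF fin_moments(2)])
  then show "0 \<le> a \<Longrightarrow> b \<le> 1 \<Longrightarrow> set_integrable lborel {a<..<b} H" by (rule integrable_subsegment)
qed

lemma fin_moment_G: "0 \<le> a \<Longrightarrow> b \<le> 1 \<Longrightarrow> fin_moment (segment_law G a b)"
  and fin_moment_H: "0 \<le> a \<Longrightarrow> b \<le> 1 \<Longrightarrow> fin_moment (segment_law H a b)"
  by (intro fin_moment_segment_law G_measurable H_measurable G_integrable H_integrable; assumption)+

lemma J_eq_put: "J a b x = put (segment_law G a b) x"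
  by (simp add: J_def put_segment_law)

lemma payoff_integrable:
  assumes "0 \<le> a" "b \<le> 1"
  shows "set_integrable lborel {a<..<b} (\<lambda>t. max (x - G t) 0)"
    and "set_integrable lborel {a<..<b} (\<lambda>t. max (x - H t) 0)"
  by (rule integrable_segment_law[THEN iffD1, OF _ _ fin_momentD(6)]; simp add: fin_moment_G fin_moment_H assms)+

lemma const_integrable: "set_integrable lborel {a<..<b::real} (\<lambda>t. c :: real)"
  unfolding set_integrable_def by (cases "a \<le> b") auto

lemma affine_integrable:
  assumes "0 \<le> a" "b \<le> 1"
  shows "set_integrable lborel {a<..<b} (\<lambda>t. x - G t)"
    and "set_integrable lborel {a<..<b} (\<lambda>t. x - H t)"
  using set_integral_diff(1)[OF _ G_integrable[OF assms], of "\<lambda>_. x"]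
    set_integral_diff(1)[OF _ H_integrable[OF assms], of "\<lambda>_. x"]
  by (simp_all add: const_integrable)

lemma const_integral: "a \<le> b \<Longrightarrow> (LINT t:{a<..<b::real}|lborel. c :: real) = (b - a) * c"
  unfolding set_lebesgue_integral_def by (simp add: mult.commute)

lemma J_add: "0 \<le> a \<Longrightarrow> a \<le> b \<Longrightarrow> b \<le> c \<Longrightarrow> c \<le> 1 \<Longrightarrow> J a c x = J a b x + J b c x"
  unfolding J_def by (rule set_integral_split) (auto intro!: payoff_integrable)

lemma J_nonneg: "0 \<le> J a b x"
  by (simp add: J_eq_put put_nonneg)

lemma affine_integral:
  assumes "0 \<le> a" "a \<le> b" "b \<le> 1"
  shows "(LINT t:{a<..<b}|lborel. x - G t) = (b - a) * x - (LINT t:{a<..<b}|lborel. G t)"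
    and "(LINT t:{a<..<b}|lborel. x - H t) = (b - a) * x - (LINT t:{a<..<b}|lborel. H t)"
  using set_integral_diff(2)[OF const_integrable[of a b x] G_integrable[of a b]]
    set_integral_diff(2)[OF const_integrable[of a b x] H_integrable[of a b]] const_integral[of a b x] assms by auto

lemma J_ge_affine:
  assumes "0 \<le> a" "a \<le> b" "b \<le> 1"
  shows "(b - a) * x - (LINT t:{a<..<b}|lborel. G t) \<le> J a b x"
  unfolding affine_integral(1)[OF assms, symmetric] J_def
  by (intro set_integral_mono affine_integrable payoff_integrable) (use assms in auto)

lemma J_eq_affineI:
  assumes ab: "0 \<le> a" "a \<le> b" "b \<le> 1" and le: "\<And>t. a < t \<Longrightarrow> t < b \<Longrightarrow> G t \<le> x"
  shows "J a b x = (b - a) * x - (LINT t:{a<..<b}|lborel. G t)"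
  unfolding affine_integral(1)[OF ab, symmetric] J_def
proof (rule set_lebesgue_integral_cong)
  show "\<forall>t. t \<in> {a<..<b} \<longrightarrow> max (x - G t) 0 = x - G t" using le by auto
qed simp

lemma J_eq_0I:
  assumes le: "\<And>t. a < t \<Longrightarrow> t < b \<Longrightarrow> x \<le> G t"
  shows "J a b x = 0"
proof -
  have "(LINT t:{a<..<b}|lborel. max (x - G t) 0) = (LINT t:{a<..<b}|lborel. 0)"
  proof (rule set_lebesgue_integral_cong)
    show "\<forall>t. t \<in> {a<..<b} \<longrightarrow> max (x - G t) 0 = 0" using le by auto
  qed simp
  then show ?thesis by (simp add: J_def set_lebesgue_integral_def)
qed

lemma J_eq_affine:
  assumes "0 \<le> a" "a \<le> b" "b < 1" "G b \<le> x"
  shows "J a b x = (b - a) * x - (LINT t:{a<..<b}|lborel. G t)"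
proof (rule J_eq_affineI)
  show "G t \<le> x" if "a < t" "t < b" for t using G_mono[of t b] that assms by simp
qed (use assms in auto)

lemma J_le:
  assumes "0 < a" "a \<le> b" "b \<le> 1"
  shows "J a b x \<le> (b - a) * max (x - G a) 0"
  unfolding J_def const_integral[OF assms(2), symmetric]
proof (rule set_integral_mono)
  fix t assume "t \<in> {a<..<b}"
  then have "G a \<le> G t" using assms by (intro G_mono) auto
  then show "max (x - G t) 0 \<le> max (x - G a) 0" by auto
qed (use assms in \<open>auto intro!: payoff_integrable const_integrable\<close>)

lemma J_ge:
  assumes "0 \<le> a" "a \<le> b" "b < 1"
  shows "(b - a) * max (x - G b) 0 \<le> J a b x"
  unfolding J_def const_integral[OF assms(2), symmetric]
proof (rule set_integral_mono)
  fix t assume "t \<in> {a<..<b}"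
  then have "G t \<le> G b" using assms by (intro G_mono) auto
  then show "max (x - G b) 0 \<le> max (x - G t) 0" by auto
qed (use assms in \<open>auto intro!: payoff_integrable const_integrable\<close>)

lemma J_eq_0: "0 < a \<Longrightarrow> a \<le> b \<Longrightarrow> b \<le> 1 \<Longrightarrow> x \<le> G a \<Longrightarrow> J a b x = 0"
  using J_le[of a b x] J_nonneg[of a b x] by simp

lemma J_convex: "0 \<le> a \<Longrightarrow> b \<le> 1 \<Longrightarrow> convex_on UNIV (J a b)"
  using convex_on_put[OF fin_moment_G[of a b]] by (simp add: J_eq_put[abs_def])

lemma put_mu: "put \<mu> = J 0 1"
  by (rule ext) (simp add: J_eq_put laws)

lemma D_nonneg: "0 \<le> D x"
  using le_c_put[OF order fin_moments, of x] by (simp add: put_diff_def)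

lemma D_continuous: "continuous_on A D"
  unfolding put_diff_def[abs_def]
  by (intro continuous_intros convex_on_continuous_at convex_on_put fin_moments)

lemma D_at_bot: "(D \<longlongrightarrow> 0) at_bot"
  using tendsto_diff[OF put_at_bot[OF fin_moments(2)] put_at_bot[OF fin_moments(1)]]
  by (simp add: put_diff_def[abs_def])

lemma D_at_top: "(D \<longlongrightarrow> 0) at_top"
  using tendsto_diff[OF put_at_top[OF fin_moments(2)] put_at_top[OF fin_moments(1)]]
    le_c_mean[OF order fin_moments]
  by (simp add: put_diff_def[abs_def])

lemma E_eq: "0 \<le> u \<Longrightarrow> u \<le> 1 \<Longrightarrow> E u x = D x + J u 1 x"
  using J_add[of 0 u 1 x] by (simp add: E_def put_diff_def put_mu)

lemma E_diff: "0 \<le> u \<Longrightarrow> u \<le> v \<Longrightarrow> v \<le> 1 \<Longrightarrow> E u x = E v x + J u v x"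
  using J_add[of 0 u v x] by (simp add: E_def)

lemma E_nonneg: "0 \<le> u \<Longrightarrow> u \<le> 1 \<Longrightarrow> 0 \<le> E u x"
  by (simp add: E_eq D_nonneg J_nonneg)

lemma D_le_E: "0 \<le> u \<Longrightarrow> u \<le> 1 \<Longrightarrow> D x \<le> E u x"
  by (simp add: E_eq J_nonneg)

lemma E_antimono: "0 \<le> u \<Longrightarrow> u \<le> v \<Longrightarrow> v \<le> 1 \<Longrightarrow> E v x \<le> E u x"
  using E_diff[of u v x] J_nonneg[of u v x] by simp

lemma E_eq_D: "0 < u \<Longrightarrow> u < 1 \<Longrightarrow> x \<le> G u \<Longrightarrow> E u x = D x"
  by (simp add: E_eq J_eq_0)

lemma E_continuous: "0 \<le> u \<Longrightarrow> u \<le> 1 \<Longrightarrow> continuous_on A (E u)"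
  unfolding E_def[abs_def]
  by (intro continuous_intros convex_on_continuous_at convex_on_put fin_moments J_convex) auto

lemma E_ge_affine:
  assumes "0 \<le> u" "u \<le> v" "v \<le> 1"
  shows "(v - u) * x - (LINT t:{u<..<v}|lborel. G t) \<le> E u x"
  using J_ge_affine[OF assms, of x] E_diff[OF assms, of x] E_nonneg[of v x] assms by simp

text \<open>
  To the right of \<open>G u\<close> the put function of the quantile part is affine, so \<open>E u\<close> is convex there.
\<close>

lemma E_supporting_line:
  assumes u: "0 < u" "u < 1" and k: "G u \<le> k"
  obtains s where "\<And>y. G u \<le> y \<Longrightarrow> E u k + s * (y - k) \<le> E u y"
proof -
  obtain s where s: "\<And>y. put \<nu> k + s * (y - k) \<le> put \<nu> y"
    using convex_supporting_line[OF convex_on_put[OF fin_moments(2)]] by blast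
  show ?thesis
  proof (rule that[of "s - u"])
    fix y assume "G u \<le> y"
    then show "E u k + (s - u) * (y - k) \<le> E u y"
      using s[of y] J_eq_affine[of 0 u y] J_eq_affine[of 0 u k] k u
      by (simp add: E_def algebra_simps)
  qed
qed

lemma minorant_facts:
  assumes u: "0 \<le> u" "u \<le> 1"
  shows minorant_convex: "convex_on UNIV (minorant u)" and minorant_le: "minorant u x \<le> E u x"
    and minorant_greatest: "\<And>f x. convex_on UNIV f \<Longrightarrow> (\<And>y. f y \<le> E u y) \<Longrightarrow> f x \<le> minorant u x"
    and minorant_line: "\<And>c s x. (\<And>y. c + s * y \<le> E u y) \<Longrightarrow> c + s * x \<le> minorant u x"
    and minorant_nonneg: "0 \<le> minorant u x"
proof -
  have 0: "0 + 0 * x \<le> E u x" for x using E_nonneg[OF u] by simp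
  note * = convex_on_convex_minorant[OF 0] convex_minorant_le[OF 0]
    convex_minorant_greatest[OF 0] line_le_convex_minorant[OF 0]
  show "convex_on UNIV (minorant u)" "minorant u x \<le> E u x"
    "\<And>f x. convex_on UNIV f \<Longrightarrow> (\<And>y. f y \<le> E u y) \<Longrightarrow> f x \<le> minorant u x"
    "\<And>c s x. (\<And>y. c + s * y \<le> E u y) \<Longrightarrow> c + s * x \<le> minorant u x"
    unfolding minorant_def using * by auto
  show "0 \<le> minorant u x"
    unfolding minorant_def using *(4)[of 0 0 x] E_nonneg[OF u] by simp
qed

lemma minorant_antimono:
  assumes "0 \<le> u" "u \<le> v" "v \<le> 1"
  shows "minorant v x \<le> minorant u x"
proof -
  have v: "0 \<le> v" "v \<le> 1" and u: "u \<le> 1" using assms by auto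
  show ?thesis
    by (rule minorant_greatest[OF assms(1) u minorant_convex[OF v]])
      (use minorant_le[OF v] E_antimono[OF assms] order_trans in blast)
qed

end

section \<open>The tangent at a quantile\<close>

lemma convex_le_line:
  fixes g :: "real \<Rightarrow> real"
  assumes g: "convex_on UNIV g" and k: "a \<le> k" "k \<le> b"
    and le: "g a \<le> c + s * a" "g b \<le> c + s * b"
  shows "g k \<le> c + s * k"
proof (cases "a = b")
  case True
  then show ?thesis using k le by simp
next
  case False
  then have ab: "a < b" using k by simp
  define t where "t = (k - a) / (b - a)"
  have t: "0 \<le> t" "t \<le> 1" using k ab by (auto simp: t_def)
  have k_eq: "k = (1 - t) * a + t * b"
  proof -
    have "t * (b - a) = k - a" using ab by (simp add: t_def)
    then show ?thesis by (simp add: algebra_simps)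
  qed
  have "g k \<le> (1 - t) * g a + t * g b"
    using convex_onD[OF g, of t a b] t k_eq by simp
  also have "\<dots> \<le> (1 - t) * (c + s * a) + t * (c + s * b)"
    using t le by (intro add_mono mult_left_mono) auto
  also have "\<dots> = c + s * ((1 - t) * a + t * b)" by algebra
  finally show ?thesis using k_eq by simp
qed

lemma closed_set_minimum:
  fixes K :: "real set"
  assumes "closed K" "K \<noteq> {}" and bdd: "bdd_below K"
  shows "\<exists>m. m \<in> K \<and> (\<forall>x\<in>K. m \<le> x) \<and> Inf (ereal ` K) = ereal m"
proof -
  have 1: "Inf K \<in> K" by (rule closed_contains_Inf[OF assms(2) bdd assms(1)])
  have 2: "Inf K \<le> x" if "x \<in> K" for x by (rule cInf_lower[OF that bdd])
  have "Inf (ereal ` K) = ereal (Inf K)"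
    by (rule antisym) (use 1 2 in \<open>auto intro!: Inf_lower INF_greatest\<close>)
  then show ?thesis using 1 2 by blast
qed

text \<open>
  The construction of \<open>R\<close> and \<open>S\<close> at one level, with \<open>z\<close> the quantile, \<open>f\<close> in the role of \<open>\<E>\<^sub>u\<close>, \<open>d\<close> in that
  of the put difference, and \<open>\<sigma> * x - c\<close> the asymptote of \<open>f\<close> at \<open>\<infinity>\<close>. The line \<open>L\<close> supports the convex
  minorant at \<open>z\<close> with the smallest possible slope. It touches \<open>f\<close> on both sides of \<open>z\<close>: on the left
  because its slope is positive while \<open>f\<close> is nonnegative, on the right because its slope is smaller than
  \<open>\<sigma>\<close>. With a slope \<open>\<ge> \<sigma>\<close>, the point of contact on the left would lie below the asymptote. But the
  asymptote is negative to the left of \<open>z\<close> and at most 0 at \<open>z\<close>, whereas \<open>f\<close> is nonnegative, and positive at \<open>z\<close>.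
\<close>

lemma tangent_triple:
  fixes f d :: "real \<Rightarrow> real" and z \<sigma> c :: real
  defines "g \<equiv> convex_minorant f"
  defines "\<phi> \<equiv> Inf (subdifferential g z)"
  defines "L \<equiv> \<lambda>x. g z + \<phi> * (x - z)"
  assumes fc: "continuous_on UNIV f" and dc: "continuous_on UNIV d"
    and f0: "\<And>x. 0 \<le> f x" and fd: "\<And>x. x \<le> z \<Longrightarrow> f x = d x"
    and dbot: "(d \<longlongrightarrow> 0) at_bot" and fpos: "\<And>x. z \<le> x \<Longrightarrow> 0 < f x"
    and \<sigma>: "0 < \<sigma>" and A: "\<And>x. \<sigma> * x - c \<le> f x" and Atop: "((\<lambda>x. f x - (\<sigma> * x - c)) \<longlongrightarrow> 0) at_top"
    and Az: "\<And>x. x \<le> z \<Longrightarrow> 0 \<le> \<sigma> * x - c \<Longrightarrow> x = z"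
  obtains s r where
    "Inf (ereal ` {y. z \<le> y \<and> g y = f y}) = ereal s"
    "{k. k \<le> z \<and> d k = L k} \<noteq> {}" "Inf (ereal ` {k. k \<le> z \<and> d k = L k}) = ereal r"
    "0 < \<phi>" "r \<le> z" "z \<le> s" "\<And>x. L x \<le> f x" "d r = L r" "f s = L s"
    "\<And>k. k \<le> z \<Longrightarrow> d k = L k \<Longrightarrow> r \<le> k" "\<And>y. z \<le> y \<Longrightarrow> y < s \<Longrightarrow> L y < f y"
    "\<And>y. z \<le> y \<Longrightarrow> y \<le> s \<Longrightarrow> g y = L y"
    "\<And>w. (\<And>x. g z + w * (x - z) \<le> f x) \<Longrightarrow> \<phi> \<le> w"
proof -
  have m0: "0 + 0 * x \<le> f x" for x using f0 by simp
  note gconv = convex_on_convex_minorant[OF m0, folded g_def]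
    and gle = convex_minorant_le[OF m0, folded g_def]
    and gline = line_le_convex_minorant[OF m0, folded g_def]
  have g0: "0 \<le> g x" for x using gline[of 0 0 x] f0 by simp
  define SD where "SD = subdifferential g z"
  have sub: "s \<in> SD \<longleftrightarrow> (\<forall>y. g z + s * (y - z) \<le> g y)" for s
    by (simp add: SD_def subdifferential_def)
  obtain s\<^sub>0 where "\<And>y. g z + s\<^sub>0 * (y - z) \<le> g y" using convex_supporting_line[OF gconv, of z] by metis
  then have s0: "s\<^sub>0 \<in> SD" by (simp add: sub)
  have slope_lower: "(g z - g y) / (z - y) \<le> s" if "s \<in> SD" "y < z" for s y
    using that sub[of s] spec[OF that(1)[unfolded sub], of y] by (simp add: field_simps)
  have bdd: "bdd_below SD" by (rule bdd_belowI[of _ "(g z - g (z - 1)) / (z - (z - 1))"]) (rule slope_lower; simp)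
  have \<phi>_lower: "\<phi> \<le> s" if "s \<in> SD" for s unfolding \<phi>_def SD_def[symmetric] by (rule cInf_lower[OF that bdd])
  have \<phi>_ge: "(g z - g y) / (z - y) \<le> \<phi>" if "y < z" for y
    unfolding \<phi>_def SD_def[symmetric] by (rule cInf_greatest) (use s0 slope_lower that in auto)
  have Lg: "L y \<le> g y" for y
  proof -
    consider "y < z" | "y = z" | "z < y" by linarith
    then show ?thesis
    proof cases
      case 1
      then show ?thesis using \<phi>_ge[OF 1] by (simp add: L_def field_simps)
    next
      case 2 then show ?thesis by (simp add: L_def)
    next
      case 3
      have "\<phi> * (y - z) \<le> s\<^sub>0 * (y - z)" using 3 \<phi>_lower[OF s0] by (intro mult_right_mono) auto
      then show ?thesis using spec[OF s0[unfolded sub], of y] by (simp add: L_def)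
    qed
  qed
  have Lf: "L y \<le> f y" for y using Lg gle order_trans by blast
  have Lform: "L y = (g z - \<phi> * z) + \<phi> * y" for y by (simp add: L_def algebra_simps)
  have Lz: "L z = g z" by (simp add: L_def)
  have best: "c' + s' * z \<le> (g z - \<phi> * z) + \<phi> * z" if "\<And>x. c' + s' * x \<le> f x" for c' s'
    using gline[OF that, of z] by simp
  have gz: "0 < g z"
  proof (rule ccontr)
    assume "\<not> 0 < g z"
    then have gz0: "g z = 0" using g0[of z] by simp
    have "\<exists>x\<ge>z. f x = 0 + 0 * x"
    proof (rule contact_right[where \<delta> = "\<sigma> / 2" and M = "2 * c / \<sigma>"])
      show "c' + s' * z \<le> 0 + 0 * z" if "\<And>x. c' + s' * x \<le> f x" for c' s'
        using gline[OF that, of z] gz0 by simp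
      show "\<sigma> / 2 * x \<le> f x - (0 + 0 * x)" if "2 * c / \<sigma> \<le> x" for x
        using A[of x] that \<sigma> by (simp add: field_simps)
    qed (use fc m0 \<sigma> in auto)
    then show False using fpos by force
  qed
  have \<phi>pos: "0 < \<phi>"
  proof (rule ccontr)
    assume neg: "\<not> 0 < \<phi>"
    have "\<forall>\<^sub>F x in at_bot. d x < g z" by (rule order_tendstoD(2)[OF dbot gz])
    then have "\<forall>\<^sub>F x in at_bot. d x < g z \<and> x \<le> z" using eventually_le_at_bot[of z] by eventually_elim simp
    then obtain x where x: "d x < g z" "x \<le> z" using eventually_happens[of _ "at_bot :: real filter"] by auto
    have "g z \<le> L x" using neg x by (simp add: L_def mult_nonpos_nonpos)
    then show False using Lf[of x] fd[of x] x by simp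
  qed
  have "\<exists>k\<le>z. f k = (g z - \<phi> * z) + \<phi> * k"
  proof (rule contact_left[where \<delta> = "\<phi> / 2" and M = "- (2 * (g z - \<phi> * z) / \<phi>)"])
    show "\<phi> / 2 * - x \<le> f x - (g z - \<phi> * z + \<phi> * x)" if "x \<le> - (2 * (g z - \<phi> * z) / \<phi>)" for x
    proof -
      have "2 * (g z - \<phi> * z) / \<phi> \<le> - x" using that by linarith
      then have "2 * (g z - \<phi> * z) \<le> - x * \<phi>" using \<phi>pos by (simp only: pos_divide_le_eq)
      then show ?thesis using f0[of x] by (simp add: algebra_simps)
    qed
  qed (use fc Lf best \<phi>pos in \<open>auto simp: Lform\<close>)
  then have Kne: "{k. k \<le> z \<and> d k = L k} \<noteq> {}" using fd by (auto simp: Lform)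
  have "closed {k. k \<le> z \<and> d k = L k}"
    unfolding L_def by (intro closed_Collect_conj closed_Collect_le closed_Collect_eq continuous_intros dc)
  note Kclosed = this
  have Kbound: "z - g z / \<phi> \<le> k" if "k \<in> {k. k \<le> z \<and> d k = L k}" for k
  proof -
    have "0 \<le> L k" using that f0[of k] fd[of k] by simp
    then show ?thesis using \<phi>pos by (simp add: L_def field_simps)
  qed
  have Kbdd: "bdd_below {k. k \<le> z \<and> d k = L k}" by (rule bdd_belowI) (rule Kbound)
  obtain r where r: "r \<in> {k. k \<le> z \<and> d k = L k}" "\<forall>x\<in>{k. k \<le> z \<and> d k = L k}. r \<le> x"
      "Inf (ereal ` {k. k \<le> z \<and> d k = L k}) = ereal r"
    using closed_set_minimum[OF Kclosed Kne Kbdd] by (elim exE conjE)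
  have slope: "\<phi> < \<sigma>"
  proof (rule ccontr)
    assume "\<not> \<phi> < \<sigma>"
    then have ge: "\<sigma> \<le> \<phi>" by simp
    have below: "L x \<le> \<sigma> * x - c" for x
    proof (rule ccontr)
      assume neg: "\<not> L x \<le> \<sigma> * x - c"
      define e where "e = L x - (\<sigma> * x - c)"
      have e: "e > 0" using neg by (simp add: e_def)
      have "\<forall>\<^sub>F y in at_top. f y - (\<sigma> * y - c) < e" by (rule order_tendstoD(2)[OF Atop e])
      then have "\<forall>\<^sub>F y in at_top. f y - (\<sigma> * y - c) < e \<and> x \<le> y" using eventually_ge_at_top[of x] by eventually_elim simp
      then obtain y where y: "f y - (\<sigma> * y - c) < e" "x \<le> y" using eventually_happens[of _ "at_top :: real filter"] by auto
      have "\<sigma> * (y - x) \<le> \<phi> * (y - x)" using ge y by (intro mult_right_mono) auto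
      then have "e \<le> L y - (\<sigma> * y - c)" unfolding e_def Lform by (simp add: algebra_simps)
      then show False using y Lf[of y] by simp
    qed
    have r1: "r \<le> z" "d r = L r" using r by auto
    have "0 \<le> \<sigma> * r - c" using below[of r] r1 f0[of r] fd[of r] by simp
    then have "r = z" using Az r1 by simp
    then have "0 < L z" using r1 fpos[of z] fd[of z] by simp
    have "0 < \<sigma> * z - c" using below[of z] \<open>0 < L z\<close> by simp
    define x where "x = z - (\<sigma> * z - c) / \<sigma>"
    have "\<sigma> * x - c = 0" using \<sigma> by (simp add: x_def field_simps)
    moreover have "x < z" using \<sigma> \<open>0 < \<sigma> * z - c\<close> by (simp add: x_def)
    ultimately show False using Az[of x] by simp
  qed
  have "\<exists>b\<ge>z. f b = (g z - \<phi> * z) + \<phi> * b"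
  proof (rule contact_right[where \<delta> = "(\<sigma> - \<phi>) / 2" and M = "2 * (c + g z - \<phi> * z) / (\<sigma> - \<phi>)"])
    show "(\<sigma> - \<phi>) / 2 * x \<le> f x - (g z - \<phi> * z + \<phi> * x)" if "2 * (c + g z - \<phi> * z) / (\<sigma> - \<phi>) \<le> x" for x
    proof -
      have "2 * (c + g z - \<phi> * z) \<le> x * (\<sigma> - \<phi>)" using that slope by (simp add: pos_divide_le_eq)
      then show ?thesis using A[of x] by (simp add: field_simps)
    qed
  qed (use fc Lf best slope in \<open>auto simp: Lform\<close>)
  then obtain b where b: "z \<le> b" "f b = L b" by (auto simp: Lform)
  have gL: "g y = L y" if "z \<le> y" "y \<le> b" for y
  proof (rule antisym)
    show "g y \<le> L y" unfolding Lform
      by (rule convex_le_line[OF gconv that]) (use gle[of b] b Lz in \<open>auto simp: Lform[symmetric]\<close>)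
  qed (rule Lg)
  have gcont: "continuous_on UNIV g" by (rule convex_on_continuous_at[OF gconv])
  let ?C = "{y. z \<le> y \<and> g y = f y}"
  have bC: "b \<in> ?C" using b gL[of b] by simp
  have Cclosed: "closed ?C" by (intro closed_Collect_conj closed_Collect_le closed_Collect_eq continuous_intros gcont fc)
  have Cne: "?C \<noteq> {}" using bC by (simp only: ex_in_conv[symmetric]) (rule exI)
  have "bdd_below ?C" by (rule bdd_belowI[of _ z]) simp
  from closed_set_minimum[OF Cclosed Cne this]
  obtain s where s: "s \<in> ?C" "\<forall>x\<in>?C. s \<le> x" "Inf (ereal ` ?C) = ereal s"
    by (elim exE conjE)
  have sb: "s \<le> b" using s(2) bC by (rule bspec)
  show ?thesis
  proof (rule that[OF s(3) Kne r(3) \<phi>pos])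
    show "r \<le> z" "d r = L r" "z \<le> s" using r s by auto
    show "L x \<le> f x" for x by (rule Lf)
    show "f s = L s" using s sb gL[of s] by simp
    show "r \<le> k" if "k \<le> z" "d k = L k" for k using bspec[OF r(2), of k] that by simp
    show "g y = L y" if "z \<le> y" "y \<le> s" for y using gL that sb by simp
    show "\<phi> \<le> w" if "\<And>x. g z + w * (x - z) \<le> f x" for w
    proof (rule \<phi>_lower)
      have line: "(g z - w * z) + w * x \<le> f x" for x using that[of x] by (simp add: algebra_simps)
      have "g z + w * (y - z) \<le> g y" for y using gline[OF line, of y] by (simp add: algebra_simps)
      then show "w \<in> SD" by (simp add: sub)
    qed
    show "L y < f y" if "z \<le> y" "y < s" for y
      using bspec[OF s(2), of y] that gL[of y] sb Lf[of y] by force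
  qed
qed

section \<open>Irreducible components\<close>

context curtain
begin

text \<open>
  The lemmas about \<open>G\<close> apply to the quantile function \<open>H\<close> of \<open>\<nu>\<close> through this instance of the locale.
\<close>

lemma curtain_nu: "curtain \<nu> \<nu>"
  using nu by unfold_locales (auto simp: le_c_def)

interpretation nn: curtain \<nu> \<nu> by (rule curtain_nu)

lemma mean_eq: "(LINT t:{0<..<1}|lborel. H t) = (LINT t:{0<..<1}|lborel. G t)"
proof -
  have "(\<integral>x. x \<partial>segment_law G 0 1) = (\<integral>x. x \<partial>segment_law H 0 1)"
    unfolding laws by (rule le_c_mean[OF order fin_moments])
  then show ?thesis
    using integral_segment_law[OF G_measurable, of "\<lambda>x. x" 0 1] integral_segment_law[OF H_measurable, of "\<lambda>x. x" 0 1]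
    by simp
qed

text \<open>
  At a zero \<open>z\<close> of \<open>D\<close> both quantile functions cross \<open>z\<close> at the same level \<open>c\<close>. The order makes the integral of
  \<open>H\<close> over \<open>(0, c)\<close> at most that of \<open>G\<close>, and then the equality of the put functions at \<open>z\<close> turns every estimate
  in \<open>put \<nu> z \<ge> \<integral>\<^sub>0\<^sup>c (z - H) \<ge> \<integral>\<^sub>0\<^sup>c (z - G) = put \<mu> z\<close> into an equality.
\<close>

lemma balance:
  assumes z: "D z = 0" and c: "0 \<le> c" "c \<le> 1"
    and lo: "\<And>t. 0 < t \<Longrightarrow> t < c \<Longrightarrow> G t \<le> z" and hi: "\<And>t. c < t \<Longrightarrow> t < 1 \<Longrightarrow> z \<le> G t"
  shows "(LINT t:{0<..<c}|lborel. H t) = (LINT t:{0<..<c}|lborel. G t)" (is ?A)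
    and "\<And>t. 0 < t \<Longrightarrow> t < c \<Longrightarrow> H t \<le> z" and "\<And>t. c < t \<Longrightarrow> t < 1 \<Longrightarrow> z \<le> H t"
proof -
  let ?h = "LINT t:{0<..<c}|lborel. H t" and ?g = "LINT t:{0<..<c}|lborel. G t"
  have split: "put \<nu> x = nn.J 0 c x + nn.J c 1 x" "put \<mu> x = J 0 c x + J c 1 x" for x
    using nn.J_add[of 0 c 1 x] J_add[of 0 c 1 x] c by (simp_all add: nn.put_mu put_mu)
  have le: "?h \<le> ?g"
  proof -
    consider "c = 0" | "c = 1" | "0 < c" "c < 1" using c by linarith
    then show ?thesis
    proof cases
      case 1 then show ?thesis by (simp add: set_lebesgue_integral_def)
    next
      case 2 then show ?thesis using mean_eq by simp
    next
      case 3
      have "nn.J 0 c (H c) = c * H c - ?h" using nn.J_eq_affine[of 0 c "H c"] 3 by simp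
      moreover have "nn.J c 1 (H c) = 0" using nn.J_eq_0[of c 1 "H c"] 3 by simp
      ultimately have "put \<nu> (H c) = c * H c - ?h" using split(1)[of "H c"] by simp
      moreover have "c * H c - ?g \<le> put \<mu> (H c)"
        using J_ge_affine[of 0 c "H c"] J_nonneg[of c 1 "H c"] split(2)[of "H c"] c by simp
      ultimately show ?thesis using D_nonneg[of "H c"] by (simp add: put_diff_def)
    qed
  qed
  have 1: "put \<mu> z = c * z - ?g"
    using split(2)[of z] J_eq_affineI[of 0 c z] J_eq_0I[of c 1 z] lo hi c by simp
  have 2: "put \<nu> z = put \<mu> z" using z by (simp add: put_diff_def)
  have 3: "c * z - ?h \<le> nn.J 0 c z" using nn.J_ge_affine[of 0 c z] c by simp
  have 4: "nn.J c 1 z = 0" and 5: "nn.J 0 c z = c * z - ?h" and A: ?A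
    using split(1)[of z] 1 2 3 le nn.J_nonneg[of c 1 z] by linarith+
  show ?A by (rule A)
  show "z \<le> H t" if "c < t" "t < 1" for t
  proof -
    have "(t - c) * max (z - H t) 0 \<le> nn.J c t z" using nn.J_ge[of c t z] that c by simp
    also have "\<dots> \<le> 0" using nn.J_add[of c t 1 z] nn.J_nonneg[of t 1 z] 4 that c by simp
    finally show ?thesis using that by (simp add: mult_le_0_iff)
  qed
  show "H t \<le> z" if t: "0 < t" "t < c" for t
  proof (rule ccontr)
    assume "\<not> H t \<le> z"
    then have "(c - t) * z < (c - t) * H t" using t by simp
    also have "\<dots> \<le> (LINT t:{t<..<c}|lborel. H t)"
      using nn.J_ge_affine[of t c "H t"] nn.J_eq_0[of t c "H t"] t c by simp
    finally have "(c - t) * z < (LINT t:{t<..<c}|lborel. H t)" .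
    moreover have "?h = (LINT t:{0<..<t}|lborel. H t) + (LINT t:{t<..<c}|lborel. H t)"
      using set_integral_split[of 0 c H t] H_integrable[of 0 c] t c by simp
    moreover have "t * z - (LINT t:{0<..<t}|lborel. H t) \<le> nn.J 0 t z"
      using nn.J_ge_affine[of 0 t z] t c by simp
    moreover have "nn.J 0 t z \<le> nn.J 0 c z" using nn.J_add[of 0 t c z] nn.J_nonneg[of t c z] t c by simp
    ultimately show False using 5 by (simp add: algebra_simps)
  qed
qed

lemma open_positive: "open {k. D k > 0}"
  by (intro open_Collect_less continuous_intros D_continuous)

text \<open>
  \<open>D\<close> vanishes at a finite end point, because a component could be continued across a point where \<open>D\<close> is
  positive.
\<close>

lemma component_facts:
  assumes I: "I \<in> irred_components \<mu> \<nu>"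
  shows component_positive: "x \<in> I \<Longrightarrow> 0 < D x"
    and component_nonempty: "I \<noteq> {}"
    and component_iff: "x \<in> I \<longleftrightarrow> left_end I < ereal x \<and> ereal x < right_end I"
    and D_left_end: "left_end I = ereal l \<Longrightarrow> D l = 0"
    and D_right_end: "right_end I = ereal r \<Longrightarrow> D r = 0"
proof -
  have I': "I \<in> components {k. D k > 0}" using I by (simp add: irred_components_def)
  have conn: "connected I" by (rule in_components_connected[OF I'])
  have opn: "open I" by (rule open_components[OF open_positive I'])
  show ne: "I \<noteq> {}" by (rule in_components_nonempty[OF I'])
  show pos: "x \<in> I \<Longrightarrow> 0 < D x" for x using in_components_subset[OF I'] by auto
  have seg: "x \<in> I" if "a \<in> I" "b \<in> I" "a \<le> x" "x \<le> b" for a b x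
    using connected_contains_Icc[OF conn that(1,2)] that by auto
  show iff: "x \<in> I \<longleftrightarrow> left_end I < ereal x \<and> ereal x < right_end I" for x
  proof
    assume "x \<in> I"
    then obtain e where e: "e > 0" "\<And>y. dist y x < e \<Longrightarrow> y \<in> I" using opn unfolding open_dist by blast
    have "x - e / 2 \<in> I" "x + e / 2 \<in> I" by (rule e(2); use e(1) in \<open>simp add: dist_real_def\<close>)+
    then have "left_end I \<le> ereal (x - e / 2)" "ereal (x + e / 2) \<le> right_end I"
      unfolding left_end_def right_end_def by (auto intro: Inf_lower Sup_upper)
    moreover have "ereal (x - e / 2) < ereal x" "ereal x < ereal (x + e / 2)" using e(1) by auto
    ultimately show "left_end I < ereal x \<and> ereal x < right_end I" by (meson le_less_trans less_le_trans)
  next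
    assume "left_end I < ereal x \<and> ereal x < right_end I"
    then obtain a b where "a \<in> I" "a < x" "b \<in> I" "x < b"
      unfolding left_end_def right_end_def Inf_less_iff less_Sup_iff by auto
    then show "x \<in> I" using seg[of a b x] by simp
  qed
  have D0: "D z = 0" if "\<And>e. e > 0 \<Longrightarrow> {z - e <..< z + e} \<inter> I \<noteq> {}" "z \<notin> I" for z
  proof (rule ccontr)
    assume "D z \<noteq> 0"
    then have "z \<in> {k. D k > 0}" using D_nonneg[of z] by simp
    then obtain e where e: "e > 0" "\<And>y. dist y z < e \<Longrightarrow> y \<in> {k. D k > 0}"
      using open_positive unfolding open_dist by blast
    have "{z - e <..< z + e} \<subseteq> {k. D k > 0}" using e(2) by (force simp: dist_real_def)
    then have "{z - e <..< z + e} \<subseteq> I"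
      using that(1)[OF e(1)] by (intro components_maximal[OF I']) (auto simp: Int_commute)
    moreover have "z \<in> {z - e <..< z + e}" using e(1) by simp
    ultimately show False using that(2) by blast
  qed
  show "D l = 0" if l: "left_end I = ereal l"
  proof (rule D0)
    show "l \<notin> I" using iff[of l] l by simp
    fix e :: real assume "e > 0"
    then have "left_end I < ereal (l + e)" using l by simp
    then obtain a where a: "a \<in> I" "a < l + e" unfolding left_end_def Inf_less_iff by auto
    moreover have "l < a" using iff[of a] a l by simp
    ultimately have "a \<in> {l - e <..< l + e} \<inter> I" using \<open>e > 0\<close> by simp
    then show "{l - e <..< l + e} \<inter> I \<noteq> {}" by blast
  qed
  show "D r = 0" if r: "right_end I = ereal r"
  proof (rule D0)
    show "r \<notin> I" using iff[of r] r by simp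
    fix e :: real assume "e > 0"
    then have "ereal (r - e) < right_end I" using r by simp
    then obtain a where a: "a \<in> I" "r - e < a" unfolding right_end_def less_Sup_iff by auto
    moreover have "a < r" using iff[of a] a r by simp
    ultimately have "a \<in> {r - e <..< r + e} \<inter> I" using \<open>e > 0\<close> by simp
    then show "{r - e <..< r + e} \<inter> I \<noteq> {}" by blast
  qed
qed

text \<open>
  \<open>D\<close> vanishes at finite end points and tends to 0 at infinite ones.
\<close>

lemma component_near_ends:
  assumes I: "I \<in> irred_components \<mu> \<nu>" and k: "k \<in> I" and e: "0 < e"
  shows component_near_left: "\<exists>a\<in>I. a \<le> k \<and> D a < e"
    and component_near_right: "\<exists>b\<in>I. k \<le> b \<and> D b < e"
proof -
  note iff = component_iff[OF I]
  have k': "left_end I < ereal k" "ereal k < right_end I" using iff k by auto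
  show "\<exists>a\<in>I. a \<le> k \<and> D a < e"
  proof (cases "left_end I")
    case (real l)
    have "(D \<longlongrightarrow> D l) (at_right l)"
      using D_continuous[of UNIV] by (auto simp: continuous_on_def intro: tendsto_within_subset)
    then have "\<forall>\<^sub>F a in at_right l. D a < e" by (rule order_tendstoD) (use D_left_end[OF I real] e in simp)
    moreover have "\<forall>\<^sub>F a in at_right l. a < k"
      using real k' by (intro order_tendstoD(2)[of "\<lambda>x. x" l]) (auto intro: tendsto_ident_at)
    moreover have "\<forall>\<^sub>F a in at_right l. l < a" by (rule eventually_at_right_less)
    ultimately have "\<forall>\<^sub>F a in at_right l. D a < e \<and> a < k \<and> l < a" by eventually_elim simp
    then obtain a where a: "D a < e" "a < k" "l < a" using eventually_happens[of _ "at_right l"] by auto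
    have "ereal a < right_end I" using a(2) k'(2) by (metis ereal_less_eq(3) less_imp_le le_less_trans)
    then have "a \<in> I" using iff[of a] real a by simp
    then show ?thesis using a by (intro bexI[of _ a]) auto
  next
    case MInf
    have "\<forall>\<^sub>F a in at_bot. D a < e" by (rule order_tendstoD(2)[OF D_at_bot e])
    then have "\<forall>\<^sub>F a in at_bot. D a < e \<and> a \<le> k" using eventually_le_at_bot[of k] by eventually_elim simp
    then obtain a where a: "D a < e" "a \<le> k" using eventually_happens[of _ "at_bot :: real filter"] by auto
    have "ereal a < right_end I" using a(2) k'(2) by (metis ereal_less_eq(3) le_less_trans)
    then have "a \<in> I" using iff[of a] MInf by simp
    then show ?thesis using a by (intro bexI[of _ a]) auto
  qed (use k' in auto)
  show "\<exists>b\<in>I. k \<le> b \<and> D b < e"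
  proof (cases "right_end I")
    case (real r)
    have "(D \<longlongrightarrow> D r) (at_left r)"
      using D_continuous[of UNIV] by (auto simp: continuous_on_def intro: tendsto_within_subset)
    then have "\<forall>\<^sub>F a in at_left r. D a < e" by (rule order_tendstoD) (use D_right_end[OF I real] e in simp)
    moreover have "\<forall>\<^sub>F a in at_left r. k < a"
      using real k' by (intro order_tendstoD(1)[of "\<lambda>x. x" r]) (auto intro: tendsto_ident_at)
    moreover have "\<forall>\<^sub>F a in at_left r. a < r" by (simp add: eventually_at_filter)
    ultimately have "\<forall>\<^sub>F a in at_left r. D a < e \<and> k < a \<and> a < r" by eventually_elim simp
    then obtain a where a: "D a < e" "k < a" "a < r" using eventually_happens[of _ "at_left r"] by auto
    have "left_end I < ereal a" using a(2) k'(1) by (metis ereal_less_eq(3) less_imp_le less_le_trans)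
    then have "a \<in> I" using iff[of a] real a by simp
    then show ?thesis using a by (intro bexI[of _ a]) auto
  next
    case PInf
    have "\<forall>\<^sub>F a in at_top. D a < e" by (rule order_tendstoD(2)[OF D_at_top e])
    then have "\<forall>\<^sub>F a in at_top. D a < e \<and> k \<le> a" using eventually_ge_at_top[of k] by eventually_elim simp
    then obtain a where a: "D a < e" "k \<le> a" using eventually_happens[of _ "at_top :: real filter"] by auto
    have "left_end I < ereal a" using a(2) k'(1) by (metis ereal_less_eq(3) less_le_trans)
    then have "a \<in> I" using iff[of a] PInf by simp
    then show ?thesis using a by (intro bexI[of _ a]) auto
  qed (use k' in auto)
qed

lemma component_cases:
  assumes I: "I \<in> irred_components \<mu> \<nu>" and x: "x \<notin> I"
  obtains (left) "ereal x \<le> left_end I" "\<And>y. y \<in> I \<Longrightarrow> x < y" | (right) "right_end I \<le> ereal x" "\<And>y. y \<in> I \<Longrightarrow> y < x"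
proof (cases "left_end I < ereal x")
  case True
  then have r: "right_end I \<le> ereal x" using component_iff[OF I, of x] x by auto
  moreover have "y < x" if "y \<in> I" for y
    using component_iff[OF I, of y] that r less_le_trans[of "ereal y" "right_end I" "ereal x"] by simp
  ultimately show ?thesis using right by blast
next
  case False
  then have l: "ereal x \<le> left_end I" by simp
  moreover have "x < y" if "y \<in> I" for y
    using component_iff[OF I, of y] that l le_less_trans[of "ereal x" "left_end I" "ereal y"] by simp
  ultimately show ?thesis using left by blast
qed

text \<open>
  If no quantile fell into \<open>I\<close>, the put function of \<open>\<mu>\<close> would be affine on \<open>I\<close> and \<open>D\<close> convex there. A
  positive convex function cannot come arbitrarily close to 0 at both ends of \<open>I\<close>.
\<close>

lemma component_charged:
  assumes I: "I \<in> irred_components \<mu> \<nu>"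
  shows "\<exists>t. 0 < t \<and> t < 1 \<and> G t \<in> I"
proof (rule ccontr)
  assume no: "\<not> ?thesis"
  obtain k where k: "k \<in> I" using component_nonempty[OF I] by blast
  define c where "c = measure \<mu> {..k}"
  have c: "0 \<le> c" "c \<le> 1"
    using finite_measure.finite_measure_mono[OF finites(1), of "{..k}" UNIV] borels by (auto simp: c_def)
  have aff: "put \<mu> y = c * y - (LINT t:{0<..<c}|lborel. G t)" if y: "y \<in> I" for y
  proof -
    have "G t \<le> y" if "0 < t" "t < c" for t
    proof -
      have "G t \<le> k" using G_le_iff[of t k] that c by (simp add: c_def)
      have "G t \<notin> I" using no that c by auto
      then show ?thesis using component_cases[OF I, of "G t"] y k \<open>G t \<le> k\<close> by (metis less_imp_le not_le)
    qed
    moreover have "y \<le> G t" if "c < t" "t < 1" for t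
    proof -
      have "k < G t" using G_le_iff[of t k] that c by (simp add: c_def not_le[symmetric])
      have "G t \<notin> I" using no that c by auto
      then show ?thesis using component_cases[OF I, of "G t"] y k \<open>k < G t\<close> by (metis less_imp_le less_asym)
    qed
    ultimately show ?thesis
      using J_add[of 0 c 1 y] J_eq_affineI[of 0 c y] J_eq_0I[of c 1 y] c by (simp add: put_mu)
  qed
  define e where "e = D k / 2"
  have e: "0 < e" "e < D k" using component_positive[OF I k] by (auto simp: e_def)
  obtain a b where ab: "a \<in> I" "a \<le> k" "D a < e" "b \<in> I" "k \<le> b" "D b < e"
    using component_near_left[OF I k e(1)] component_near_right[OF I k e(1)] by blast
  have "put \<nu> k \<le> (e - (LINT t:{0<..<c}|lborel. G t)) + c * k"
  proof (rule convex_le_line[OF convex_on_put[OF fin_moments(2)] ab(2,5)])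
    show "put \<nu> a \<le> (e - (LINT t:{0<..<c}|lborel. G t)) + c * a"
      using ab(3) aff[OF ab(1)] by (simp add: put_diff_def)
    show "put \<nu> b \<le> (e - (LINT t:{0<..<c}|lborel. G t)) + c * b"
      using ab(6) aff[OF ab(4)] by (simp add: put_diff_def)
  qed
  then have "D k \<le> e" using aff[OF k] by (simp add: put_diff_def)
  then show False using e by simp
qed

lemma u_bounds:
  assumes I: "I \<in> irred_components \<mu> \<nu>"
  shows u_left_ge_0: "0 \<le> u_left \<mu> I" and u_right_le_1: "u_right \<mu> I \<le> 1"
    and u_left_less_u_right: "u_left \<mu> I < u_right \<mu> I"
    and above_u_left: "u_left \<mu> I < t \<Longrightarrow> t < 1 \<Longrightarrow> left_end I < ereal (G t)"
    and below_u_left: "0 < t \<Longrightarrow> t \<le> u_left \<mu> I \<Longrightarrow> ereal (G t) \<le> left_end I"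
    and below_u_right: "0 < t \<Longrightarrow> t < u_right \<mu> I \<Longrightarrow> ereal (G t) < right_end I"
    and above_u_right: "u_right \<mu> I < t \<Longrightarrow> t < 1 \<Longrightarrow> right_end I \<le> ereal (G t)"
proof -
  define A where "A = {u. 0 < u \<and> u < mass \<mu> \<and> left_end I < ereal (G u)}"
  define B where "B = {u. 0 < u \<and> u < mass \<mu> \<and> ereal (G u) < right_end I}"
  have ul: "u_left \<mu> I = Inf A" and ur: "u_right \<mu> I = Sup B" by (simp_all add: u_left_def u_right_def A_def B_def)
  obtain t\<^sub>0 where t0: "0 < t\<^sub>0" "t\<^sub>0 < 1" "G t\<^sub>0 \<in> I" using component_charged[OF I] by blast
  have A0: "t\<^sub>0 \<in> A" and B0: "t\<^sub>0 \<in> B" using t0 component_iff[OF I] by (auto simp: A_def B_def)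
  have bA: "bdd_below A" by (rule bdd_belowI[of _ 0]) (auto simp: A_def)
  have bB: "bdd_above B" by (rule bdd_aboveI[of _ 1]) (auto simp: B_def)
  show ul0: "0 \<le> u_left \<mu> I" unfolding ul using A0 by (intro cInf_greatest) (auto simp: A_def)
  show ur1: "u_right \<mu> I \<le> 1" unfolding ur using B0 by (intro cSup_least) (auto simp: B_def)
  show above: "left_end I < ereal (G t)" if t: "u_left \<mu> I < t" "t < 1" for t
  proof -
    obtain u where u: "u \<in> A" "u < t" using t A0 cInf_less_iff[of A t] bA unfolding ul by auto
    then have "ereal (G u) \<le> ereal (G t)" using G_mono[of u t] t by (simp add: A_def)
    moreover have "left_end I < ereal (G u)" using u(1) by (simp add: A_def)
    ultimately show ?thesis by (rule less_le_trans[rotated])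
  qed
  show below: "ereal (G t) \<le> left_end I" if t: "0 < t" "t \<le> u_left \<mu> I" for t
  proof (rule ccontr)
    assume neg: "\<not> ereal (G t) \<le> left_end I"
    have "u_left \<mu> I \<le> t\<^sub>0" unfolding ul by (rule cInf_lower[OF A0 bA])
    then have t1: "t < 1" using t t0 by simp
    \<comment> \<open>For a finite end point \<open>l\<close> the condition \<open>l < G u\<close> reads \<open>measure \<mu> {..l} < u\<close>, so it persists slightly below \<open>t\<close>
      and the infimum is not attained.\<close>
    have "\<exists>u<t. 0 < u \<and> left_end I < ereal (G u)"
    proof (cases "left_end I")
      case (real l)
      then have "measure \<mu> {..l} < t" using neg G_le_iff[of t l] t t1 by simp
      moreover have "0 \<le> measure \<mu> {..l}" by simp
      ultimately obtain u where u: "measure \<mu> {..l} < u" "u < t" using dense by blast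
      then have "0 < u" using \<open>0 \<le> measure \<mu> {..l}\<close> by linarith
      then have "l < G u" using G_le_iff[of u l] u t1 by simp
      then show ?thesis using u \<open>0 < u\<close> real by auto
    next
      case MInf
      then show ?thesis using t by (intro exI[of _ "t / 2"]) auto
    qed (use neg in auto)
    then obtain u where "u < t" "u \<in> A" using t1 by (auto simp: A_def)
    then show False using cInf_lower[OF _ bA, of u] t unfolding ul by simp
  qed
  show "ereal (G t) < right_end I" if t: "0 < t" "t < u_right \<mu> I" for t
  proof -
    obtain u where u: "u \<in> B" "t < u" using t B0 less_cSup_iff[of B t] bB unfolding ur by auto
    then have "ereal (G t) \<le> ereal (G u)" using G_mono[of t u] t by (simp add: B_def)
    moreover have "ereal (G u) < right_end I" using u(1) by (simp add: B_def)
    ultimately show ?thesis by (rule le_less_trans)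
  qed
  show "right_end I \<le> ereal (G t)" if t: "u_right \<mu> I < t" "t < 1" for t
  proof (rule ccontr)
    assume "\<not> right_end I \<le> ereal (G t)"
    moreover have "0 < t" using cSup_upper[OF B0 bB] t t0 unfolding ur by simp
    ultimately have "t \<in> B" using t by (auto simp: B_def)
    then show False using cSup_upper[OF _ bB, of t] t unfolding ur by simp
  qed
  have "u_left \<mu> I < t\<^sub>0"
    using below[of t\<^sub>0] t0 component_iff[OF I, of "G t\<^sub>0"] by (meson leD not_le)
  moreover have "t\<^sub>0 \<le> u_right \<mu> I" unfolding ur by (rule cSup_upper[OF B0 bB])
  ultimately show "u_left \<mu> I < u_right \<mu> I" by simp
qed

lemma G_in_component:
  assumes I: "I \<in> irred_components \<mu> \<nu>" and t: "u_left \<mu> I < t" "t < u_right \<mu> I"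
  shows "G t \<in> I"
  using above_u_left[OF I, of t] below_u_right[OF I, of t] component_iff[OF I] u_left_ge_0[OF I] u_right_le_1[OF I] t
  by auto

lemma u_bounds_of_G:
  assumes I: "I \<in> irred_components \<mu> \<nu>" and t: "0 < t" "t < 1" "G t \<in> I"
  shows "u_left \<mu> I < t" "t \<le> u_right \<mu> I"
  using below_u_left[OF I, of t] above_u_right[OF I, of t] component_iff[OF I, of "G t"] t by (meson leD not_le)+

lemma component_unique:
  assumes "I \<in> irred_components \<mu> \<nu>" "I' \<in> irred_components \<mu> \<nu>" "x \<in> I" "x \<in> I'"
  shows "I = I'"
  using assms components_eq[of I "{k. D k > 0}" I'] unfolding irred_components_def by blast

lemma component_exists:
  assumes "0 < D x"
  shows "\<exists>I\<in>irred_components \<mu> \<nu>. x \<in> I"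
  using assms Union_components[of "{k. D k > 0}"] unfolding irred_components_def by blast

lemma component_borel: "I \<in> irred_components \<mu> \<nu> \<Longrightarrow> I \<in> sets borel"
  unfolding irred_components_def by (intro borel_open open_components[OF open_positive])

text \<open>
  A level belongs to \<open>(u_left, u_right)\<close> if and only if its quantile lies in \<open>I\<close>, with \<open>u_right\<close> as the only
  possible exception.
\<close>

lemma restrict_measure_component:
  assumes I: "I \<in> irred_components \<mu> \<nu>"
  shows "restrict_measure \<mu> I = segment_law G (u_left \<mu> I) (u_right \<mu> I)"
proof (rule measure_eqI)
  let ?l = "u_left \<mu> I" and ?r = "u_right \<mu> I"
  note b = u_left_ge_0[OF I] u_right_le_1[OF I] u_left_less_u_right[OF I]
  have [measurable]: "I \<in> sets borel" by (rule component_borel[OF I])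
  show "sets (restrict_measure \<mu> I) = sets (segment_law G ?l ?r)"
    by (simp add: restrict_measure_def borels)
  fix A assume "A \<in> sets (restrict_measure \<mu> I)"
  then have A[measurable]: "A \<in> sets borel" by (simp add: restrict_measure_def borels)
  have Im: "I \<in> sets \<mu>" "A \<in> sets \<mu>" by (simp_all add: borels)
  have "emeasure (restrict_measure \<mu> I) A = (\<integral>\<^sup>+x. indicator I x * indicator A x \<partial>\<mu>)"
    unfolding restrict_measure_def by (subst emeasure_density) (use Im in auto)
  also have "\<dots> = emeasure \<mu> (I \<inter> A)"
    using Im by (simp add: indicator_inter_arith[symmetric])
  also have "\<dots> = emeasure (segment_law G 0 1) (I \<inter> A)" by (simp add: laws)
  also have "\<dots> = emeasure lborel {t \<in> {0<..<1}. G t \<in> I \<inter> A}"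
    by (rule emeasure_segment_law) auto
  also have "\<dots> = emeasure lborel {t \<in> {?l<..<?r}. G t \<in> A}"
  proof (rule emeasure_eq_AE)
    show "AE t in lborel. t \<in> {t \<in> {0<..<1}. G t \<in> I \<inter> A} \<longleftrightarrow> t \<in> {t \<in> {?l<..<?r}. G t \<in> A}"
      using AE_lborel_singleton[of ?r]
    proof eventually_elim
      case (elim t)
      then show ?case using G_in_component[OF I, of t] u_bounds_of_G[OF I, of t] b by auto
    qed
  qed auto
  also have "\<dots> = emeasure (segment_law G ?l ?r) A" by (rule emeasure_segment_law[symmetric]) auto
  finally show "emeasure (restrict_measure \<mu> I) A = emeasure (segment_law G ?l ?r) A" .
qed

lemma quantile_segment_law:
  assumes ab: "0 \<le> a" "b \<le> 1" and s: "0 < s" "s < b - a"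
  shows "quantile (segment_law G a b) s = G (a + s)"
proof -
  let ?L = "segment_law G a b"
  have fin: "finite_measure ?L" by (rule finite_measure_segment_law) simp
  have mass: "mass ?L = b - a" by (rule mass_segment_law) (use s in auto)
  have as: "0 < a + s" "a + s < 1" using ab s by auto
  have "quantile ?L s \<le> x \<longleftrightarrow> G (a + s) \<le> x" for x
  proof -
    have 1: "quantile ?L s \<le> x \<longleftrightarrow> s \<le> measure ?L {..x}"
      by (rule quantile_le_iff[OF fin]) (use s mass in auto)
    have meas: "emeasure ?L {..x} = emeasure lborel {t \<in> {a<..<b}. G t \<le> x}"
      by (subst emeasure_segment_law) auto
    have em: "emeasure ?L {..x} = ennreal (measure ?L {..x})"
      by (rule finite_measure.emeasure_eq_measure[OF fin])
    show ?thesis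
    proof
      assume x: "G (a + s) \<le> x"
      have "{a<..a + s} \<subseteq> {t \<in> {a<..<b}. G t \<le> x}"
      proof
        fix t assume t: "t \<in> {a<..a + s}"
        then have "G t \<le> G (a + s)" using ab as by (intro G_mono) auto
        then show "t \<in> {t \<in> {a<..<b}. G t \<le> x}" using t s x by auto
      qed
      then have "emeasure lborel {a<..a + s} \<le> emeasure lborel {t \<in> {a<..<b}. G t \<le> x}"
        by (rule emeasure_mono) auto
      then have "ennreal s \<le> ennreal (measure ?L {..x})" using em meas s by simp
      then show "quantile ?L s \<le> x" using 1 by simp
    next
      assume q: "quantile ?L s \<le> x"
      show "G (a + s) \<le> x"
      proof (rule ccontr)
        assume "\<not> G (a + s) \<le> x"
        then have F: "measure \<mu> {..x} < a + s" using G_le_iff[OF as] by simp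
        define c where "c = max a (measure \<mu> {..x})"
        have c: "a \<le> c" "c < a + s" using F s by (auto simp: c_def)
        have "{t \<in> {a<..<b}. G t \<le> x} \<subseteq> {a<..c}"
        proof
          fix t assume "t \<in> {t \<in> {a<..<b}. G t \<le> x}"
          then show "t \<in> {a<..c}" using G_le_iff[of t x] ab by (auto simp: c_def)
        qed
        then have "emeasure lborel {t \<in> {a<..<b}. G t \<le> x} \<le> emeasure lborel {a<..c}"
          by (rule emeasure_mono) auto
        then have "ennreal (measure ?L {..x}) \<le> ennreal (c - a)" using em meas c by simp
        then have "measure ?L {..x} \<le> c - a" using c by simp
        then show False using q 1 c by simp
      qed
    qed
  qed
  from this[of "G (a + s)"] this[of "quantile ?L s"] show ?thesis by simp
qed

text \<open>
  At a finite end point of \<open>I\<close> these are instances of \<open>balance\<close>. An infinite end point belongs to the level 0 or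
  1, where only the equality of the means has a content.
\<close>

lemma target_bounds:
  assumes I: "I \<in> irred_components \<mu> \<nu>"
  shows target_balance_left: "(LINT t:{0<..<u_left \<mu> I}|lborel. H t) = (LINT t:{0<..<u_left \<mu> I}|lborel. G t)"
    and target_balance_right: "(LINT t:{0<..<u_right \<mu> I}|lborel. H t) = (LINT t:{0<..<u_right \<mu> I}|lborel. G t)"
    and H_below_left: "\<And>t. 0 < t \<Longrightarrow> t < u_left \<mu> I \<Longrightarrow> ereal (H t) \<le> left_end I"
    and H_above_left: "\<And>t. u_left \<mu> I < t \<Longrightarrow> t < 1 \<Longrightarrow> left_end I \<le> ereal (H t)"
    and H_below_right: "\<And>t. 0 < t \<Longrightarrow> t < u_right \<mu> I \<Longrightarrow> ereal (H t) \<le> right_end I"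
    and H_above_right: "\<And>t. u_right \<mu> I < t \<Longrightarrow> t < 1 \<Longrightarrow> right_end I \<le> ereal (H t)"
proof -
  let ?l = "u_left \<mu> I" and ?r = "u_right \<mu> I"
  note b = u_left_ge_0[OF I] u_right_le_1[OF I] u_left_less_u_right[OF I]
  obtain k where k: "k \<in> I" using component_nonempty[OF I] by blast
  have k': "left_end I < ereal k" "ereal k < right_end I" using component_iff[OF I] k by auto
  have L: "(LINT t:{0<..<?l}|lborel. H t) = (LINT t:{0<..<?l}|lborel. G t) \<and>
    (\<forall>t. 0 < t \<longrightarrow> t < ?l \<longrightarrow> ereal (H t) \<le> left_end I) \<and> (\<forall>t. ?l < t \<longrightarrow> t < 1 \<longrightarrow> left_end I \<le> ereal (H t))"
  proof (cases "left_end I")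
    case (real z)
    have 1: "G t \<le> z" if "0 < t" "t < ?l" for t using below_u_left[OF I, of t] that real by simp
    have 2: "z \<le> G t" if "?l < t" "t < 1" for t using above_u_left[OF I, of t] that real by simp
    note bal = balance[OF D_left_end[OF I real] b(1) _ 1 2]
    show ?thesis using bal b real by auto
  next
    case MInf
    have "\<not> 0 < ?l" using below_u_left[OF I, of "?l"] MInf by auto
    then have "?l = 0" using b by simp
    then show ?thesis using MInf by (simp add: set_lebesgue_integral_def)
  qed (use k' in auto)
  have R: "(LINT t:{0<..<?r}|lborel. H t) = (LINT t:{0<..<?r}|lborel. G t) \<and>
    (\<forall>t. 0 < t \<longrightarrow> t < ?r \<longrightarrow> ereal (H t) \<le> right_end I) \<and> (\<forall>t. ?r < t \<longrightarrow> t < 1 \<longrightarrow> right_end I \<le> ereal (H t))"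
  proof (cases "right_end I")
    case (real z)
    have 1: "G t \<le> z" if "0 < t" "t < ?r" for t using below_u_right[OF I, of t] that real by simp
    have 2: "z \<le> G t" if "?r < t" "t < 1" for t using above_u_right[OF I, of t] that real by simp
    note bal = balance[OF D_right_end[OF I real] _ b(2) 1 2]
    show ?thesis using bal b real by auto
  next
    case PInf
    have "\<not> ?r < 1" using above_u_right[OF I, of "(?r + 1) / 2"] PInf by auto
    then have "?r = 1" using b by simp
    then show ?thesis using mean_eq PInf by simp
  qed (use k' in auto)
  show "(LINT t:{0<..<u_left \<mu> I}|lborel. H t) = (LINT t:{0<..<u_left \<mu> I}|lborel. G t)"
    "(LINT t:{0<..<u_right \<mu> I}|lborel. H t) = (LINT t:{0<..<u_right \<mu> I}|lborel. G t)"
    "\<And>t. 0 < t \<Longrightarrow> t < u_left \<mu> I \<Longrightarrow> ereal (H t) \<le> left_end I"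
    "\<And>t. u_left \<mu> I < t \<Longrightarrow> t < 1 \<Longrightarrow> left_end I \<le> ereal (H t)"
    "\<And>t. 0 < t \<Longrightarrow> t < u_right \<mu> I \<Longrightarrow> ereal (H t) \<le> right_end I"
    "\<And>t. u_right \<mu> I < t \<Longrightarrow> t < 1 \<Longrightarrow> right_end I \<le> ereal (H t)"
    using L R by auto
qed

text \<open>
  For strikes in \<open>I\<close> the levels outside \<open>(u_left, u_right)\<close> contribute equally to the put functions of \<open>\<mu>\<close> and
  \<open>\<nu>\<close>, so all of \<open>D\<close> is due to the levels inside. For other strikes the levels inside balance.
\<close>

lemma put_target:
  assumes I: "I \<in> irred_components \<mu> \<nu>"
  shows "nn.J (u_left \<mu> I) (u_right \<mu> I) k = J (u_left \<mu> I) (u_right \<mu> I) k + (if k \<in> I then D k else 0)"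
proof -
  let ?l = "u_left \<mu> I" and ?r = "u_right \<mu> I"
  note b = u_left_ge_0[OF I] u_right_le_1[OF I] u_left_less_u_right[OF I]
  let ?h = "\<lambda>a b. LINT t:{a<..<b}|lborel. H t" and ?g = "\<lambda>a b. LINT t:{a<..<b}|lborel. G t"
  have D: "D k = (nn.J 0 ?l k - J 0 ?l k) + (nn.J ?l ?r k - J ?l ?r k) + (nn.J ?r 1 k - J ?r 1 k)"
    using nn.J_add[of 0 ?l 1 k] nn.J_add[of ?l ?r 1 k] J_add[of 0 ?l 1 k] J_add[of ?l ?r 1 k] b
    by (simp add: put_diff_def put_mu nn.put_mu)
  show ?thesis
  proof (cases "k \<in> I")
    case True
    then have k: "left_end I < ereal k" "ereal k < right_end I" using component_iff[OF I] by auto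
    have "G t \<le> k" if "0 < t" "t < ?l" for t
      using below_u_left[OF I, of t] that k le_less_trans[of "ereal (G t)" "left_end I" "ereal k"] by simp
    moreover have "H t \<le> k" if "0 < t" "t < ?l" for t
      using H_below_left[OF I, of t] that k le_less_trans[of "ereal (H t)" "left_end I" "ereal k"] by simp
    ultimately have "nn.J 0 ?l k - J 0 ?l k = 0"
      using J_eq_affineI[of 0 ?l k] nn.J_eq_affineI[of 0 ?l k] target_balance_left[OF I] b by simp
    moreover have "k \<le> G t" if "?r < t" "t < 1" for t
      using above_u_right[OF I, of t] that k less_le_trans[of "ereal k" "right_end I" "ereal (G t)"] by simp
    moreover have "k \<le> H t" if "?r < t" "t < 1" for t
      using H_above_right[OF I, of t] that k less_le_trans[of "ereal k" "right_end I" "ereal (H t)"] by simp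
    ultimately show ?thesis using D True J_eq_0I[of ?r 1 k] nn.J_eq_0I[of ?r 1 k] by simp
  next
    case False
    show ?thesis
    proof (rule component_cases[OF I False])
      assume left: "ereal k \<le> left_end I"
      have "k \<le> G t" if "?l < t" "t < ?r" for t
        using above_u_left[OF I, of t] that left b le_less_trans[of "ereal k" "left_end I" "ereal (G t)"] by simp
      moreover have "k \<le> H t" if "?l < t" "t < ?r" for t
        using H_above_left[OF I, of t] that left b order_trans[of "ereal k" "left_end I" "ereal (H t)"] by simp
      ultimately show ?thesis using False J_eq_0I[of ?l ?r k] nn.J_eq_0I[of ?l ?r k] by simp
    next
      assume right: "right_end I \<le> ereal k"
      have "G t \<le> k" if "?l < t" "t < ?r" for t
        using below_u_right[OF I, of t] that right b less_le_trans[of "ereal (G t)" "right_end I" "ereal k"] by simp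
      moreover have "H t \<le> k" if "?l < t" "t < ?r" for t
        using H_below_right[OF I, of t] that right b order_trans[of "ereal (H t)" "right_end I" "ereal k"] by simp
      moreover have "?h 0 ?r = ?h 0 ?l + ?h ?l ?r" "?g 0 ?r = ?g 0 ?l + ?g ?l ?r"
        by (rule set_integral_split; use b in \<open>simp add: G_integrable H_integrable\<close>)+
      ultimately show ?thesis
        using False J_eq_affineI[of ?l ?r k] nn.J_eq_affineI[of ?l ?r k] target_balance_left[OF I] target_balance_right[OF I] b
        by simp
    qed
  qed
qed

text \<open>
  The part of \<open>\<nu>\<close> with the same levels is the shadow. Its minimality comes from the strikes in \<open>I\<close>: there the
  put functions of \<open>\<mu>\<close> and of its restriction to \<open>I\<close> differ by an affine function, and a convex function that
  exceeds it by at most \<open>D\<close> does not exceed it at all, since \<open>D\<close> is small near both ends of \<open>I\<close>.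
\<close>

lemma shadow_component:
  assumes I: "I \<in> irred_components \<mu> \<nu>"
  shows "shadow \<nu> (segment_law G (u_left \<mu> I) (u_right \<mu> I)) = segment_law H (u_left \<mu> I) (u_right \<mu> I)"
proof -
  let ?l = "u_left \<mu> I" and ?r = "u_right \<mu> I"
  note b = u_left_ge_0[OF I] u_right_le_1[OF I] u_left_less_u_right[OF I]
  show ?thesis
  proof (rule shadow_eqI)
    show "fin_moment (segment_law G ?l ?r)" "fin_moment (segment_law H ?l ?r)" "fin_moment \<nu>"
      using b fin_moment_G fin_moment_H fin_moments by auto
    show "mass (segment_law H ?l ?r) = mass (segment_law G ?l ?r)"
      using b by (simp add: mass_segment_law)
    have "emeasure (segment_law H ?l ?r) A \<le> emeasure (segment_law H 0 1) A" if [measurable]: "A \<in> sets borel" for A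
      unfolding emeasure_segment_law[OF H_measurable that] using b by (intro emeasure_mono) auto
    then show "segment_law H ?l ?r \<le> \<nu>"
      by (subst le_measure) (auto simp: laws borels)
    show "put (segment_law G ?l ?r) k \<le> put (segment_law H ?l ?r) k" for k
      using put_target[OF I, of k] D_nonneg[of k] by (simp add: J_eq_put nn.J_eq_put)
    fix g k assume g: "convex_on UNIV g" "\<And>x. g x \<le> put \<nu> x - put (segment_law G ?l ?r) x"
    show "g k \<le> put \<nu> k - put (segment_law H ?l ?r) k"
    proof (cases "k \<in> I")
      case False
      then show ?thesis using put_target[OF I, of k] g(2)[of k] by (simp add: J_eq_put nn.J_eq_put)
    next
      case True
      define C where "C = (LINT t:{0<..<?l}|lborel. G t)"
      have aff: "put \<nu> y - J ?l ?r y = D y + (- C + ?l * y)" if "y \<in> I" for y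
      proof -
        have y: "left_end I < ereal y" "ereal y < right_end I" using component_iff[OF I] that by auto
        have "G t \<le> y" if "0 < t" "t < ?l" for t
          using below_u_left[OF I, of t] that y le_less_trans[of "ereal (G t)" "left_end I" "ereal y"] by simp
        moreover have "y \<le> G t" if "?r < t" "t < 1" for t
          using above_u_right[OF I, of t] that y less_le_trans[of "ereal y" "right_end I" "ereal (G t)"] by simp
        ultimately show ?thesis
          using J_add[of 0 ?l 1 y] J_add[of ?l ?r 1 y] J_eq_affineI[of 0 ?l y] J_eq_0I[of ?r 1 y] b
          by (simp add: put_diff_def put_mu C_def)
      qed
      have "g k \<le> - C + ?l * k"
      proof (rule field_le_epsilon)
        fix e :: real assume e: "0 < e"
        obtain a where a: "a \<in> I" "a \<le> k" "D a < e" using component_near_left[OF I True e] by blast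
        obtain b where b: "b \<in> I" "k \<le> b" "D b < e" using component_near_right[OF I True e] by blast
        have "g k \<le> (e - C) + ?l * k"
        proof (rule convex_le_line[OF g(1) a(2) b(2)])
          show "g a \<le> (e - C) + ?l * a" using g(2)[of a] aff[OF a(1)] a(3) by (simp add: J_eq_put)
          show "g b \<le> (e - C) + ?l * b" using g(2)[of b] aff[OF b(1)] b(3) by (simp add: J_eq_put)
        qed
        then show "g k \<le> - C + ?l * k + e" by simp
      qed
      then show ?thesis
        using aff[OF True] put_target[OF I, of k] True by (simp add: J_eq_put nn.J_eq_put)
    qed
  qed
qed

text \<open>
  Compared with \<open>E u\<close>, the local problem drops \<open>D\<close> outside \<open>I\<close> and the levels above \<open>u_right\<close>. This
  lowers the function, but not between the end points of \<open>I\<close>, which is why tangents of the local problem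
  are tangents of \<open>E u\<close>.
\<close>

lemma put_diff_upto_component:
  assumes I: "I \<in> irred_components \<mu> \<nu>" and u: "u_left \<mu> I < u" "u < u_right \<mu> I"
  shows "put_diff_upto (segment_law G (u_left \<mu> I) (u_right \<mu> I)) (segment_law H (u_left \<mu> I) (u_right \<mu> I)) (u - u_left \<mu> I) x =
    (if x \<in> I then D x else 0) + J u (u_right \<mu> I) x"
proof -
  let ?l = "u_left \<mu> I" and ?r = "u_right \<mu> I"
  let ?L = "segment_law G ?l ?r"
  note b = u_left_ge_0[OF I] u_right_le_1[OF I]
  have fin: "finite_measure ?L" by (rule finite_measure_segment_law) simp
  have mass: "mass ?L = ?r - ?l" by (rule mass_segment_law) (use u in auto)
  have q[measurable]: "quantile ?L \<in> borel_measurable borel" by (rule quantile_measurable[OF fin]) simp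
  have "put (quantile_part ?L (u - ?l)) x = (LINT t:{0<..<u - ?l}|lborel. max (x - quantile ?L t) 0)"
    by (subst quantile_part_eq_segment_law[OF fin]) (use u mass in \<open>auto simp: put_segment_law\<close>)
  also have "\<dots> = (LINT t:{0<..<u - ?l}|lborel. max (x - G (?l + t)) 0)"
  proof (rule set_lebesgue_integral_cong)
    show "\<forall>t. t \<in> {0<..<u - ?l} \<longrightarrow> max (x - quantile ?L t) 0 = max (x - G (?l + t)) 0"
      using quantile_segment_law[OF b] u by auto
  qed simp
  also have "\<dots> = J ?l u x"
    unfolding J_def set_lebesgue_integral_def
    using lborel_integral_real_affine[of 1 "\<lambda>t. indicator {?l<..<u} t *\<^sub>R max (x - G t) 0" ?l]
    by (simp add: indicator_def less_diff_eq add.commute)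
  finally have "put (quantile_part ?L (u - ?l)) x = J ?l u x" .
  then show ?thesis
    using put_target[OF I, of x] J_add[of ?l u ?r x] u b
    by (simp add: put_diff_upto_def put_diff_def J_eq_put nn.J_eq_put)
qed

end

section \<open>Second-order left-monotonicity\<close>

context curtain
begin

interpretation nn: curtain \<nu> \<nu> by (rule curtain_nu)

lemma in_component_facts:
  assumes "in_component \<mu> \<nu> u I"
  shows "I \<in> irred_components \<mu> \<nu>" "u_left \<mu> I < u" "u < u_right \<mu> I" "0 < u" "u < 1" "G u \<in> I"
proof -
  show I: "I \<in> irred_components \<mu> \<nu>" and u: "u_left \<mu> I < u" "u < u_right \<mu> I"
    using assms by (auto simp: in_component_def)
  show "0 < u" "u < 1" using u_left_ge_0[OF I] u_right_le_1[OF I] u by auto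
  show "G u \<in> I" by (rule G_in_component[OF I u])
qed

lemma at_gap_facts:
  assumes "at_gap \<mu> \<nu> u I"
  shows "I \<in> irred_components \<mu> \<nu>" "u = u_right \<mu> I" "0 < u" "u < 1" "G u \<in> I"
proof -
  show I: "I \<in> irred_components \<mu> \<nu>" and u: "u = u_right \<mu> I" "0 < u" "u < 1"
    using assms by (auto simp: at_gap_def)
  have "left_end I < ereal (G u)" using above_u_left[OF I, of u] u_left_less_u_right[OF I] u by simp
  moreover have "ereal (G u) < right_end I" using assms unfolding at_gap_def by blast
  ultimately show "G u \<in> I" using component_iff[OF I, of "G u"] by blast
qed

lemma glued_inside:
  assumes I: "in_component \<mu> \<nu> u I"
  shows "glued_R \<mu> \<nu> u = component_R \<mu> \<nu> I (u - u_left \<mu> I)"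
    and "glued_S \<mu> \<nu> u = component_S \<mu> \<nu> I (u - u_left \<mu> I)"
proof -
  have "(THE I. in_component \<mu> \<nu> u I) = I"
    using I in_component_facts(1,6) component_unique by (intro the_equality) blast+
  then show "glued_R \<mu> \<nu> u = component_R \<mu> \<nu> I (u - u_left \<mu> I)"
    "glued_S \<mu> \<nu> u = component_S \<mu> \<nu> I (u - u_left \<mu> I)"
    using I unfolding glued_R_def glued_S_def by (auto simp: Let_def)
qed

lemma glued_gap:
  assumes I: "at_gap \<mu> \<nu> u I"
  shows "glued_R \<mu> \<nu> u = left_end I" and "glued_S \<mu> \<nu> u = right_end I"
proof -
  have no: "\<not> in_component \<mu> \<nu> u I'" for I'
  proof
    assume I': "in_component \<mu> \<nu> u I'"
    have "I = I'"
      using component_unique[OF at_gap_facts(1)[OF I] in_component_facts(1)[OF I'] at_gap_facts(5)[OF I] in_component_facts(6)[OF I']] .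
    then show False using at_gap_facts(2)[OF I] in_component_facts(3)[OF I'] by simp
  qed
  have "(THE I. at_gap \<mu> \<nu> u I) = I"
    using I at_gap_facts(1,5) component_unique by (intro the_equality) blast+
  then show "glued_R \<mu> \<nu> u = left_end I" "glued_S \<mu> \<nu> u = right_end I"
    using I no unfolding glued_R_def glued_S_def by auto
qed

lemma glued_outside:
  assumes u: "0 < u" "u < 1" and no: "\<nexists>I. in_component \<mu> \<nu> u I" "\<nexists>I. at_gap \<mu> \<nu> u I"
  shows "glued_R \<mu> \<nu> u = ereal (G u)" and "glued_S \<mu> \<nu> u = ereal (G u)" and "D (G u) = 0"
proof -
  show "glued_R \<mu> \<nu> u = ereal (G u)" "glued_S \<mu> \<nu> u = ereal (G u)"
    using no by (auto simp: glued_R_def glued_S_def)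
  show "D (G u) = 0"
  proof (rule ccontr)
    assume "D (G u) \<noteq> 0"
    then have "0 < D (G u)" using D_nonneg[of "G u"] by simp
    then obtain I where I: "I \<in> irred_components \<mu> \<nu>" "G u \<in> I" using component_exists by blast
    have b: "u_left \<mu> I < u" "u \<le> u_right \<mu> I" using u_bounds_of_G[OF I(1) u I(2)] by auto
    have "ereal (G u) < right_end I" using component_iff[OF I(1)] I(2) by simp
    then have "in_component \<mu> \<nu> u I \<or> at_gap \<mu> \<nu> u I"
      using b I(1) u by (auto simp: in_component_def at_gap_def)
    then show False using no by blast
  qed
qed

text \<open>
  The tangent of the local problem serves for \<open>E u\<close>, since both points of contact lie in the closure of \<open>I\<close>.
  Indeed, to the left of \<open>I\<close> the local function vanishes, where an increasing line below it is negative; and at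
  the right end point the local function already meets its asymptote, hence its convex minorant. The last
  property, the minimality of the slope, recovers \<open>R\<close> from the convex minorant alone in \<open>lower_le_iff\<close>.
\<close>

lemma component_tangent:
  assumes in_I: "in_component \<mu> \<nu> u I"
  obtains r s \<phi> c where "glued_R \<mu> \<nu> u = ereal r" "glued_S \<mu> \<nu> u = ereal s" "0 < \<phi>" "r \<le> G u" "G u \<le> s"
    "\<And>x. c + \<phi> * x \<le> E u x" "D r = c + \<phi> * r" "E u s = c + \<phi> * s"
    "\<And>k. k \<le> G u \<Longrightarrow> D k = c + \<phi> * k \<Longrightarrow> r \<le> k" "\<And>y. G u \<le> y \<Longrightarrow> y < s \<Longrightarrow> c + \<phi> * y < E u y"
    "left_end I \<le> ereal r" "ereal s \<le> right_end I"
    "\<forall>w\<ge>0. (\<forall>x\<le>G u. (c + \<phi> * G u) + w * (x - G u) \<le> D x) \<longrightarrow> \<phi> \<le> w"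
proof -
  note I = in_component_facts(1)[OF in_I] and u = in_component_facts(2-5)[OF in_I] and GI = in_component_facts(6)[OF in_I]
  define a where "a = u_left \<mu> I"
  define b where "b = u_right \<mu> I"
  have ab: "0 \<le> a" "b \<le> 1" "a < u" "u < b" using u u_left_ge_0[OF I] u_right_le_1[OF I] by (auto simp: a_def b_def)
  have GI': "left_end I < ereal (G u)" "ereal (G u) < right_end I" using GI component_iff[OF I] by auto
  \<comment> \<open>The put difference \<open>d\<close> and the function \<open>f\<close> of the local problem, with asymptote \<open>\<sigma> * x - c0\<close>.\<close>
  define d where "d x = (if x \<in> I then D x else 0)" for x
  define f where "f x = d x + J u b x" for x
  define \<sigma> where "\<sigma> = b - u"
  define c0 where "c0 = (LINT t:{u<..<b}|lborel. G t)"
  let ?\<eta> = "segment_law G a b" and ?\<xi> = "segment_law H a b"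
  have q: "quantile ?\<eta> (u - a) = G u" using quantile_segment_law[of a b "u - a"] ab by simp
  have pd: "put_diff ?\<eta> ?\<xi> k = d k" for k
    using put_target[OF I, of k] by (simp add: put_diff_def J_eq_put nn.J_eq_put d_def a_def b_def)
  have pu: "put_diff_upto ?\<eta> ?\<xi> (u - a) = f"
    using put_diff_upto_component[OF I] u by (intro ext) (simp add: f_def d_def a_def b_def)
  have rm: "restrict_measure \<mu> I = ?\<eta>" and sh: "shadow \<nu> ?\<eta> = ?\<xi>"
    using restrict_measure_component[OF I] shadow_component[OF I] by (simp_all add: a_def b_def)
  define g where "g = convex_minorant f"
  define \<phi> where "\<phi> = Inf (subdifferential g (G u))"
  define L where "L x = g (G u) + \<phi> * (x - G u)" for x
  have R: "glued_R \<mu> \<nu> u = (if {k. k \<le> G u \<and> d k = L k} = {} then -\<infinity> else Inf (ereal ` {k. k \<le> G u \<and> d k = L k}))"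
    unfolding glued_inside[OF in_I] component_R_def rm sh a_def[symmetric] basic_R_def basic_phi_def pu q pd g_def[symmetric] \<phi>_def[symmetric] Let_def L_def ..
  have S: "glued_S \<mu> \<nu> u = Inf (ereal ` {y. G u \<le> y \<and> g y = f y})"
    unfolding glued_inside[OF in_I] component_S_def rm sh a_def[symmetric] basic_S_def pu q g_def[symmetric] ..
  have d0: "0 \<le> d x" and dD: "d x \<le> D x" for x using D_nonneg by (auto simp: d_def)
  have dcont: "continuous_on A d" for A
  proof -
    have "d = (\<lambda>x. nn.J a b x - J a b x)"
      using put_target[OF I] by (intro ext) (simp add: d_def a_def b_def)
    moreover have "continuous_on A (J a b)" "continuous_on A (nn.J a b)"
      using ab by (intro convex_on_continuous_at J_convex nn.J_convex; simp)+
    ultimately show ?thesis by (simp add: continuous_on_diff)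
  qed
  have Jcont: "continuous_on A (J u b)" for A
    using ab u by (intro convex_on_continuous_at J_convex) auto
  have fcont: "continuous_on A f" for A
    unfolding f_def[abs_def] by (intro continuous_intros dcont Jcont)
  have fd: "f x = d x" if "x \<le> G u" for x
    using J_eq_0[of u b x] that ab u by (simp add: f_def)
  have A_le_J: "\<sigma> * x - c0 \<le> J u b x" for x
    using J_ge_affine[of u b x] ab u by (simp add: \<sigma>_def c0_def)
  have fE: "f x \<le> E u x" for x
    using E_eq[of u x] J_add[of u b 1 x] J_nonneg[of b 1 x] dD[of x] ab u by (simp add: f_def)
  have right_of: "right_end I \<le> ereal x" if "G u \<le> x" "x \<notin> I" for x
    using component_iff[OF I, of x] that GI' less_le_trans[of "left_end I" "ereal (G u)" "ereal x"] by auto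
  obtain r s where
    rs: "Inf (ereal ` {y. G u \<le> y \<and> g y = f y}) = ereal s"
    "{k. k \<le> G u \<and> d k = L k} \<noteq> {}" "Inf (ereal ` {k. k \<le> G u \<and> d k = L k}) = ereal r"
    "0 < \<phi>" "r \<le> G u" "G u \<le> s" "\<And>x. L x \<le> f x" "d r = L r" "f s = L s"
    "\<And>k. k \<le> G u \<Longrightarrow> d k = L k \<Longrightarrow> r \<le> k" "\<And>y. G u \<le> y \<Longrightarrow> y < s \<Longrightarrow> L y < f y"
    "\<And>y. G u \<le> y \<Longrightarrow> y \<le> s \<Longrightarrow> g y = L y"
    "\<And>w. (\<And>x. g (G u) + w * (x - G u) \<le> f x) \<Longrightarrow> \<phi> \<le> w"
  proof (rule tangent_triple[of f d "G u" \<sigma> c0, folded g_def, folded \<phi>_def, folded L_def])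
    show "continuous_on UNIV f" "continuous_on UNIV d" by (rule fcont dcont)+
    show "0 \<le> f x" for x using d0 J_nonneg by (simp add: f_def)
    show "f x = d x" if "x \<le> G u" for x using fd that .
    show "(d \<longlongrightarrow> 0) at_bot"
      by (rule tendsto_sandwich[OF _ _ tendsto_const D_at_bot]) (use d0 dD in auto)
    show "0 < f x" if "G u \<le> x" for x
    proof (cases "x \<in> I")
      case True
      then show ?thesis using component_positive[OF I True] J_nonneg[of u b x] by (simp add: f_def d_def)
    next
      case False
      define v where "v = (u + b) / 2"
      have v: "u < v" "v < b" using ab by (auto simp: v_def)
      have "ereal (G v) < right_end I" using below_u_right[OF I, of v] v u by (simp add: b_def)
      then have "ereal (G v) < ereal x" using right_of[OF that False] by (rule less_le_trans)
      then have "0 < (v - u) * max (x - G v) 0" using v by simp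
      also have "\<dots> \<le> J u v x" using J_ge[of u v x] v u ab by simp
      also have "\<dots> \<le> J u b x" using J_add[of u v b x] J_nonneg[of v b x] v u ab by simp
      finally show ?thesis using d0[of x] by (simp add: f_def)
    qed
    show "0 < \<sigma>" using ab by (simp add: \<sigma>_def)
    show "\<sigma> * x - c0 \<le> f x" for x using A_le_J[of x] d0[of x] by (simp add: f_def)
    show "((\<lambda>x. f x - (\<sigma> * x - c0)) \<longlongrightarrow> 0) at_top"
    proof -
      have fm: "fin_moment (segment_law G u b)" using fin_moment_G ab u by simp
      have "((\<lambda>x. J u b x - (\<sigma> * x - c0)) \<longlongrightarrow> 0) at_top"
        using put_at_top[OF fm] integral_segment_law[OF G_measurable, of "\<lambda>x. x" u b] ab
        by (simp add: J_eq_put mass_segment_law \<sigma>_def c0_def mult.commute)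
      moreover have "(d \<longlongrightarrow> 0) at_top"
        by (rule tendsto_sandwich[OF _ _ tendsto_const D_at_top]) (use d0 dD in auto)
      ultimately have "((\<lambda>x. d x + (J u b x - (\<sigma> * x - c0))) \<longlongrightarrow> 0 + 0) at_top" by (intro tendsto_add)
      then show ?thesis by (simp add: f_def algebra_simps)
    qed
    show "x = G u" if "x \<le> G u" "0 \<le> \<sigma> * x - c0" for x
    proof -
      have "\<sigma> * G u - c0 \<le> 0" using A_le_J[of "G u"] J_eq_0[of u b "G u"] ab u by simp
      then have "\<sigma> * G u \<le> \<sigma> * x" using that by simp
      then show ?thesis using that ab by (simp add: \<sigma>_def)
    qed
  qed (rule that; (assumption | blast))
  define c where "c = g (G u) - \<phi> * G u"
  have Lc: "L x = c + \<phi> * x" for x by (simp add: L_def c_def algebra_simps)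
  have Lmono: "L x < L y" if "x < y" for x y using that rs(4) by (simp add: Lc)
  have d_end: "d x = D x" if "left_end I \<le> ereal x" "ereal x \<le> right_end I" for x
  proof (cases "x \<in> I")
    case False
    then have "left_end I = ereal x \<or> right_end I = ereal x"
      using component_iff[OF I, of x] that by auto
    then have "D x = 0" using D_left_end[OF I] D_right_end[OF I] by auto
    then show ?thesis using False by (simp add: d_def)
  qed (simp add: d_def)
  have left_r: "left_end I \<le> ereal r"
  proof (rule ccontr)
    assume "\<not> left_end I \<le> ereal r"
    then have lt: "ereal r < left_end I" by simp
    then obtain l where l: "left_end I = ereal l" using GI' by (cases "left_end I") auto
    then have "r < l" "l \<notin> I" "r \<notin> I" using lt component_iff[OF I] by auto
    have "L l \<le> d l" using rs(7)[of l] fd[of l] GI' l by simp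
    then have "L l \<le> 0" using \<open>l \<notin> I\<close> by (simp add: d_def)
    moreover have "L r = 0" using rs(8) \<open>r \<notin> I\<close> by (simp add: d_def)
    ultimately show False using Lmono[OF \<open>r < l\<close>] by simp
  qed
  have right_s: "ereal s \<le> right_end I"
  proof (rule ccontr)
    assume "\<not> ereal s \<le> right_end I"
    then have lt: "right_end I < ereal s" by simp
    then obtain z where z: "right_end I = ereal z" using GI' by (cases "right_end I") auto
    have zs: "z < s" "G u \<le> z" using lt GI' z by auto
    have zI: "z \<notin> I" using component_iff[OF I, of z] z by simp
    have "J u b z = \<sigma> * z - c0"
      unfolding \<sigma>_def c0_def
    proof (rule J_eq_affineI)
      show "G t \<le> z" if "u < t" "t < b" for t
        using below_u_right[OF I, of t] that u z by (simp add: b_def)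
    qed (use ab u in auto)
    then have fz: "f z = \<sigma> * z - c0" using zI by (simp add: f_def d_def)
    have "- c0 + \<sigma> * z \<le> g z"
      unfolding g_def
    proof (rule line_le_convex_minorant)
      show "0 + 0 * x \<le> f x" for x using d0[of x] J_nonneg[of u b x] by (simp add: f_def)
      show "- c0 + \<sigma> * x \<le> f x" for x using A_le_J[of x] d0[of x] by (simp add: f_def)
    qed
    also have "g z = L z" using rs(12)[of z] zs by simp
    also have "\<dots> < f z" using rs(11)[of z] zs by simp
    finally show False using fz by simp
  qed
  have r_right: "ereal r \<le> right_end I" using rs(5) GI' by (meson ereal_less_eq(3) le_less_trans less_imp_le)
  have left_s: "left_end I \<le> ereal s" using rs(6) GI' by (meson ereal_less_eq(3) less_le_trans less_imp_le)
  have f_eq_E: "f s = E u s"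
  proof -
    have "J b 1 s = 0"
    proof (rule J_eq_0I)
      show "s \<le> G t" if "b < t" "t < 1" for t
        using above_u_right[OF I, of t] that right_s order_trans[of "ereal s" "right_end I" "ereal (G t)"] by (simp add: b_def)
    qed
    then show ?thesis
      using E_eq[of u s] J_add[of u b 1 s] d_end[OF left_s right_s] ab u by (simp add: f_def)
  qed
  show ?thesis
  proof (rule that[of r s \<phi> c])
    show "glued_R \<mu> \<nu> u = ereal r" unfolding R rs(3) using rs(2) by simp
    show "glued_S \<mu> \<nu> u = ereal s" unfolding S rs(1) ..
    show "c + \<phi> * x \<le> E u x" for x using rs(7)[of x] fE[of x] by (simp add: Lc)
    show "D r = c + \<phi> * r" using rs(8) d_end[OF left_r r_right] by (simp add: Lc)
    show "E u s = c + \<phi> * s" using rs(9) f_eq_E by (simp add: Lc)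
    show "c + \<phi> * y < E u y" if "G u \<le> y" "y < s" for y
      using rs(11)[OF that] fE[of y] by (simp add: Lc)
    show "\<forall>w\<ge>0. (\<forall>x\<le>G u. (c + \<phi> * G u) + w * (x - G u) \<le> D x) \<longrightarrow> \<phi> \<le> w"
    proof (intro allI impI, rule ccontr)
      fix w assume w0: "0 \<le> w" and wx: "\<forall>x\<le>G u. (c + \<phi> * G u) + w * (x - G u) \<le> D x"
      note w = w0 wx[rule_format]
      assume neg: "\<not> \<phi> \<le> w"
      have gz: "g (G u) = c + \<phi> * G u" by (simp add: c_def)
      have "g (G u) + w * (x - G u) \<le> f x" for x
      proof (cases "G u \<le> x")
        case True
        then have "w * (x - G u) \<le> \<phi> * (x - G u)" using neg by (intro mult_right_mono) auto
        then show ?thesis using rs(7)[of x] by (simp add: L_def)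
      next
        case x: False
        show ?thesis
        proof (cases "x \<in> I")
          case True
          then show ?thesis using w(2)[of x] fd[of x] x gz by (simp add: d_def)
        next
          case False
          have "ereal x < right_end I" using x GI' less_trans[of "ereal x" "ereal (G u)" "right_end I"] by simp
          then have "ereal x \<le> left_end I" using component_iff[OF I, of x] False by auto
          then obtain l where l: "left_end I = ereal l" using GI' by (cases "left_end I") auto
          then have xl: "x \<le> l" "l \<le> G u" using \<open>ereal x \<le> left_end I\<close> GI' by auto
          have "w * (x - G u) \<le> w * (l - G u)" using xl w(1) by (intro mult_left_mono) auto
          moreover have "g (G u) + w * (l - G u) \<le> 0" using w(2)[OF xl(2)] D_left_end[OF I l] gz by simp
          ultimately show ?thesis using d0[of x] J_nonneg[of u b x] by (simp add: f_def)
        qed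
      qed
      then have "\<phi> \<le> w" by (rule rs(13))
      then show False using neg by simp
    qed
    show "r \<le> k" if k: "k \<le> G u" "D k = c + \<phi> * k" for k
    proof (cases "left_end I \<le> ereal k")
      case True
      have "ereal k \<le> right_end I" using k(1) GI' by (meson ereal_less_eq(3) le_less_trans less_imp_le)
      then show ?thesis using rs(10)[OF k(1)] d_end[OF True] k(2) by (simp add: Lc)
    next
      case False
      then obtain l where l: "left_end I = ereal l" using GI' by (cases "left_end I") auto
      then have "k < l" "l \<notin> I" using False component_iff[OF I] by auto
      have "L l \<le> 0" using rs(7)[of l] fd[of l] GI' l \<open>l \<notin> I\<close> by (simp add: d_def)
      then have "L k < 0" using Lmono[OF \<open>k < l\<close>] by simp
      then show ?thesis using k D_nonneg[of k] by (simp add: Lc)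
    qed
  qed (use rs left_r right_s in auto)
qed

text \<open>
  The right end point is finite, for otherwise \<open>u_right\<close> would be 1, which is not a level.
\<close>

lemma gap_facts:
  assumes gap: "at_gap \<mu> \<nu> u I"
  obtains s where "right_end I = ereal s" "E u s = 0" "G u < s" "D s = 0"
proof -
  note I = at_gap_facts(1)[OF gap] and u = at_gap_facts(2-4)[OF gap] and GI = at_gap_facts(5)[OF gap]
  have GI': "left_end I < ereal (G u)" "ereal (G u) < right_end I" using GI component_iff[OF I] by auto
  show ?thesis
  proof (cases "right_end I")
    case (real s)
    have "J u 1 s = 0"
      by (rule J_eq_0I) (use above_u_right[OF I] u real in auto)
    then have "E u s = 0" using E_eq[of u s] D_right_end[OF I real] u by simp
    then show ?thesis using that[OF real] GI' real D_right_end[OF I real] by simp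
  next
    case PInf
    then show ?thesis using above_u_right[OF I, of "(u + 1) / 2"] u by simp
  qed (use GI' in auto)
qed

text \<open>
  This is the equality of \<open>E u\<close> with its convex minorant at \<open>y\<close>, expressed by affine minorants.
\<close>

definition contact :: "real \<Rightarrow> real \<Rightarrow> bool" where
  "contact u y \<longleftrightarrow> (\<exists>c \<phi>. (\<forall>x. c + \<phi> * x \<le> E u x) \<and> E u y = c + \<phi> * y)"

text \<open>
  The three cases in the definition of \<open>glued_S\<close> have this common description, which no longer refers to
  components. At a gap \<open>E u\<close> is positive on the component and vanishes at its right end point, and outside
  the components it vanishes at \<open>G u\<close>.
\<close>

lemma glued_S_contact:
  assumes u: "0 < u" "u < 1"
  obtains s where "glued_S \<mu> \<nu> u = ereal s" "G u \<le> s" "contact u s" "\<And>y. G u \<le> y \<Longrightarrow> y < s \<Longrightarrow> \<not> contact u y"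
proof -
  consider (inside) I where "in_component \<mu> \<nu> u I" | (gap) I where "at_gap \<mu> \<nu> u I"
    | (outside) "\<nexists>I. in_component \<mu> \<nu> u I" "\<nexists>I. at_gap \<mu> \<nu> u I" by blast
  then show ?thesis
  proof cases
    case inside
    obtain r s c \<phi> where t: "glued_R \<mu> \<nu> u = ereal r" "glued_S \<mu> \<nu> u = ereal s" "0 < \<phi>" "r \<le> G u" "G u \<le> s"
      "\<And>x. c + \<phi> * x \<le> E u x" "D r = c + \<phi> * r" "E u s = c + \<phi> * s"
      "\<And>k. k \<le> G u \<Longrightarrow> D k = c + \<phi> * k \<Longrightarrow> r \<le> k" "\<And>y. G u \<le> y \<Longrightarrow> y < s \<Longrightarrow> c + \<phi> * y < E u y"
      "left_end I \<le> ereal r" "ereal s \<le> right_end I"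
      by (rule component_tangent[OF inside]) (rule that; (assumption | blast))
    show ?thesis
    proof (rule that[OF t(2,5)])
      show "contact u s" using t(6,8) unfolding contact_def by blast
      fix y assume y: "G u \<le> y" "y < s"
      show "\<not> contact u y"
      proof
        assume "contact u y"
        then obtain c' \<phi>' where l: "\<And>x. c' + \<phi>' * x \<le> E u x" "E u y = c' + \<phi>' * y" unfolding contact_def by blast
        have "c' + \<phi>' * y \<le> c + \<phi> * y"
        proof (rule convex_le_line[OF convex_affine])
          show "r \<le> y" "y \<le> s" using t y by auto
          show "c' + \<phi>' * r \<le> c + \<phi> * r" using l(1)[of r] E_eq_D[OF u t(4)] t(7) by simp
          show "c' + \<phi>' * s \<le> c + \<phi> * s" using l(1)[of s] t(8) by simp
        qed
        then show False using t(10)[OF y] l(2) by simp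
      qed
    qed
  next
    case gap
    note I = at_gap_facts(1)[OF gap] and GI = at_gap_facts(5)[OF gap]
    obtain s where s: "right_end I = ereal s" "E u s = 0" "G u < s" using gap_facts[OF gap] .
    show ?thesis
    proof (rule that[of s])
      show "glued_S \<mu> \<nu> u = ereal s" using glued_gap(2)[OF gap] s by simp
      show "contact u s" unfolding contact_def
        using s E_nonneg u by (intro exI[of _ 0]) auto
      fix y assume y: "G u \<le> y" "y < s"
      have "left_end I < ereal y" using GI component_iff[OF I, of "G u"] y less_le_trans[of "left_end I" "ereal (G u)" "ereal y"] by simp
      then have "y \<in> I" using component_iff[OF I, of y] y s by simp
      then have Dy: "0 < D y" by (rule component_positive[OF I])
      obtain a where a: "a \<in> I" "a \<le> G u" "D a < D y" using component_near_left[OF I GI Dy] by blast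
      show "\<not> contact u y"
      proof
        assume "contact u y"
        then obtain c' \<phi>' where l: "\<And>x. c' + \<phi>' * x \<le> E u x" "E u y = c' + \<phi>' * y" unfolding contact_def by blast
        have "c' + \<phi>' * y \<le> max (D a) 0 + 0 * y"
        proof (rule convex_le_line[OF convex_affine])
          show "a \<le> y" "y \<le> s" using a y by auto
          show "c' + \<phi>' * a \<le> max (D a) 0 + 0 * a" using l(1)[of a] E_eq_D[OF u a(2)] by simp
          show "c' + \<phi>' * s \<le> max (D a) 0 + 0 * s" using l(1)[of s] s by simp
        qed
        then have "E u y < D y" using l(2) a Dy by simp
        then show False using D_le_E[of u y] u by simp
      qed
    qed (use s in auto)
  next
    case outside
    note o = glued_outside[OF u outside]
    show ?thesis
    proof (rule that[of "G u"])
      show "contact u (G u)" unfolding contact_def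
        using o E_nonneg E_eq_D[OF u order_refl] u by (intro exI[of _ 0]) auto
    qed (use o in auto)
  qed
qed

text \<open>
  \<open>E u - E v\<close> is nowhere below an affine function that it equals to the right of \<open>G v\<close>. Adding this affine
  function to a line that touches \<open>E v\<close> at \<open>z\<close> gives a line that touches \<open>E u\<close> at \<open>z\<close>.
\<close>

lemma contact_transfer:
  assumes uv: "0 < u" "u < v" "v < 1" and z: "G v \<le> z" "contact v z"
  shows "contact u z"
proof -
  obtain c \<phi> where l: "\<And>x. c + \<phi> * x \<le> E v x" "E v z = c + \<phi> * z" using z(2) unfolding contact_def by blast
  define C where "C = (LINT t:{u<..<v}|lborel. G t)"
  have E: "E u x = E v x + J u v x" for x using E_diff[of u v x] uv by simp
  have "(c - C) + (\<phi> + (v - u)) * x \<le> E u x" for x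
    using l(1)[of x] J_ge_affine[of u v x] E[of x] uv by (simp add: C_def algebra_simps)
  moreover have "E u z = (c - C) + (\<phi> + (v - u)) * z"
    using l(2) J_eq_affine[of u v z] E[of z] uv z by (simp add: C_def algebra_simps)
  ultimately show ?thesis unfolding contact_def by blast
qed

lemma glued_S_mono:
  assumes uv: "0 < u" "u < v" "v < 1"
  shows "glued_S \<mu> \<nu> u \<le> glued_S \<mu> \<nu> v"
proof -
  obtain s where s: "glued_S \<mu> \<nu> u = ereal s" "\<And>y. G u \<le> y \<Longrightarrow> y < s \<Longrightarrow> \<not> contact u y"
    using glued_S_contact[of u] uv by (metis order.strict_trans)
  obtain s' where s': "glued_S \<mu> \<nu> v = ereal s'" "G v \<le> s'" "contact v s'"
    using glued_S_contact[of v] uv by (metis order.strict_trans)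
  have "G u \<le> s'" using G_mono[of u v] uv s' by simp
  then have "s \<le> s'" using s(2)[of s'] contact_transfer[OF uv s'(2,3)] by force
  then show ?thesis using s s' by simp
qed

lemma glued_le:
  assumes u: "0 < u" "u < 1"
  shows "glued_R \<mu> \<nu> u \<le> ereal (G u)" "ereal (G u) \<le> glued_S \<mu> \<nu> u"
proof -
  consider (inside) I where "in_component \<mu> \<nu> u I" | (gap) I where "at_gap \<mu> \<nu> u I"
    | (outside) "\<nexists>I. in_component \<mu> \<nu> u I" "\<nexists>I. at_gap \<mu> \<nu> u I" by blast
  then show "glued_R \<mu> \<nu> u \<le> ereal (G u)"
  proof cases
    case inside
    obtain r where "glued_R \<mu> \<nu> u = ereal r" "r \<le> G u"
      by (rule component_tangent[OF inside]) (rule that; (assumption | blast))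
    then show ?thesis by simp
  next
    case gap
    then show ?thesis using glued_gap(1)[OF gap] component_iff[OF at_gap_facts(1)[OF gap]] at_gap_facts(5)[OF gap] by auto
  next
    case outside
    then show ?thesis using glued_outside[OF u outside] by simp
  qed
  obtain s where "glued_S \<mu> \<nu> u = ereal s" "G u \<le> s" by (rule glued_S_contact[OF u])
  then show "ereal (G u) \<le> glued_S \<mu> \<nu> u" by simp
qed

text \<open>
  If \<open>R v\<close> lay strictly between \<open>R u\<close> and \<open>S u\<close>, then \<open>u\<close> and \<open>v\<close> would belong to the same component. The line of
  \<open>v\<close> minus the line of \<open>u\<close> is at most \<open>- J u v\<close> at \<open>R u\<close> and at \<open>S u\<close>, and at least \<open>- J u v\<close> at \<open>R v\<close>. As
  \<open>J u v\<close> is convex, there is equality at \<open>R u\<close>. So the line of \<open>v\<close> touches \<open>D\<close> already at \<open>R u\<close>,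
  against the minimality of \<open>R v\<close>.
\<close>

lemma glued_R_not_between:
  assumes uv: "0 < u" "u < v" "v < 1"
  shows "glued_R \<mu> \<nu> v \<notin> {glued_R \<mu> \<nu> u <..< glued_S \<mu> \<nu> u}"
proof
  assume between: "glued_R \<mu> \<nu> v \<in> {glued_R \<mu> \<nu> u <..< glued_S \<mu> \<nu> u}"
  have u: "0 < u" "u < 1" and v: "0 < v" "v < 1" using uv by auto
  have between_comp: "\<exists>I. (in_component \<mu> \<nu> u I \<or> at_gap \<mu> \<nu> u I) \<and> left_end I < glued_R \<mu> \<nu> v \<and> glued_R \<mu> \<nu> v < right_end I"
  proof -
    consider (inside) I where "in_component \<mu> \<nu> u I" | (gap) I where "at_gap \<mu> \<nu> u I"
      | (outside) "\<nexists>I. in_component \<mu> \<nu> u I" "\<nexists>I. at_gap \<mu> \<nu> u I" by blast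
    then show ?thesis
    proof cases
      case inside
      obtain r s where "glued_R \<mu> \<nu> u = ereal r" "glued_S \<mu> \<nu> u = ereal s" "left_end I \<le> ereal r" "ereal s \<le> right_end I"
      by (rule component_tangent[OF inside]) (rule that; (assumption | blast))
      then have "left_end I < glued_R \<mu> \<nu> v" "glued_R \<mu> \<nu> v < right_end I"
        using between by (auto intro: le_less_trans less_le_trans)
      then show ?thesis using inside by blast
    next
      case gap
      then show ?thesis using glued_gap[OF gap] between by auto
    next
      case outside
      then show ?thesis using glued_outside[OF u outside] between by auto
    qed
  qed
  then obtain I where I: "in_component \<mu> \<nu> u I \<or> at_gap \<mu> \<nu> u I"
    and vI: "left_end I < glued_R \<mu> \<nu> v" "glued_R \<mu> \<nu> v < right_end I" by blast
  have irr: "I \<in> irred_components \<mu> \<nu>" using I in_component_facts(1) at_gap_facts(1) by blast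
  obtain \<rho> where \<rho>: "glued_R \<mu> \<nu> v = ereal \<rho>" using vI by (cases "glued_R \<mu> \<nu> v") auto
  then have \<rho>I: "\<rho> \<in> I" using component_iff[OF irr] vI by simp
  then have D\<rho>: "0 < D \<rho>" by (rule component_positive[OF irr])
  consider (inside) I' where "in_component \<mu> \<nu> v I'" | (gap) I' where "at_gap \<mu> \<nu> v I'"
      | (outside) "\<nexists>I. in_component \<mu> \<nu> v I" "\<nexists>I. at_gap \<mu> \<nu> v I" by blast
  then show False
  proof cases
    case gap
    then show False using D_left_end[OF at_gap_facts(1)[OF gap], of \<rho>] glued_gap(1)[OF gap] \<rho> D\<rho> by simp
  next
    case outside
    then show False using glued_outside[OF v outside] \<rho> D\<rho> by simp
  next
    case inside
    note I' = in_component_facts[OF inside]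
    obtain r' s' c' \<phi>' where t': "glued_R \<mu> \<nu> v = ereal r'" "glued_S \<mu> \<nu> v = ereal s'" "0 < \<phi>'" "r' \<le> G v" "G v \<le> s'"
      "\<And>x. c' + \<phi>' * x \<le> E v x" "D r' = c' + \<phi>' * r'" "E v s' = c' + \<phi>' * s'"
      "\<And>k. k \<le> G v \<Longrightarrow> D k = c' + \<phi>' * k \<Longrightarrow> r' \<le> k" "\<And>y. G v \<le> y \<Longrightarrow> y < s' \<Longrightarrow> c' + \<phi>' * y < E v y"
      "left_end I' \<le> ereal r'" "ereal s' \<le> right_end I'"
      by (rule component_tangent[OF inside]) (rule that; (assumption | blast))
    have r': "r' = \<rho>" using t'(1) \<rho> by simp
    have "\<rho> \<in> I'"
    proof (rule ccontr)
      assume "\<rho> \<notin> I'"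
      moreover have "ereal \<rho> < right_end I'"
        using t'(4) r' component_iff[OF I'(1), of "G v"] I'(6) le_less_trans[of "ereal \<rho>" "ereal (G v)" "right_end I'"] by simp
      ultimately have "left_end I' = ereal \<rho>" using component_iff[OF I'(1), of \<rho>] t'(11) r' by auto
      then show False using D_left_end[OF I'(1)] D\<rho> by simp
    qed
    then have II': "I = I'" using component_unique[OF irr I'(1) \<rho>I] by simp
    have "\<not> at_gap \<mu> \<nu> u I" using at_gap_facts(2)[of u I] I'(3) uv II' by auto
    then have in_u: "in_component \<mu> \<nu> u I" using I by blast
    obtain r s c \<phi> where t: "glued_R \<mu> \<nu> u = ereal r" "glued_S \<mu> \<nu> u = ereal s" "r \<le> G u" "G u \<le> s"
      "\<And>x. c + \<phi> * x \<le> E u x" "D r = c + \<phi> * r" "E u s = c + \<phi> * s"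
      by (rule component_tangent[OF in_u]) (rule that; (assumption | blast))
    have rho: "r < \<rho>" "\<rho> < s" using between t \<rho> by auto
    have GG: "G u \<le> G v" using G_mono uv by simp
    have E: "E u x = E v x + J u v x" for x using E_diff[of u v x] uv by simp
    have at_r: "c' + \<phi>' * r \<le> c + \<phi> * r"
      using t'(6)[of r] E_eq_D[OF v, of r] t(3,6) GG by simp
    have at_s: "c' + \<phi>' * s \<le> c + \<phi> * s - J u v s" using t'(6)[of s] E[of s] t(7) by simp
    have at_rho: "c + \<phi> * \<rho> - J u v \<rho> \<le> c' + \<phi>' * \<rho>"
      using t(5)[of \<rho>] E[of \<rho>] E_eq_D[OF v, of \<rho>] t'(4,7) r' by simp
    have Jr: "J u v r = 0" using J_eq_0[of u v r] uv t(3) by simp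
    define w where "w = (\<rho> - r) / (s - r)"
    have w: "0 < w" "w < 1" using rho by (auto simp: w_def)
    have rho_eq: "\<rho> = (1 - w) * r + w * s"
    proof -
      have "w * (s - r) = \<rho> - r" using rho by (simp add: w_def)
      then show ?thesis by (simp add: algebra_simps)
    qed
    have "J u v \<rho> \<le> (1 - w) * J u v r + w * J u v s"
      using convex_onD[OF J_convex[of u v], of w r s] uv w rho_eq by simp
    then have "c + \<phi> * \<rho> - w * J u v s \<le> c' + \<phi>' * \<rho>" using at_rho Jr by simp
    also have "c' + \<phi>' * \<rho> = (1 - w) * (c' + \<phi>' * r) + w * (c' + \<phi>' * s)" unfolding rho_eq by algebra
    also have "\<dots> \<le> (1 - w) * (c' + \<phi>' * r) + w * (c + \<phi> * s - J u v s)"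
      using at_s w by (intro add_left_mono mult_left_mono) auto
    finally have "(1 - w) * (c + \<phi> * r) \<le> (1 - w) * (c' + \<phi>' * r)"
      unfolding rho_eq by (simp add: algebra_simps)
    then have "c + \<phi> * r \<le> c' + \<phi>' * r" using w by simp
    then have "D r = c' + \<phi>' * r" using at_r t(6) by simp
    then have "\<rho> \<le> r" using t'(9)[of r] r' t(3) GG by simp
    then show False using rho by simp
  qed
qed

lemma glued_left_monotone:
  "second_order_left_monotone (glued_R \<mu> \<nu>) (glued_S \<mu> \<nu>) G {0<..<1}"
  unfolding second_order_left_monotone_def
  using glued_le glued_S_mono glued_R_not_between by auto

end

section \<open>The minorant as a function of the level\<close>

text \<open>
  The expectation of \<open>(k - Y)\<^sup>+\<close> for \<open>Y\<close> with values in \<open>{r, s}\<close> and mean \<open>g\<close>.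
\<close>

definition chord_put :: "real \<Rightarrow> real \<Rightarrow> real \<Rightarrow> real \<Rightarrow> real" where
  "chord_put k r g s =
     (if r < s then (s - g) / (s - r) * max (k - r) 0 + (g - r) / (s - r) * max (k - s) 0 else max (k - g) 0)"

lemma chord_put_left: "r \<le> g \<Longrightarrow> g \<le> s \<Longrightarrow> k \<le> r \<Longrightarrow> chord_put k r g s = 0"
  by (simp add: chord_put_def)

lemma chord_put_mid: "r < k \<Longrightarrow> k < s \<Longrightarrow> chord_put k r g s = (s - g) / (s - r) * (k - r)"
  by (simp add: chord_put_def)

lemma chord_put_right:
  assumes "r \<le> g" "g \<le> s" "s \<le> k"
  shows "chord_put k r g s = k - g"
proof (cases "r < s")
  case True
  have "(s - g) * (k - r) + (g - r) * (k - s) = (k - g) * (s - r)" by algebra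
  then have "((s - g) * (k - r) + (g - r) * (k - s)) / (s - r) = k - g" using True by simp
  moreover have "chord_put k r g s = (s - g) / (s - r) * (k - r) + (g - r) / (s - r) * (k - s)"
    using True assms by (simp add: chord_put_def)
  ultimately show ?thesis by (simp add: add_divide_distrib)
qed (use assms in \<open>simp add: chord_put_def\<close>)

lemma chord_put_bounds:
  assumes "r \<le> g" "g \<le> s"
  shows "max (k - g) 0 \<le> chord_put k r g s" and "chord_put k r g s \<le> max (k - g) 0 + (s - g)"
proof -
  consider "k \<le> r" | "r < k" "k < s" | "s \<le> k" by linarith
  then have "max (k - g) 0 \<le> chord_put k r g s \<and> chord_put k r g s \<le> max (k - g) 0 + (s - g)"
  proof cases
    case 1
    then show ?thesis using chord_put_left[OF assms 1] assms by simp
  next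
    case 2
    have "(s - g) * (k - r) - (k - g) * (s - r) = (g - r) * (s - k)" by algebra
    moreover have "0 \<le> (g - r) * (s - k)" using assms 2 by simp
    ultimately have "(k - g) * (s - r) \<le> (s - g) * (k - r)" by linarith
    then have "k - g \<le> (s - g) * (k - r) / (s - r)" using 2 by (simp add: pos_le_divide_eq)
    moreover have "0 \<le> (s - g) * (k - r) / (s - r)" using assms 2 by simp
    moreover have "(s - g) * ((k - r) / (s - r)) \<le> (s - g) * 1" using assms 2 by (intro mult_left_mono) auto
    ultimately show ?thesis using chord_put_mid[OF 2] by simp
  next
    case 3
    then show ?thesis using chord_put_right[OF assms 3] assms by simp
  qed
  then show "max (k - g) 0 \<le> chord_put k r g s" "chord_put k r g s \<le> max (k - g) 0 + (s - g)" by auto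
qed

context curtain
begin

definition lower :: "real \<Rightarrow> real" where "lower u = real_of_ereal (glued_R \<mu> \<nu> u)"
definition upper :: "real \<Rightarrow> real" where "upper u = real_of_ereal (glued_S \<mu> \<nu> u)"

lemma upper_facts:
  assumes u: "0 < u" "u < 1"
  shows glued_S_upper: "glued_S \<mu> \<nu> u = ereal (upper u)" and G_le_upper: "G u \<le> upper u"
    and contact_upper: "contact u (upper u)"
proof -
  obtain s where s: "glued_S \<mu> \<nu> u = ereal s" "G u \<le> s" "contact u s"
    using glued_S_contact[OF u] by metis
  then have "upper u = s" by (simp add: upper_def)
  then show "glued_S \<mu> \<nu> u = ereal (upper u)" "G u \<le> upper u" "contact u (upper u)" using s by auto
qed

lemma upper_mono: "0 < u \<Longrightarrow> u \<le> v \<Longrightarrow> v < 1 \<Longrightarrow> upper u \<le> upper v"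
  using glued_S_mono[of u v] glued_S_upper[of u] glued_S_upper[of v] by (cases "u = v") auto

text \<open>
  In a component the line is the tangent. In the other two cases it is the zero function.
\<close>

lemma lower_chord:
  assumes u: "0 < u" "u < 1" and fin: "glued_R \<mu> \<nu> u \<noteq> -\<infinity>"
  shows glued_R_lower: "glued_R \<mu> \<nu> u = ereal (lower u)" and lower_le_G: "lower u \<le> G u"
    and chord_ex: "\<exists>c \<phi>. (\<forall>x. c + \<phi> * x \<le> E u x) \<and> D (lower u) = c + \<phi> * lower u \<and> E u (upper u) = c + \<phi> * upper u"
proof -
  have "glued_R \<mu> \<nu> u \<noteq> \<infinity>" using glued_le(1)[OF u] by auto
  then show R: "glued_R \<mu> \<nu> u = ereal (lower u)" using fin by (cases "glued_R \<mu> \<nu> u") (auto simp: lower_def)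
  then show le: "lower u \<le> G u" using glued_le(1)[OF u] by simp
  note S = glued_S_upper[OF u]
  consider (inside) I where "in_component \<mu> \<nu> u I" | (gap) I where "at_gap \<mu> \<nu> u I"
    | (outside) "\<nexists>I. in_component \<mu> \<nu> u I" "\<nexists>I. at_gap \<mu> \<nu> u I" by blast
  then show "\<exists>c \<phi>. (\<forall>x. c + \<phi> * x \<le> E u x) \<and> D (lower u) = c + \<phi> * lower u \<and> E u (upper u) = c + \<phi> * upper u"
  proof cases
    case inside
    obtain r s \<phi> c where t: "glued_R \<mu> \<nu> u = ereal r" "glued_S \<mu> \<nu> u = ereal s"
      "\<And>x. c + \<phi> * x \<le> E u x" "D r = c + \<phi> * r" "E u s = c + \<phi> * s"
      by (rule component_tangent[OF inside]) (rule that; (assumption | blast))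
    then have "r = lower u" "s = upper u" using R S by auto
    then show ?thesis using t by blast
  next
    case gap
    obtain s where s: "right_end I = ereal s" "E u s = 0" using gap_facts[OF gap] by metis
    have "upper u = s" using glued_gap(2)[OF gap] s S by simp
    moreover have "D (lower u) = 0" using D_left_end[OF at_gap_facts(1)[OF gap]] glued_gap(1)[OF gap] R by simp
    ultimately show ?thesis using s E_nonneg[of u] u by (intro exI[of _ 0]) auto
  next
    case outside
    note o = glued_outside[OF u outside]
    have "upper u = G u" "lower u = G u" using o R S by auto
    then show ?thesis using o E_nonneg[of u] E_eq_D[OF u order_refl] u by (intro exI[of _ 0]) auto
  qed
qed

text \<open>
  A supporting line of the convex piece of \<open>E u\<close> to the right of \<open>G u\<close> lies below \<open>E u\<close> everywhere: to exceed
  \<open>E u\<close> on the left, it would have to be steeper downwards than the line touching at \<open>z\<close> and then fall below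
  it at \<open>k\<close>.
\<close>

lemma minorant_eq_E_right:
  assumes u: "0 < u" "u < 1" and z: "contact u z" "G u \<le> z" "z \<le> k"
  shows "minorant u k = E u k"
proof -
  have u': "0 \<le> u" "u \<le> 1" using u by auto
  obtain c \<phi> where l: "\<And>x. c + \<phi> * x \<le> E u x" "E u z = c + \<phi> * z" using z(1) unfolding contact_def by blast
  have "E u k \<le> minorant u k"
  proof (cases "k = z")
    case True
    then show ?thesis using minorant_line[OF u' l(1), of k] l(2) by simp
  next
    case False
    then have zk: "z < k" using z by simp
    obtain s where s: "\<And>y. G u \<le> y \<Longrightarrow> E u k + s * (y - k) \<le> E u y"
      using E_supporting_line[OF u, of k] z by force
    have "(E u k - s * k) + s * y \<le> E u y" for y
    proof (rule ccontr)
      assume neg: "\<not> (E u k - s * k) + s * y \<le> E u y"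
      have "y < G u"
      proof (rule ccontr)
        assume "\<not> y < G u"
        then show False using s[of y] neg by (simp add: algebra_simps)
      qed
      then have yz: "y < z" using z by simp
      have 1: "c + \<phi> * y < (E u k - s * k) + s * y" using neg l(1)[of y] by simp
      have 2: "(E u k - s * k) + s * z \<le> c + \<phi> * z" using s[of z] z l(2) by (simp add: algebra_simps)
      have "0 < (\<phi> - s) * (z - y)" using 1 2 by (simp add: algebra_simps)
      then have "0 < \<phi> - s" using yz by (simp add: zero_less_mult_iff)
      then have "0 < (\<phi> - s) * (k - z)" using zk by simp
      then have "E u k < c + \<phi> * k" using 2 by (simp add: algebra_simps)
      then show False using l(1)[of k] by simp
    qed
    from minorant_line[OF u' this, of k] show ?thesis by simp
  qed
  then show ?thesis using minorant_le[OF u', of k] by simp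
qed

lemma minorant_eq_line:
  assumes u: "0 \<le> u" "u \<le> 1" and l: "\<And>x. c + \<phi> * x \<le> E u x"
    and r: "E u r \<le> c + \<phi> * r" and s: "E u s \<le> c + \<phi> * s" and k: "r \<le> k" "k \<le> s"
  shows "minorant u k = c + \<phi> * k"
proof (rule antisym)
  show "minorant u k \<le> c + \<phi> * k"
    by (rule convex_le_line[OF minorant_convex[OF u] k])
      (use minorant_le[OF u, of r] minorant_le[OF u, of s] r s in auto)
  show "c + \<phi> * k \<le> minorant u k" by (rule minorant_line[OF u l])
qed

abbreviation "payoff k u \<equiv> chord_put k (lower u) (G u) (upper u)"

text \<open>
  An envelope argument. From level \<open>u\<close> to level \<open>v\<close> the value of \<open>E\<close> at \<open>x\<close> drops by \<open>J u v x\<close>, which is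
  \<open>(v - u) * max (x - G u) 0\<close> up to an error of at most \<open>(v - u) * (G v - G u)\<close>. At the contact points
  \<open>lower u\<close> and \<open>upper u\<close> this bounds the minorant of level \<open>v\<close>, and between them convexity interpolates. The
  interpolated rate is the put payoff of the two-point law.
\<close>

lemma minorant_decrease_lower:
  assumes uv: "0 < u" "u < v" "v < 1" and fin: "glued_R \<mu> \<nu> u \<noteq> -\<infinity>"
  shows "(v - u) * (payoff k u - (G v - G u)) \<le> minorant u k - minorant v k"
proof -
  have u: "0 < u" "u < 1" and u': "0 \<le> u" "u \<le> 1" and v': "0 \<le> v" "v \<le> 1" using uv by auto
  let ?r = "lower u" and ?s = "upper u" and ?\<delta> = "v - u" and ?\<Delta> = "G v - G u"
  have \<Delta>: "0 \<le> ?\<Delta>" and \<delta>: "0 < ?\<delta>" using G_mono[of u v] uv by auto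
  have rs: "?r \<le> G u" "G u \<le> ?s" using lower_le_G[OF u fin] G_le_upper[OF u] by auto
  obtain c \<phi> where l: "\<And>x. c + \<phi> * x \<le> E u x" "D ?r = c + \<phi> * ?r" "E u ?s = c + \<phi> * ?s"
    using chord_ex[OF u fin] by blast
  have Er: "E u ?r = c + \<phi> * ?r" using l(2) E_eq_D[OF u rs(1)] by simp
  have J: "?\<delta> * (max (x - G u) 0 - ?\<Delta>) \<le> J u v x" for x
  proof -
    have "?\<delta> * (max (x - G u) 0 - ?\<Delta>) \<le> ?\<delta> * max (x - G v) 0" using \<delta> \<Delta> by (intro mult_left_mono) auto
    also have "\<dots> \<le> J u v x" using J_ge[of u v x] uv by simp
    finally show ?thesis .
  qed
  have E: "E v x = E u x - J u v x" for x using E_diff[of u v x] uv by simp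
  consider "k \<le> ?r" | "?r < k" "k < ?s" | "?s \<le> k" by linarith
  then show ?thesis
  proof cases
    case 1
    have "?\<delta> * ?\<Delta> \<ge> 0" using \<delta> \<Delta> by simp
    then show ?thesis using chord_put_left[OF rs 1] minorant_antimono[of u v k] uv by (simp add: algebra_simps)
  next
    case 2
    define \<kappa> where "\<kappa> = (?s - G u) / (?s - ?r)"
    have \<kappa>: "\<kappa> * (?s - ?r) = ?s - G u" using 2 by (simp add: \<kappa>_def)
    have A: "minorant v k \<le> (c + ?\<delta> * ?\<Delta> + ?\<delta> * \<kappa> * ?r) + (\<phi> - ?\<delta> * \<kappa>) * k"
    proof (rule convex_le_line[OF minorant_convex[OF v']])
      show "?r \<le> k" "k \<le> ?s" using 2 by auto
      have "minorant v ?r \<le> c + \<phi> * ?r" using minorant_le[OF v', of ?r] E[of ?r] J_nonneg[of u v ?r] Er by simp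
      moreover have "0 \<le> ?\<delta> * ?\<Delta>" using \<delta> \<Delta> by simp
      ultimately show "minorant v ?r \<le> (c + ?\<delta> * ?\<Delta> + ?\<delta> * \<kappa> * ?r) + (\<phi> - ?\<delta> * \<kappa>) * ?r"
        by (simp add: left_diff_distrib)
      have "minorant v ?s \<le> c + \<phi> * ?s - ?\<delta> * (?s - G u - ?\<Delta>)"
        using minorant_le[OF v', of ?s] E[of ?s] J[of ?s] rs l(3) by simp
      also have "\<dots> = (c + ?\<delta> * ?\<Delta> + ?\<delta> * \<kappa> * ?r) + (\<phi> - ?\<delta> * \<kappa>) * ?s"
      proof -
        have "?\<delta> * (\<kappa> * (?s - ?r)) = ?\<delta> * (?s - G u)" by (simp only: \<kappa>)
        then show ?thesis by (simp add: algebra_simps)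
      qed
      finally show "minorant v ?s \<le> (c + ?\<delta> * ?\<Delta> + ?\<delta> * \<kappa> * ?r) + (\<phi> - ?\<delta> * \<kappa>) * ?s" .
    qed
    have B: "c + \<phi> * k \<le> minorant u k" by (rule minorant_line[OF u' l(1)])
    have p: "payoff k u = \<kappa> * (k - ?r)" using chord_put_mid[OF 2] by (simp add: \<kappa>_def)
    show ?thesis unfolding p using A B by (simp add: algebra_simps)
  next
    case 3
    have "minorant v k \<le> E u k - J u v k" using minorant_le[OF v', of k] E[of k] by simp
    also have "E u k = minorant u k" using minorant_eq_E_right[OF u contact_upper[OF u] rs(2) 3] by simp
    finally show ?thesis using chord_put_right[OF rs 3] J[of k] 3 rs by simp
  qed
qed

text \<open>
  The same argument from the contact points of the later level. To the left of \<open>lower v\<close>, where they give no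
  chord, a supporting line of the minorant of level \<open>u\<close>, lowered by \<open>(v - u) * (G v - G u)\<close>, is an affine
  minorant of \<open>E v\<close> if it exceeds the minorant of level \<open>v\<close> at \<open>k\<close>.
\<close>

lemma minorant_decrease_upper:
  assumes uv: "0 < u" "u < v" "v < 1" and fin: "glued_R \<mu> \<nu> v \<noteq> -\<infinity>"
  shows "minorant u k - minorant v k \<le> (v - u) * (payoff k v + (G v - G u))"
proof -
  have v: "0 < v" "v < 1" and u': "0 \<le> u" "u \<le> 1" and v': "0 \<le> v" "v \<le> 1" using uv by auto
  let ?r = "lower v" and ?s = "upper v" and ?\<delta> = "v - u" and ?\<Delta> = "G v - G u"
  have \<Delta>: "0 \<le> ?\<Delta>" and \<delta>: "0 < ?\<delta>" using G_mono[of u v] uv by auto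
  have rs: "?r \<le> G v" "G v \<le> ?s" using lower_le_G[OF v fin] G_le_upper[OF v] by auto
  obtain c \<phi> where l: "\<And>x. c + \<phi> * x \<le> E v x" "D ?r = c + \<phi> * ?r" "E v ?s = c + \<phi> * ?s"
    using chord_ex[OF v fin] by blast
  have Er: "E v ?r = c + \<phi> * ?r" using l(2) E_eq_D[OF v rs(1)] by simp
  have J: "J u v x \<le> ?\<delta> * (max (x - G v) 0 + ?\<Delta>)" for x
  proof -
    have "J u v x \<le> ?\<delta> * max (x - G u) 0" using J_le[of u v x] uv by simp
    also have "\<dots> \<le> ?\<delta> * (max (x - G v) 0 + ?\<Delta>)" using \<delta> \<Delta> by (intro mult_left_mono) auto
    finally show ?thesis .
  qed
  have E: "E u x = E v x + J u v x" for x using E_diff[of u v x] uv by simp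
  consider "k \<le> ?r" | "?r < k" "k < ?s" | "?s \<le> k" by linarith
  then show ?thesis
  proof cases
    case 1
    have mr: "minorant v ?r = E v ?r"
      using minorant_line[OF v' l(1), of ?r] minorant_le[OF v', of ?r] Er by simp
    have "minorant u k - ?\<delta> * ?\<Delta> \<le> minorant v k"
    proof (rule ccontr)
      assume neg: "\<not> minorant u k - ?\<delta> * ?\<Delta> \<le> minorant v k"
      obtain b where b: "\<And>y. minorant u k + b * (y - k) \<le> minorant u y"
        using convex_supporting_line[OF minorant_convex[OF u']] by metis
      define a where "a = minorant u k - ?\<delta> * ?\<Delta> - b * k"
      have low: "a + b * x \<le> E v x" if "x \<le> G v" for x
        using b[of x] minorant_le[OF u', of x] E[of x] J[of x] that by (simp add: a_def algebra_simps)
      have "a + b * x \<le> E v x" for x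
      proof (cases "x \<le> G v")
        case True then show ?thesis by (rule low)
      next
        case False
        show ?thesis
        proof (rule ccontr)
          assume neg2: "\<not> a + b * x \<le> E v x"
          define e where "e = min (a + b * k - minorant v k) (a + b * x - minorant v x)"
          have e: "e > 0" using neg neg2 minorant_le[OF v', of x] by (simp add: e_def a_def)
          have "minorant v ?r \<le> (a - e) + b * ?r"
            by (rule convex_le_line[where b = x, OF minorant_convex[OF v'] 1]) (use False rs in \<open>auto simp: e_def\<close>)
          then show False using low[OF rs(1)] mr e by simp
        qed
      qed
      from minorant_line[OF v' this, of k] show False using neg by (simp add: a_def)
    qed
    then show ?thesis using chord_put_left[OF rs 1] by simp
  next
    case 2
    define \<kappa> where "\<kappa> = (?s - G v) / (?s - ?r)"
    have \<kappa>: "\<kappa> * (?s - ?r) = ?s - G v" using 2 by (simp add: \<kappa>_def)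
    have A: "minorant u k \<le> (c + ?\<delta> * ?\<Delta> - ?\<delta> * \<kappa> * ?r) + (\<phi> + ?\<delta> * \<kappa>) * k"
    proof (rule convex_le_line[OF minorant_convex[OF u']])
      show "?r \<le> k" "k \<le> ?s" using 2 by auto
      have "minorant u ?r \<le> c + \<phi> * ?r + ?\<delta> * ?\<Delta>"
        using minorant_le[OF u', of ?r] E[of ?r] J[of ?r] rs Er by simp
      then show "minorant u ?r \<le> (c + ?\<delta> * ?\<Delta> - ?\<delta> * \<kappa> * ?r) + (\<phi> + ?\<delta> * \<kappa>) * ?r"
        by (simp add: distrib_right)
      have "minorant u ?s \<le> c + \<phi> * ?s + ?\<delta> * (?s - G v + ?\<Delta>)"
        using minorant_le[OF u', of ?s] E[of ?s] J[of ?s] rs l(3) by simp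
      also have "\<dots> = (c + ?\<delta> * ?\<Delta> - ?\<delta> * \<kappa> * ?r) + (\<phi> + ?\<delta> * \<kappa>) * ?s"
      proof -
        have "?\<delta> * (\<kappa> * (?s - ?r)) = ?\<delta> * (?s - G v)" by (simp only: \<kappa>)
        then show ?thesis by (simp add: algebra_simps)
      qed
      finally show "minorant u ?s \<le> (c + ?\<delta> * ?\<Delta> - ?\<delta> * \<kappa> * ?r) + (\<phi> + ?\<delta> * \<kappa>) * ?s" .
    qed
    have B: "c + \<phi> * k \<le> minorant v k" by (rule minorant_line[OF v' l(1)])
    have p: "payoff k v = \<kappa> * (k - ?r)" using chord_put_mid[OF 2] by (simp add: \<kappa>_def)
    show ?thesis unfolding p using A B by (simp add: algebra_simps)
  next
    case 3
    have "minorant u k \<le> E v k + J u v k" using minorant_le[OF u', of k] E[of k] by simp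
    also have "E v k = minorant v k" using minorant_eq_E_right[OF v contact_upper[OF v] rs(2) 3] by simp
    finally show ?thesis using chord_put_right[OF rs 3] J[of k] 3 rs by simp
  qed
qed

end

section \<open>Measurability in the level\<close>

context curtain
begin

definition inside :: "real set" where "inside = {u. \<exists>I. in_component \<mu> \<nu> u I}"
definition gaps :: "real set" where "gaps = {u. \<exists>I. at_gap \<mu> \<nu> u I}"

lemma inside_subset: "inside \<subseteq> {0<..<1}"
  using in_component_facts(4,5) by (auto simp: inside_def)

lemma gaps_subset: "gaps \<subseteq> {0<..<1}"
  using at_gap_facts(3,4) by (auto simp: gaps_def)

lemma inside_borel [measurable]: "inside \<in> sets borel"
proof -
  have "inside = (\<Union>I\<in>irred_components \<mu> \<nu>. {u_left \<mu> I <..< u_right \<mu> I})"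
    by (auto simp: inside_def in_component_def)
  then have "open inside" by auto
  then show ?thesis by (rule borel_open)
qed

lemma countable_gaps: "countable gaps"
proof -
  have "countable (irred_components \<mu> \<nu>)"
  proof (rule countable_disjoint_open_subsets)
    show "open S" if "S \<in> irred_components \<mu> \<nu>" for S
      using that open_components[OF open_positive] by (simp add: irred_components_def)
    show "disjoint (irred_components \<mu> \<nu>)"
      unfolding irred_components_def by (simp add: pairwise_disjoint_components disjoint_def components_nonoverlap)
  qed
  moreover have "gaps \<subseteq> u_right \<mu> ` irred_components \<mu> \<nu>"
    using at_gap_facts(1,2) unfolding gaps_def by blast
  ultimately show ?thesis using countable_subset by blast
qed

lemma subset_gaps_borel: "A \<subseteq> gaps \<Longrightarrow> A \<in> sets borel"
  by (rule sets.countable[OF _ countable_subset[OF _ countable_gaps]]) simp_all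

lemma outside_eq_G: "u \<notin> inside \<Longrightarrow> u \<notin> gaps \<Longrightarrow> lower u = G u \<and> upper u = G u"
  by (auto simp: inside_def gaps_def lower_def upper_def glued_R_def glued_S_def)

lemma upper_measurable [measurable]: "upper \<in> borel_measurable borel"
proof -
  let ?C = "{{..0}, {0<..<1}, {1..}} :: real set set"
  show ?thesis
  proof (rule measurable_piecewise_restrict[of ?C])
    fix \<Omega> assume "\<Omega> \<in> ?C"
    then consider "\<Omega> = {0<..<1}" | "\<And>u. u \<in> \<Omega> \<Longrightarrow> u \<notin> {0<..<1}"
      by (elim insertE) auto
    then show "upper \<in> borel_measurable (restrict_space borel \<Omega>)"
    proof cases
      case 1
      then show ?thesis by (auto intro!: borel_measurable_mono_on_fnc mono_onI upper_mono)
    next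
      case 2
      then have "upper u = G u" if "u \<in> \<Omega>" for u
        using outside_eq_G[of u] that inside_subset gaps_subset by blast
      then show ?thesis
        by (subst measurable_cong[where g = G]) (auto simp: space_restrict_space intro: measurable_restrict_space1)
    qed
  qed auto
qed

text \<open>
  The minorant is decreasing in the level and continuous in the strike. So the composition is the limit of
  measurable functions obtained by rounding the strike to multiples of \<open>1/(n+1)\<close>.
\<close>

lemma minorant_compose_measurable:
  assumes [measurable]: "f \<in> borel_measurable borel"
  shows "(\<lambda>u. if 0 < u \<and> u < 1 then minorant u (f u) else 0) \<in> borel_measurable borel"
proof -
  have fixed: "(\<lambda>u. if 0 < u \<and> u < 1 then minorant u x else 0) \<in> borel_measurable borel" for x
  proof -
    have "(\<lambda>u. - minorant u x) \<in> borel_measurable (restrict_space borel {0<..<1})"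
      by (intro borel_measurable_mono_on_fnc mono_onI) (auto intro: minorant_antimono)
    then have "(\<lambda>u. - (- minorant u x)) \<in> borel_measurable (restrict_space borel {0<..<1})"
      by (rule borel_measurable_uminus)
    then have "(\<lambda>u. minorant u x) \<in> borel_measurable (restrict_space borel {0<..<1})" by simp
    then have "(\<lambda>u. indicator {0<..<1} u *\<^sub>R minorant u x) \<in> borel_measurable borel"
      by (subst (asm) borel_measurable_restrict_space_iff) auto
    moreover have "(\<lambda>u. indicator {0<..<1} u *\<^sub>R minorant u x) = (\<lambda>u. if 0 < u \<and> u < 1 then minorant u x else 0)"
      by (auto simp: indicator_def)
    ultimately show ?thesis by simp
  qed
  show ?thesis
  proof (rule borel_measurable_LIMSEQ_real)
    define \<xi> where "\<xi> n u = real_of_int \<lfloor>real (Suc n) * f u\<rfloor> / real (Suc n)" for n u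
    show "(\<lambda>u. if 0 < u \<and> u < 1 then minorant u (\<xi> n u) else 0) \<in> borel_measurable borel" for n
    proof -
      have "(\<lambda>u. (\<lambda>i::int. \<lambda>u. if 0 < u \<and> u < 1 then minorant u (real_of_int i / real (Suc n)) else 0) \<lfloor>real (Suc n) * f u\<rfloor> u) \<in> borel_measurable borel"
        by (rule measurable_compose_countable) (use fixed in measurable)
      then show ?thesis unfolding \<xi>_def .
    qed
    fix u :: real
    show "(\<lambda>n. if 0 < u \<and> u < 1 then minorant u (\<xi> n u) else 0) \<longlonglongrightarrow> (if 0 < u \<and> u < 1 then minorant u (f u) else 0)"
    proof (cases "0 < u \<and> u < 1")
      case True
      have \<xi>: "\<xi> n u \<le> f u \<and> f u - 1 / real (Suc n) \<le> \<xi> n u" for n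
      proof -
        define m where "m = real (Suc n)"
        have m: "0 < m" by (simp add: m_def)
        have 1: "real_of_int \<lfloor>m * f u\<rfloor> \<le> m * f u" and 2: "m * f u - 1 \<le> real_of_int \<lfloor>m * f u\<rfloor>" by linarith+
        have "real_of_int \<lfloor>m * f u\<rfloor> / m \<le> m * f u / m" "(m * f u - 1) / m \<le> real_of_int \<lfloor>m * f u\<rfloor> / m"
          by (rule divide_right_mono[OF 1 less_imp_le[OF m]], rule divide_right_mono[OF 2 less_imp_le[OF m]])
        then show ?thesis using m unfolding \<xi>_def m_def[symmetric] by (simp add: diff_divide_distrib)
      qed
      have lim: "(\<lambda>n. f u - 1 / real (Suc n)) \<longlonglongrightarrow> f u"
        using tendsto_diff[OF tendsto_const LIMSEQ_Suc[OF lim_const_over_n[of "1::real"]], of "f u"] by simp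
      have "(\<lambda>n. \<xi> n u) \<longlonglongrightarrow> f u"
        by (rule tendsto_sandwich[OF _ _ lim tendsto_const]; rule always_eventually; use \<xi> in blast)
      moreover have "isCont (minorant u) (f u)"
        using convex_on_continuous_at[OF minorant_convex[of u], of UNIV] True by (simp add: continuous_on_eq_continuous_at)
      ultimately have "(\<lambda>n. minorant u (\<xi> n u)) \<longlonglongrightarrow> minorant u (f u)"
        by (rule isCont_tendsto_compose[rotated])
      then show ?thesis using True by simp
    next
      case False
      then show ?thesis by (simp only: if_False tendsto_const)
    qed
  qed
qed

lemma line_slope_nonneg:
  assumes u: "0 < u" "u < 1" and l: "\<And>x. a + b * x \<le> E u x"
  shows "0 \<le> b"
proof (rule ccontr)
  assume neg: "\<not> 0 \<le> b"
  have "\<forall>\<^sub>F x in at_bot. D x < 1" by (rule order_tendstoD(2)[OF D_at_bot]) simp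
  then have "\<forall>\<^sub>F x in at_bot. D x < 1 \<and> x \<le> min (G u) ((1 - a) / b)"
    using eventually_le_at_bot[of "min (G u) ((1 - a) / b)"] by eventually_elim simp
  then obtain x where x: "D x < 1" "x \<le> G u" "x \<le> (1 - a) / b" using eventually_happens[of _ "at_bot :: real filter"] by auto
  have "1 - a \<le> b * x" using x(3) neg by (simp add: le_divide_eq mult.commute split: if_splits)
  then show False using l[of x] E_eq_D[OF u x(2)] x(1) by simp
qed

text \<open>
  To the right of \<open>R u\<close> the minorant is affine up to \<open>G u\<close>. Conversely, by convexity the midpoint equation makes
  the minorant affine on \<open>[c, G u]\<close>, and the minimality of the slope makes the tangent follow this affine piece
  down to \<open>c\<close>. There it is highest among the affine minorants, so it touches \<open>E u\<close> at or before \<open>c\<close>. The point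
  of the equation is that both sides are measurable in \<open>u\<close>: the monotonicity properties of \<open>R\<close> and \<open>S\<close> do not
  make \<open>R\<close> measurable on the set where \<open>S u = G u\<close>.
\<close>

lemma lower_le_iff:
  assumes u: "u \<in> inside" and c: "c < G u"
  shows "lower u \<le> c \<longleftrightarrow> 2 * minorant u ((c + G u) / 2) = minorant u c + minorant u (G u)"
proof -
  obtain I where I: "in_component \<mu> \<nu> u I" using u by (auto simp: inside_def)
  have u: "0 < u" "u < 1" and u': "0 \<le> u" "u \<le> 1" using in_component_facts(4,5)[OF I] by auto
  obtain r s \<phi> c\<^sub>0 where t: "glued_R \<mu> \<nu> u = ereal r" "glued_S \<mu> \<nu> u = ereal s" "0 < \<phi>" "r \<le> G u" "G u \<le> s"
      "\<And>x. c\<^sub>0 + \<phi> * x \<le> E u x" "D r = c\<^sub>0 + \<phi> * r" "E u s = c\<^sub>0 + \<phi> * s"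
      "\<And>k. k \<le> G u \<Longrightarrow> D k = c\<^sub>0 + \<phi> * k \<Longrightarrow> r \<le> k"
      "\<forall>w\<ge>0. (\<forall>x\<le>G u. (c\<^sub>0 + \<phi> * G u) + w * (x - G u) \<le> D x) \<longrightarrow> \<phi> \<le> w"
    by (rule component_tangent[OF I]) (rule that; (assumption | blast))
  have low: "lower u = r" using t by (simp add: lower_def)
  have Er: "E u r = c\<^sub>0 + \<phi> * r" using t(7) E_eq_D[OF u t(4)] by simp
  have line: "minorant u x = c\<^sub>0 + \<phi> * x" if "r \<le> x" "x \<le> s" for x
    by (rule minorant_eq_line[OF u' t(6)]) (use Er t(8) that in auto)
  note conv = minorant_convex[OF u']
  define M where "M = (c + G u) / 2"
  have M: "c < M" "M < G u" using c by (auto simp: M_def)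
  show ?thesis unfolding low M_def[symmetric]
  proof
    assume "r \<le> c"
    then show "2 * minorant u M = minorant u c + minorant u (G u)"
      using line[of c] line[of M] line[of "G u"] M t(4,5) by (simp add: M_def field_simps)
  next
    assume mid: "2 * minorant u M = minorant u c + minorant u (G u)"
    show "r \<le> c"
    proof -
      \<comment> \<open>The slope of the chord over \<open>[c, G u]\<close>.\<close>
      define w where "w = (minorant u (G u) - minorant u c) / (G u - c)"
      have w: "w * (G u - c) = minorant u (G u) - minorant u c" using c by (simp add: w_def)
      \<comment> \<open>A supporting line at the midpoint that meets the chord there must be the chord.\<close>
      obtain b where b: "\<And>y. minorant u M + b * (y - M) \<le> minorant u y"
        using convex_supporting_line[OF conv] by metis
      have bw: "b = w"
      proof -
        have 1: "minorant u M + b * (c - M) \<le> minorant u c" "minorant u M + b * (G u - M) \<le> minorant u (G u)" using b by auto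
        have 2: "c - M = - ((G u - c) / 2)" "G u - M = (G u - c) / 2" by (auto simp: M_def field_simps)
        have "b * (G u - c) = minorant u (G u) - minorant u c"
          using 1 mid unfolding 2 by (simp add: field_simps)
        then show ?thesis using w c by (metis diff_gt_0_iff_gt less_irrefl mult_right_cancel)
      qed
      have G_end: "minorant u (G u) = c\<^sub>0 + \<phi> * G u" using line t(4,5) by simp
      have wl: "minorant u (G u) + w * (x - G u) \<le> minorant u x" for x
      proof -
        have "minorant u M = minorant u (G u) + w * (M - G u)"
        proof -
          have "w * (M - G u) = - (w * (G u - c) / 2)" by (simp add: M_def field_simps)
          then show ?thesis using w mid by (simp add: field_simps)
        qed
        then show ?thesis using b[of x] bw by (simp add: algebra_simps)
      qed
      have "0 \<le> w"
      proof (rule line_slope_nonneg[OF u])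
        show "(minorant u (G u) - w * G u) + w * x \<le> E u x" for x
          using wl[of x] minorant_le[OF u', of x] by (simp add: algebra_simps)
      qed
      then have "\<phi> \<le> w"
      proof (rule t(10)[rule_format])
        fix x assume "x \<le> G u"
        then show "c\<^sub>0 + \<phi> * G u + w * (x - G u) \<le> D x"
          using wl[of x] minorant_le[OF u', of x] E_eq_D[OF u, of x] G_end by simp
      qed
      then have "\<phi> * (G u - c) \<le> w * (G u - c)" using c by (intro mult_right_mono) auto
      then have ge: "minorant u c \<le> c\<^sub>0 + \<phi> * c" using w G_end by (simp add: algebra_simps)
      have "\<exists>k\<le>c. E u k = c\<^sub>0 + \<phi> * k"
      proof (rule contact_left[where \<delta> = "\<phi> / 2" and M = "- (2 * c\<^sub>0 / \<phi>)"])
        show "continuous_on UNIV (E u)" by (rule E_continuous[OF u'])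
        show "c\<^sub>0 + \<phi> * x \<le> E u x" for x by (rule t(6))
        show "c' + s' * c \<le> c\<^sub>0 + \<phi> * c" if "\<And>x. c' + s' * x \<le> E u x" for c' s'
          using minorant_line[OF u' that, of c] ge by simp
        show "0 < \<phi> / 2" using t(3) by simp
        show "\<phi> / 2 * - x \<le> E u x - (c\<^sub>0 + \<phi> * x)" if "x \<le> - (2 * c\<^sub>0 / \<phi>)" for x
        proof -
          have "2 * c\<^sub>0 / \<phi> \<le> - x" using that by linarith
          then have "2 * c\<^sub>0 \<le> - x * \<phi>" using t(3) by (simp only: pos_divide_le_eq)
          then show ?thesis using E_nonneg[OF u', of x] by (simp add: algebra_simps)
        qed
      qed
      then obtain k where k: "k \<le> c" "E u k = c\<^sub>0 + \<phi> * k" by blast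
      then have "D k = c\<^sub>0 + \<phi> * k" using E_eq_D[OF u, of k] c by simp
      then show ?thesis using t(9)[of k] k c by simp
    qed
  qed
qed

lemma lower_measurable [measurable]: "lower \<in> borel_measurable borel"
  unfolding borel_measurable_iff_le
proof (intro allI)
  fix c
  define F where "F f u = (if 0 < u \<and> u < 1 then minorant u (f u) else 0)" for f :: "real \<Rightarrow> real" and u
  have [measurable]: "F (\<lambda>u. (c + G u) / 2) \<in> borel_measurable borel" "F (\<lambda>u. c) \<in> borel_measurable borel" "F G \<in> borel_measurable borel"
    unfolding F_def by (rule minorant_compose_measurable; measurable)+
  have gaps [measurable]: "gaps \<in> sets borel" by (rule subset_gaps_borel) simp
  have eq: "{u. lower u \<le> c} = {u. u \<in> inside \<and> G u \<le> c} \<union>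
    {u. u \<in> inside \<and> c < G u \<and> 2 * F (\<lambda>u. (c + G u) / 2) u = F (\<lambda>u. c) u + F G u} \<union>
    {u \<in> gaps. lower u \<le> c} \<union> {u. u \<notin> inside \<and> u \<notin> gaps \<and> G u \<le> c}"
  proof -
    have "lower u \<le> c \<longleftrightarrow> G u \<le> c \<or> (c < G u \<and> 2 * F (\<lambda>u. (c + G u) / 2) u = F (\<lambda>u. c) u + F G u)"
      if u: "u \<in> inside" for u
    proof -
      have u01: "0 < u" "u < 1" using u inside_subset by auto
      have "glued_R \<mu> \<nu> u \<noteq> -\<infinity>"
      proof -
        obtain I where I: "in_component \<mu> \<nu> u I" using u by (auto simp: inside_def)
        obtain r where "glued_R \<mu> \<nu> u = ereal r"
          by (rule component_tangent[OF I]) (rule that; (assumption | blast))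
        then show ?thesis by simp
      qed
      then have "lower u \<le> G u" using lower_le_G[OF u01] by simp
      then show ?thesis using lower_le_iff[OF u, of c] u01 by (cases "G u \<le> c") (auto simp: F_def)
    qed
    moreover have "u \<notin> inside \<Longrightarrow> u \<notin> gaps \<Longrightarrow> lower u \<le> c \<longleftrightarrow> G u \<le> c" for u
      using outside_eq_G[of u] by simp
    ultimately show ?thesis by blast
  qed
  have [measurable]: "{u \<in> gaps. lower u \<le> c} \<in> sets borel" by (rule subset_gaps_borel) auto
  have "{u. lower u \<le> c} \<in> sets borel" unfolding eq by measurable
  then show "{u \<in> space borel. lower u \<le> c} \<in> sets borel" by simp
qed

lemma payoff_measurable [measurable]: "payoff k \<in> borel_measurable borel"
  unfolding chord_put_def[abs_def] by measurable

text \<open>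
  \<open>R\<close> is infinite only at the gap of a component that is unbounded to the left, and two such components meet.
\<close>

lemma glued_R_minus_infinity_unique:
  assumes u: "0 < u" "u < 1" "glued_R \<mu> \<nu> u = -\<infinity>" and v: "0 < v" "v < 1" "glued_R \<mu> \<nu> v = -\<infinity>"
  shows "u = v"
proof -
  have *: "\<exists>I. at_gap \<mu> \<nu> u I \<and> left_end I = -\<infinity>" if u: "0 < u" "u < 1" "glued_R \<mu> \<nu> u = -\<infinity>" for u
  proof -
    consider (inside) I where "in_component \<mu> \<nu> u I" | (gap) I where "at_gap \<mu> \<nu> u I"
      | (outside) "\<nexists>I. in_component \<mu> \<nu> u I" "\<nexists>I. at_gap \<mu> \<nu> u I" by blast
    then show ?thesis
    proof cases
      case inside
      obtain r where "glued_R \<mu> \<nu> u = ereal r"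
        by (rule component_tangent[OF inside]) (rule that; (assumption | blast))
      then show ?thesis using u by simp
    next
      case gap
      then show ?thesis using glued_gap(1)[OF gap] u by auto
    next
      case outside
      then show ?thesis using glued_outside[OF u(1,2) outside] u by simp
    qed
  qed
  obtain I where I: "at_gap \<mu> \<nu> u I" "left_end I = -\<infinity>" using *[OF u] by blast
  obtain I' where I': "at_gap \<mu> \<nu> v I'" "left_end I' = -\<infinity>" using *[OF v] by blast
  note irr = at_gap_facts(1)[OF I(1)] at_gap_facts(1)[OF I'(1)]
  define x where "x = min (G u) (G v)"
  have "x \<in> I"
    using component_iff[OF irr(1), of x] component_iff[OF irr(1), of "G u"] at_gap_facts(5)[OF I(1)] I(2)
      le_less_trans[of "ereal x" "ereal (G u)" "right_end I"] by (simp add: x_def)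
  moreover have "x \<in> I'"
    using component_iff[OF irr(2), of x] component_iff[OF irr(2), of "G v"] at_gap_facts(5)[OF I'(1)] I'(2)
      le_less_trans[of "ereal x" "ereal (G v)" "right_end I'"] by (simp add: x_def)
  ultimately have "I = I'" using component_unique[OF irr] by blast
  then show ?thesis using at_gap_facts(2)[OF I(1)] at_gap_facts(2)[OF I'(1)] by simp
qed

end

section \<open>Integrating the payoffs of the two-point laws\<close>

text \<open>
  The integral of a difference quotient is a difference of averages of \<open>\<eta>\<close> near the end points, and
  dominated convergence exchanges the limits. This replaces the fundamental theorem of calculus, as the
  derivative may fail to exist on a countable dense set.
\<close>

lemma integral_of_right_derivative:
  fixes \<eta> p :: "real \<Rightarrow> real"
  assumes cont: "continuous_on UNIV \<eta>" and anti: "\<And>x y. x \<le> y \<Longrightarrow> \<eta> y \<le> \<eta> x" and ab: "a < b"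
    and p: "p \<in> borel_measurable borel"
    and bound: "\<And>n. AE t in lborel. t \<in> {a<..<b} \<longrightarrow> \<bar>real (Suc (n + n\<^sub>0)) * (\<eta> t - \<eta> (t + 1 / real (Suc (n + n\<^sub>0))))\<bar> \<le> C"
    and lim: "AE t in lborel. t \<in> {a<..<b} \<longrightarrow> (\<lambda>n. real (Suc n) * (\<eta> t - \<eta> (t + 1 / real (Suc n)))) \<longlonglongrightarrow> p t"
  shows "set_integrable lborel {a<..<b} p" and "(LINT t:{a<..<b}|lborel. p t) = \<eta> a - \<eta> b"
proof -
  define m where "m n = real (Suc (n + n\<^sub>0))" for n
  have m: "0 < m n" for n by (simp add: m_def)
  have m_lim: "(\<lambda>n. 1 / m n) \<longlonglongrightarrow> 0"
    unfolding m_def using LIMSEQ_ignore_initial_segment[OF LIMSEQ_Suc[OF lim_const_over_n[of "1::real"]], of n\<^sub>0] by simp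
  define q where "q n t = m n * (\<eta> t - \<eta> (t + 1 / m n))" for n t
  have [measurable]: "\<eta> \<in> borel_measurable borel" by (rule borel_measurable_continuous_onI[OF cont])
  note p[measurable]
  have qm[measurable]: "q n \<in> borel_measurable borel" for n unfolding q_def[abs_def] by measurable
  have int: "set_integrable lborel {x<..<y} \<eta>" for x y
    by (rule set_integrable_subset[OF borel_integrable_atLeastAtMost'[of x y \<eta>]])
      (use cont continuous_on_subset in auto)
  have shift: "set_integrable lborel {x<..<y} (\<lambda>t. \<eta> (t + e))" "(LINT t:{x<..<y}|lborel. \<eta> (t + e)) = (LINT t:{x + e<..<y + e}|lborel. \<eta> t)" for x y e
  proof -
    show "set_integrable lborel {x<..<y} (\<lambda>t. \<eta> (t + e))"
      by (rule set_integrable_subset[OF borel_integrable_atLeastAtMost'[of x y "\<lambda>t. \<eta> (t + e)"]])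
        (auto intro!: continuous_on_compose2[OF cont] continuous_intros)
    show "(LINT t:{x<..<y}|lborel. \<eta> (t + e)) = (LINT t:{x + e<..<y + e}|lborel. \<eta> t)"
      unfolding set_lebesgue_integral_def
      using lborel_integral_real_affine[of 1 "\<lambda>t. indicator {x + e<..<y + e} t *\<^sub>R \<eta> t" e]
      by (simp add: indicator_def add.commute)
  qed
  have sandwich: "(y - x) * \<eta> y \<le> (LINT t:{x<..<y}|lborel. \<eta> t) \<and> (LINT t:{x<..<y}|lborel. \<eta> t) \<le> (y - x) * \<eta> x"
    if "x \<le> y" for x y
  proof -
    have c: "set_integrable lborel {x<..<y} (\<lambda>t. c :: real)" "(LINT t:{x<..<y}|lborel. c :: real) = (y - x) * c" for c
      using that by (auto simp: set_integrable_def set_lebesgue_integral_def mult.commute)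
    have "(LINT t:{x<..<y}|lborel. \<eta> y) \<le> (LINT t:{x<..<y}|lborel. \<eta> t)"
      by (intro set_integral_mono c int) (use anti in auto)
    moreover have "(LINT t:{x<..<y}|lborel. \<eta> t) \<le> (LINT t:{x<..<y}|lborel. \<eta> x)"
      by (intro set_integral_mono c int) (use anti in auto)
    ultimately show ?thesis using c by simp
  qed
  have qint: "(LINT t:{a<..<b}|lborel. q n t) = m n * (LINT t:{a<..<a + 1 / m n}|lborel. \<eta> t) - m n * (LINT t:{b<..<b + 1 / m n}|lborel. \<eta> t)" for n
  proof -
    let ?e = "1 / m n"
    have e: "0 < ?e" using m by simp
    have "(LINT t:{a<..<b}|lborel. q n t) = m n * ((LINT t:{a<..<b}|lborel. \<eta> t) - (LINT t:{a<..<b}|lborel. \<eta> (t + ?e)))"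
      unfolding q_def by (simp only: set_integral_mult_right set_integral_diff(2)[OF int shift(1)])
    also have "(LINT t:{a<..<b}|lborel. \<eta> (t + ?e)) = (LINT t:{a + ?e<..<b + ?e}|lborel. \<eta> t)" by (rule shift(2))
    finally have f0: "(LINT t:{a<..<b}|lborel. q n t) = m n * ((LINT t:{a<..<b}|lborel. \<eta> t) - (LINT t:{a + ?e<..<b + ?e}|lborel. \<eta> t))" .
    have f1: "(LINT t:{a<..<b + ?e}|lborel. \<eta> t) = (LINT t:{a<..<b}|lborel. \<eta> t) + (LINT t:{b<..<b + ?e}|lborel. \<eta> t)"
      by (rule set_integral_split[OF int]) (use ab e in auto)
    have f2: "(LINT t:{a<..<b + ?e}|lborel. \<eta> t) = (LINT t:{a<..<a + ?e}|lborel. \<eta> t) + (LINT t:{a + ?e<..<b + ?e}|lborel. \<eta> t)"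
      by (rule set_integral_split[OF int]) (use ab e in auto)
    have f3: "(LINT t:{a<..<b}|lborel. \<eta> t) - (LINT t:{a + ?e<..<b + ?e}|lborel. \<eta> t) =
        (LINT t:{a<..<a + ?e}|lborel. \<eta> t) - (LINT t:{b<..<b + ?e}|lborel. \<eta> t)"
      using f1 f2 by linarith
    show ?thesis unfolding f0 f3 by (rule right_diff_distrib)
  qed
  have lim2: "(\<lambda>n. LINT t:{a<..<b}|lborel. q n t) \<longlonglongrightarrow> \<eta> a - \<eta> b"
  proof (rule tendsto_sandwich)
    have c: "(\<lambda>n. \<eta> (x + 1 / m n)) \<longlonglongrightarrow> \<eta> x" for x
    proof -
      have "isCont \<eta> x" using cont by (simp add: continuous_on_eq_continuous_at)
      moreover have "(\<lambda>n. x + 1 / m n) \<longlonglongrightarrow> x" using tendsto_add[OF tendsto_const m_lim, of x] by simp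
      ultimately show ?thesis by (rule isCont_tendsto_compose)
    qed
    show "(\<lambda>n. \<eta> (a + 1 / m n) - \<eta> b) \<longlonglongrightarrow> \<eta> a - \<eta> b" by (intro tendsto_diff c tendsto_const)
    show "(\<lambda>n. \<eta> a - \<eta> (b + 1 / m n)) \<longlonglongrightarrow> \<eta> a - \<eta> b" by (intro tendsto_diff c tendsto_const)
    have s: "\<eta> (x + 1 / m n) \<le> m n * (LINT t:{x<..<x + 1 / m n}|lborel. \<eta> t)"
      "m n * (LINT t:{x<..<x + 1 / m n}|lborel. \<eta> t) \<le> \<eta> x" for x n
      using sandwich[of x "x + 1 / m n"] m[of n] by (simp_all add: field_simps)
    show "\<forall>\<^sub>F n in sequentially. \<eta> (a + 1 / m n) - \<eta> b \<le> (LINT t:{a<..<b}|lborel. q n t)"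
      unfolding qint using s by (intro always_eventually allI diff_mono) auto
    show "\<forall>\<^sub>F n in sequentially. (LINT t:{a<..<b}|lborel. q n t) \<le> \<eta> a - \<eta> (b + 1 / m n)"
      unfolding qint using s by (intro always_eventually allI diff_mono) auto
  qed
  have w: "integrable lborel (\<lambda>t. indicator {a<..<b} t * C)" using ab by auto
  have l: "AE t in lborel. (\<lambda>n. indicator {a<..<b} t *\<^sub>R q n t) \<longlonglongrightarrow> indicator {a<..<b} t *\<^sub>R p t"
    using lim
  proof eventually_elim
    case (elim t)
    show ?case
    proof (cases "t \<in> {a<..<b}")
      case True
      then have "(\<lambda>n. q n t) \<longlonglongrightarrow> p t"
        unfolding q_def m_def using elim LIMSEQ_ignore_initial_segment[of "\<lambda>n. real (Suc n) * (\<eta> t - \<eta> (t + 1 / real (Suc n)))" "p t" n\<^sub>0] by simp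
      then show ?thesis using True by simp
    qed simp
  qed
  have bd: "AE t in lborel. norm (indicator {a<..<b} t *\<^sub>R q n t) \<le> indicator {a<..<b} t * C" for n
    using bound[of n]
  proof eventually_elim
    case (elim t)
    then show ?case by (cases "t \<in> {a<..<b}") (simp_all add: q_def m_def)
  qed
  have pm: "(\<lambda>t. indicator {a<..<b} t *\<^sub>R p t) \<in> borel_measurable lborel" by simp
  have qm': "(\<lambda>t. indicator {a<..<b} t *\<^sub>R q n t) \<in> borel_measurable lborel" for n by simp
  show "set_integrable lborel {a<..<b} p"
    unfolding set_integrable_def by (rule integrable_dominated_convergence[OF pm qm' w l bd])
  have "(\<lambda>n. LINT t:{a<..<b}|lborel. q n t) \<longlonglongrightarrow> (LINT t:{a<..<b}|lborel. p t)"
    unfolding set_lebesgue_integral_def by (rule integral_dominated_convergence[OF pm qm' w l bd])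
  then show "(LINT t:{a<..<b}|lborel. p t) = \<eta> a - \<eta> b"
    using lim2 LIMSEQ_unique by blast
qed

context curtain
begin

definition B :: "real \<Rightarrow> real" where
  "B x = (LINT t:{0<..<x}|lborel. \<bar>G t\<bar>)"

lemma abs_G_integrable: "0 \<le> a \<Longrightarrow> b \<le> 1 \<Longrightarrow> set_integrable lborel {a<..<b} (\<lambda>t. \<bar>G t\<bar>)"
  by (intro set_integrable_abs G_integrable)

lemma B_continuous: "continuous_on {0..1} B"
proof -
  have eq: "B x = integral {0..x} (\<lambda>t. \<bar>G t\<bar>)" if "x \<in> {0..1}" for x
    unfolding B_def using set_borel_integral_eq_integral(2)[OF abs_G_integrable[of 0 x]] that
    by (simp add: integral_open_interval_real)
  have "(\<lambda>t. \<bar>G t\<bar>) integrable_on {0<..<1}"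
    by (rule set_borel_integral_eq_integral(1)[OF abs_G_integrable]) auto
  then have "(\<lambda>t. \<bar>G t\<bar>) integrable_on {0..1}" by (simp add: integrable_on_open_interval_real)
  from indefinite_integral_continuous_1[OF this] show ?thesis
    by (rule continuous_on_eq) (use eq in auto)
qed

lemma B_diff:
  assumes "0 \<le> u" "u \<le> v" "v \<le> 1"
  shows "B v - B u = (LINT t:{u<..<v}|lborel. \<bar>G t\<bar>)"
  unfolding B_def using set_integral_split[OF abs_G_integrable[of 0 v], of u] assms by simp

lemma B_nonneg: "0 \<le> B x"
  unfolding B_def set_lebesgue_integral_def by (rule integral_nonneg_AE) (auto simp: indicator_def)

lemma J_le_B:
  assumes uv: "0 \<le> u" "u \<le> v" "v \<le> 1"
  shows "J u v x \<le> (v - u) * max x 0 + (B v - B u)"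
proof -
  note i = const_integrable[of u v "max x 0"] abs_G_integrable[OF uv(1,3)]
  have "J u v x \<le> (LINT t:{u<..<v}|lborel. max x 0 + \<bar>G t\<bar>)"
    unfolding J_def by (rule set_integral_mono[OF payoff_integrable(1)[OF uv(1,3)] set_integral_add(1)[OF i]]) auto
  also have "\<dots> = (v - u) * max x 0 + (B v - B u)"
    using set_integral_add(2)[OF i] const_integral[OF uv(2)] B_diff[OF uv] by simp
  finally show ?thesis .
qed

lemma G_integral_le_B: "0 \<le> v \<Longrightarrow> v \<le> 1 \<Longrightarrow> (LINT t:{v<..<1}|lborel. G t) \<le> B 1"
proof -
  assume v: "0 \<le> v" "v \<le> 1"
  have "(LINT t:{v<..<1}|lborel. G t) \<le> (LINT t:{v<..<1}|lborel. \<bar>G t\<bar>)"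
    by (rule set_integral_mono) (use v G_integrable abs_G_integrable in auto)
  also have "\<dots> = B 1 - B v" using B_diff[of v 1] v by simp
  finally show ?thesis using B_nonneg[of v] by simp
qed

text \<open>
  \<open>E v\<close> grows at least like \<open>(1 - b) * x\<close>, so \<open>J u v\<close> is bounded by a small multiple of \<open>E v\<close> plus a small constant.
  Scaling down a supporting line of the minorant of level \<open>u\<close> accordingly gives an affine minorant of \<open>E v\<close>.
\<close>

lemma minorant_estimate:
  assumes uv: "0 \<le> u" "u \<le> v" "v \<le> b" "b < 1"
  defines "\<tau> \<equiv> (v - u) / (1 - b)"
  shows "minorant u k \<le> (1 + \<tau>) * minorant v k + (\<tau> * B 1 + (B v - B u))"
proof -
  have u': "0 \<le> u" "u \<le> 1" and v': "0 \<le> v" "v \<le> 1" using uv by auto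
  have \<tau>: "0 \<le> \<tau>" "\<tau> * (1 - b) = v - u" using uv by (auto simp: \<tau>_def)
  let ?K = "\<tau> * B 1 + (B v - B u)"
  have E: "E u x \<le> (1 + \<tau>) * E v x + ?K" for x
  proof -
    have "(1 - b) * max x 0 \<le> E v x + B 1"
    proof (cases "0 \<le> x")
      case True
      have "(1 - b) * x \<le> (1 - v) * x" using uv True by (intro mult_right_mono) auto
      also have "\<dots> \<le> E v x + B 1" using E_ge_affine[of v 1 x] G_integral_le_B[of v] v' by simp
      finally show ?thesis using True by simp
    next
      case False
      then show ?thesis using E_nonneg[OF v', of x] B_nonneg[of 1] by simp
    qed
    then have "\<tau> * ((1 - b) * max x 0) \<le> \<tau> * (E v x + B 1)" using \<tau> by (intro mult_left_mono) auto
    moreover have "\<tau> * ((1 - b) * max x 0) = (v - u) * max x 0" by (simp only: mult.assoc[symmetric] \<tau>(2))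
    ultimately have "J u v x \<le> \<tau> * (E v x + B 1) + (B v - B u)" using J_le_B[of u v x] uv by simp
    then show ?thesis using E_diff[of u v x] uv by (simp add: algebra_simps)
  qed
  obtain s where s: "\<And>y. minorant u k + s * (y - k) \<le> minorant u y"
    using convex_supporting_line[OF minorant_convex[OF u']] by metis
  have pos: "0 < 1 + \<tau>" using \<tau> by simp
  have "(minorant u k - s * k - ?K) / (1 + \<tau>) + (s / (1 + \<tau>)) * x \<le> E v x" for x
  proof -
    have "(minorant u k - s * k - ?K) + s * x \<le> (1 + \<tau>) * E v x"
      using s[of x] minorant_le[OF u', of x] E[of x] by (simp add: algebra_simps)
    then have "((minorant u k - s * k - ?K) + s * x) / (1 + \<tau>) \<le> E v x"
      using pos by (simp add: pos_divide_le_eq mult.commute)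
    then show ?thesis by (simp add: add_divide_distrib)
  qed
  from minorant_line[OF v' this, of k]
  have "((minorant u k - s * k - ?K) + s * k) / (1 + \<tau>) \<le> minorant v k"
    by (simp only: add_divide_distrib times_divide_eq_left)
  then show ?thesis using pos by (simp add: pos_divide_le_eq algebra_simps)
qed

lemma minorant_continuous:
  assumes b: "0 \<le> b" "b < 1"
  shows "continuous_on {0..b} (\<lambda>u. minorant u k)"
  unfolding continuous_on_def
proof
  fix x assume x: "x \<in> {0..b}"
  have bound: "\<bar>minorant u k - minorant v k\<bar> \<le> \<bar>v - u\<bar> / (1 - b) * (put \<nu> k + B 1) + \<bar>B v - B u\<bar>"
    if uv: "0 \<le> u" "u \<le> v" "v \<le> b" for u v
  proof -
    have v': "0 \<le> v" "v \<le> 1" using uv b by auto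
    define \<tau> where "\<tau> = (v - u) / (1 - b)"
    have "minorant v k \<le> put \<nu> k"
      using minorant_le[OF v', of k] J_nonneg[of 0 v k] by (simp add: E_def)
    then have "\<tau> * minorant v k \<le> \<tau> * put \<nu> k"
      using uv b by (intro mult_left_mono) (auto simp: \<tau>_def)
    moreover have "minorant u k \<le> (1 + \<tau>) * minorant v k + (\<tau> * B 1 + (B v - B u))"
      unfolding \<tau>_def by (rule minorant_estimate[OF uv b(2)])
    moreover have "\<bar>v - u\<bar> / (1 - b) = \<tau>" using uv by (simp add: \<tau>_def)
    moreover have "0 \<le> B v - B u" using B_diff[of u v] uv b
      by (auto simp: set_lebesgue_integral_def indicator_def intro!: integral_nonneg_AE)
    ultimately show ?thesis
      using minorant_antimono[of u v k] uv b by (simp add: algebra_simps)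
  qed
  have "((\<lambda>u. minorant u k - minorant x k) \<longlongrightarrow> 0) (at x within {0..b})"
  proof (rule Lim_null_comparison)
    show "\<forall>\<^sub>F u in at x within {0..b}. norm (minorant u k - minorant x k)
        \<le> \<bar>x - u\<bar> / (1 - b) * (put \<nu> k + B 1) + \<bar>B x - B u\<bar>"
      unfolding eventually_at_filter
    proof (intro always_eventually allI impI)
      fix u assume u: "u \<noteq> x" "u \<in> {0..b}"
      show "norm (minorant u k - minorant x k) \<le> \<bar>x - u\<bar> / (1 - b) * (put \<nu> k + B 1) + \<bar>B x - B u\<bar>"
      proof (cases "u \<le> x")
        case True
        then show ?thesis using bound[of u x] u x by simp
      next
        case False
        then show ?thesis using bound[of x u] u x by (simp add: abs_minus_commute)
      qed
    qed
    have "(B \<longlongrightarrow> B x) (at x within {0..b})"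
      using continuous_on_subset[OF B_continuous, of "{0..b}"] b x by (auto simp: continuous_on_def)
    then have "((\<lambda>u. \<bar>x - u\<bar> / (1 - b) * (put \<nu> k + B 1) + \<bar>B x - B u\<bar>) \<longlongrightarrow>
      \<bar>x - x\<bar> / (1 - b) * (put \<nu> k + B 1) + \<bar>B x - B x\<bar>) (at x within {0..b})"
      by (intro tendsto_intros) (use b in auto)
    then show "((\<lambda>u. \<bar>x - u\<bar> / (1 - b) * (put \<nu> k + B 1) + \<bar>B x - B u\<bar>) \<longlongrightarrow> 0) (at x within {0..b})"
      by simp
  qed
  then show "((\<lambda>u. minorant u k) \<longlongrightarrow> minorant x k) (at x within {0..b})" by (rule LIM_zero_cancel)
qed

lemma minorant_0: "minorant 0 k = put \<nu> k"
proof -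
  have E0: "E 0 = put \<nu>" by (rule ext) (simp add: E_def J_def set_lebesgue_integral_def)
  show ?thesis
    using minorant_le[of 0 k] minorant_greatest[of 0 "put \<nu>" k] convex_on_put[OF fin_moments(2)]
    by (simp add: E0)
qed

text \<open>
  \<open>D\<close> is small at two points on either side of \<open>k\<close>, hence so is \<open>E u\<close> for \<open>u\<close> close to 1, and a convex function is
  small between two points where it is small.
\<close>

lemma minorant_at_1:
  assumes e: "0 < e"
  shows "\<exists>d<1. \<forall>u. d < u \<longrightarrow> u < 1 \<longrightarrow> minorant u k \<le> e"
proof -
  have "\<forall>\<^sub>F x in at_bot. D x < e / 2" by (rule order_tendstoD(2)[OF D_at_bot]) (use e in simp)
  then have "\<forall>\<^sub>F x in at_bot. D x < e / 2 \<and> x \<le> k" using eventually_le_at_bot[of k] by eventually_elim simp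
  then obtain a where a: "D a < e / 2" "a \<le> k" using eventually_happens[of _ "at_bot :: real filter"] by auto
  have "\<forall>\<^sub>F x in at_top. D x < e / 2" by (rule order_tendstoD(2)[OF D_at_top]) (use e in simp)
  then have "\<forall>\<^sub>F x in at_top. D x < e / 2 \<and> k \<le> x" using eventually_ge_at_top[of k] by eventually_elim simp
  then obtain b where b: "D b < e / 2" "k \<le> b" using eventually_happens[of _ "at_top :: real filter"] by auto
  define M where "M = max (max a 0) (max b 0)"
  have "continuous_on {0..1} (\<lambda>u. (1 - u) * M + (B 1 - B u))"
    by (intro continuous_intros B_continuous)
  from this[unfolded continuous_on_def, THEN bspec[where x = 1]]
  have "((\<lambda>u. (1 - u) * M + (B 1 - B u)) \<longlongrightarrow> (1 - 1) * M + (B 1 - B 1)) (at 1 within {0..1})" by simp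
  then have "\<forall>\<^sub>F u in at 1 within {0..1}. (1 - u) * M + (B 1 - B u) < e / 2"
    by (rule order_tendstoD) (use e in simp)
  then obtain d where d: "d > 0" "\<And>u. u \<in> {0..1} \<Longrightarrow> u \<noteq> 1 \<Longrightarrow> dist u 1 < d \<Longrightarrow> (1 - u) * M + (B 1 - B u) < e / 2"
    unfolding eventually_at by metis
  show ?thesis
  proof (intro exI[of _ "max 0 (1 - d)"] conjI allI impI)
    show "max 0 (1 - d) < 1" using d by simp
    fix u assume u: "max 0 (1 - d) < u" "u < 1"
    have u': "0 \<le> u" "u \<le> 1" using u by auto
    have small: "(1 - u) * M + (B 1 - B u) < e / 2" using u by (intro d(2)) (auto simp: dist_real_def)
    have "E u x \<le> e" if "D x < e / 2" "max x 0 \<le> M" for x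
    proof -
      have "(1 - u) * max x 0 \<le> (1 - u) * M" using u that by (intro mult_left_mono) auto
      then show ?thesis using E_eq[OF u', of x] J_le_B[of u 1 x] small that u' by simp
    qed
    then have "E u a \<le> e" "E u b \<le> e" using a b by (auto simp: M_def)
    then have "minorant u k \<le> e + 0 * k"
      by (intro convex_le_line[OF minorant_convex[OF u'] a(2) b(2)])
        (use minorant_le[OF u', of a] minorant_le[OF u', of b] in auto)
    then show "minorant u k \<le> e" by simp
  qed
qed

text \<open>
  \<open>G\<close> and \<open>upper\<close> are monotone. By second-order left-monotonicity, \<open>lower\<close> is decreasing on each of the sets
  \<open>{u. u < q \<and> G q < upper u}\<close>, and those with rational \<open>q\<close> contain all levels \<open>u\<close> with \<open>G u < upper u\<close> at which
  \<open>G\<close> is continuous. Where \<open>G u = upper u\<close>, the bounds for the payoff force continuity without any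
  information on \<open>lower\<close>.
\<close>

lemma payoff_continuity:
  "\<exists>Z. countable Z \<and> (\<forall>t. 0 < t \<longrightarrow> t < 1 \<longrightarrow> t \<notin> Z \<longrightarrow> glued_R \<mu> \<nu> t \<noteq> -\<infinity> \<and> isCont G t \<and> isCont (payoff k) t)"
proof -
  define W where "W = {u. 0 < u \<and> u < 1 \<and> glued_R \<mu> \<nu> u = -\<infinity>}"
  have finW: "finite W"
  proof (cases "W = {}")
    case False
    then obtain w where "w \<in> W" by blast
    then have "W \<subseteq> {w}" using glued_R_minus_infinity_unique by (auto simp: W_def)
    then show ?thesis by (rule finite_subset) simp
  qed simp
  define A where "A q = {u. 0 < u \<and> u < q \<and> G q < upper u} - W" for q
  define disc where "disc S f = {a\<in>S. \<not> continuous (at a within S) f}" for S and f :: "real \<Rightarrow> real"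
  define Q where "Q = {q\<in>\<rat>. 0 < q \<and> q < (1::real)}"
  define Z where "Z = W \<union> disc {0<..<1} G \<union> disc {0<..<1} upper \<union> (\<Union>q\<in>Q. disc (A q) (\<lambda>u. - lower u) \<union> {Inf (A q)})"
  have "countable (disc {0<..<1} G)" "countable (disc {0<..<1} upper)"
    unfolding disc_def by (intro mono_on_ctble_discont mono_onI; auto intro: G_mono upper_mono)+
  moreover have "countable (disc (A q) (\<lambda>u. - lower u))" if q: "q \<in> Q" for q
    unfolding disc_def
  proof (intro mono_on_ctble_discont mono_onI)
    fix u v assume uv: "u \<in> A q" "v \<in> A q" "u \<le> v"
    show "- lower u \<le> - lower v"
    proof (cases "u = v")
      case False
      have u: "0 < u" "u < 1" "glued_R \<mu> \<nu> u \<noteq> -\<infinity>" and v: "0 < v" "v < 1" "glued_R \<mu> \<nu> v \<noteq> -\<infinity>"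
        using uv q by (auto simp: A_def W_def Q_def)
      have "lower v \<le> G v" by (rule lower_le_G[OF v])
      also have "G v \<le> G q" using uv q by (intro G_mono) (auto simp: A_def Q_def)
      also have "\<dots> < upper u" using uv by (simp add: A_def)
      finally have "lower v < upper u" .
      moreover have "glued_R \<mu> \<nu> v \<notin> {glued_R \<mu> \<nu> u <..< glued_S \<mu> \<nu> u}"
        by (rule glued_R_not_between) (use u v uv False in auto)
      ultimately show ?thesis
        using glued_R_lower[OF u] glued_R_lower[OF v] glued_S_upper[OF u(1,2)] by auto
    qed simp
  qed
  moreover have "countable Q" unfolding Q_def by (rule countable_subset[OF _ countable_rat]) auto
  ultimately have cZ: "countable Z" unfolding Z_def using finW by (auto intro: countable_finite)
  show ?thesis
  proof (intro exI[of _ Z] conjI[OF cZ] allI impI)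
    fix t :: real assume t: "0 < t" "t < 1" "t \<notin> Z"
    have fin: "glued_R \<mu> \<nu> t \<noteq> -\<infinity>" using t by (auto simp: Z_def W_def)
    have tW: "t \<notin> W" using t by (simp add: Z_def)
    have "continuous (at t within {0<..<1}) G" "continuous (at t within {0<..<1}) upper"
      using t by (auto simp: Z_def disc_def)
    moreover have "at t within {0<..<1} = at t" using t by (intro at_within_open) auto
    ultimately have Gc: "isCont G t" and uc: "isCont upper t" by simp_all
    have Gl: "(G \<longlongrightarrow> G t) (at t)" and ul: "(upper \<longlongrightarrow> upper t) (at t)" using Gc uc by (simp_all add: isCont_def)
    define T0 where "T0 = {0<..<1} - W"
    have T0: "open T0" "t \<in> T0" using finW t tW by (auto simp: T0_def intro!: open_Diff finite_imp_closed)
    have ev: "\<forall>\<^sub>F v in at t. v \<in> T0" by (rule eventually_at_in_open'[OF T0])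
    have good: "lower v \<le> G v \<and> G v \<le> upper v" if "v \<in> T0" for v
      using that lower_le_G[of v] G_le_upper[of v] by (auto simp: T0_def W_def)
    have "isCont (payoff k) t"
    proof (cases "upper t = G t")
      case True
      have val: "payoff k t = max (k - G t) 0"
      proof (rule antisym)
        show "payoff k t \<le> max (k - G t) 0"
          using chord_put_bounds(2)[of "lower t" "G t" "upper t" k] good[OF T0(2)] True by simp
        show "max (k - G t) 0 \<le> payoff k t"
          by (rule chord_put_bounds(1)) (use good[OF T0(2)] in auto)
      qed
      show ?thesis unfolding isCont_def val
      proof (rule tendsto_sandwich)
        show "\<forall>\<^sub>F v in at t. max (k - G v) 0 \<le> payoff k v"
          using ev by eventually_elim (use good chord_put_bounds in blast)
        show "\<forall>\<^sub>F v in at t. payoff k v \<le> max (k - G v) 0 + (upper v - G v)"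
          using ev by eventually_elim (use good chord_put_bounds in blast)
        show "((\<lambda>v. max (k - G v) 0) \<longlongrightarrow> max (k - G t) 0) (at t)"
          by (intro tendsto_max tendsto_diff tendsto_const Gl)
        have "((\<lambda>v. max (k - G v) 0 + (upper v - G v)) \<longlongrightarrow> max (k - G t) 0 + (upper t - G t)) (at t)"
          by (intro tendsto_add tendsto_max tendsto_diff tendsto_const Gl ul)
        then show "((\<lambda>v. max (k - G v) 0 + (upper v - G v)) \<longlongrightarrow> max (k - G t) 0) (at t)" using True by simp
      qed
    next
      case False
      then have lt: "G t < upper t" using good[OF T0(2)] by simp
      have "\<forall>\<^sub>F x in at t. G x < upper t" by (rule order_tendstoD(2)[OF Gl lt])
      then obtain e where e: "e > 0" "\<And>x. x \<noteq> t \<Longrightarrow> dist x t < e \<Longrightarrow> G x < upper t"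
        unfolding eventually_at by auto
      obtain q where q: "q \<in> \<rat>" "t < q" "q < min (t + e) 1" using Rats_dense_in_real[of t "min (t + e) 1"] e t by auto
      have qQ: "q \<in> Q" using q t by (simp add: Q_def)
      have Gq: "G q < upper t" using q by (intro e(2)) (auto simp: dist_real_def)
      have tA: "t \<in> A q" using t q tW Gq by (simp add: A_def)
      have bdd: "bdd_below (A q)" by (rule bdd_belowI[of _ 0]) (auto simp: A_def)
      have "Inf (A q) \<noteq> t" using t qQ by (auto simp: Z_def)
      then have "Inf (A q) < t" using cInf_lower[OF tA bdd] by simp
      then obtain u' where u': "u' \<in> A q" "u' < t" using cInf_lessD[of "A q" t] tA by auto
      define T where "T = {u'<..<q} - W"
      have T: "open T" "t \<in> T" using finW u' q tW by (auto simp: T_def intro!: open_Diff finite_imp_closed)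
      have "T \<subseteq> A q"
      proof
        fix x assume x: "x \<in> T"
        then have "upper u' \<le> upper x" using u' q by (intro upper_mono) (auto simp: T_def A_def)
        then show "x \<in> A q" using x u' by (auto simp: T_def A_def)
      qed
      then have "at t within A q = at t" by (rule at_within_open_subset[OF T(2,1)])
      moreover have "continuous (at t within A q) (\<lambda>u. - lower u)" using t qQ tA by (auto simp: Z_def disc_def)
      ultimately have "isCont (\<lambda>u. - lower u) t" by simp
      then have "isCont (\<lambda>u. - (- lower u)) t" by (rule continuous_minus)
      then have ll: "(lower \<longlongrightarrow> lower t) (at t)" by (simp add: isCont_def)
      have lu: "lower t < upper t" using good[OF T0(2)] lt by simp
      then have "0 < upper t - lower t" by simp
      then have "\<forall>\<^sub>F v in at t. 0 < upper v - lower v" by (rule order_tendstoD(1)[OF tendsto_diff[OF ul ll]])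
      then have ev2: "\<forall>\<^sub>F v in at t. (upper v - G v) / (upper v - lower v) * max (k - lower v) 0
          + (G v - lower v) / (upper v - lower v) * max (k - upper v) 0 = payoff k v"
        by eventually_elim (simp add: chord_put_def)
      have "((\<lambda>v. (upper v - G v) / (upper v - lower v) * max (k - lower v) 0
          + (G v - lower v) / (upper v - lower v) * max (k - upper v) 0) \<longlongrightarrow>
          (upper t - G t) / (upper t - lower t) * max (k - lower t) 0
          + (G t - lower t) / (upper t - lower t) * max (k - upper t) 0) (at t)"
        by (intro tendsto_add tendsto_mult tendsto_divide tendsto_max tendsto_diff tendsto_const Gl ul ll) (use lu in auto)
      from Lim_transform_eventually[OF this ev2] show ?thesis
        unfolding isCont_def using lu by (simp add: chord_put_def)
    qed
    then show "glued_R \<mu> \<nu> t \<noteq> -\<infinity> \<and> isCont G t \<and> isCont (payoff k) t" using fin Gc by blast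
  qed
qed

text \<open>
  By the two envelope estimates, the difference quotient of the minorant over a step lies between the
  payoffs at the two ends of the step, up to an increment of \<open>G\<close>.
\<close>

lemma payoff_integral_inner:
  assumes ab: "0 < a" "a < b" "b < 1"
  shows "set_integrable lborel {a<..<b} (payoff k)"
    and "(LINT t:{a<..<b}|lborel. payoff k t) = minorant a k - minorant b k"
proof -
  obtain Z where Z: "countable Z"
    "\<And>t. 0 < t \<Longrightarrow> t < 1 \<Longrightarrow> t \<notin> Z \<Longrightarrow> glued_R \<mu> \<nu> t \<noteq> -\<infinity> \<and> isCont G t \<and> isCont (payoff k) t"
    using payoff_continuity[of k] by blast
  define b' where "b' = (1 + b) / 2"
  have b': "b < b'" "b' < 1" using ab by (auto simp: b'_def)
  \<comment> \<open>Clamping the level extends the minorant continuously to the line; \<open>b'\<close> leaves room for steps that start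
    before \<open>b\<close>.\<close>
  define cl where "cl t = max 0 (min t b')" for t :: real
  define \<eta> where "\<eta> t = minorant (cl t) k" for t
  have cl: "0 \<le> cl t" "cl t \<le> b'" for t using ab b' by (auto simp: cl_def)
  have cl_id: "cl t = t" if "0 \<le> t" "t \<le> b'" for t using that by (simp add: cl_def)
  have \<eta>c: "continuous_on UNIV \<eta>"
    unfolding \<eta>_def[abs_def]
    by (rule continuous_on_compose2[OF minorant_continuous[of b' k]])
      (use ab b' cl in \<open>auto simp: cl_def[abs_def] intro!: continuous_intros\<close>)
  have \<eta>a: "\<eta> y \<le> \<eta> x" if "x \<le> y" for x y
    unfolding \<eta>_def by (rule minorant_antimono) (use that cl[of x] cl[of y] b' in \<open>auto simp: cl_def\<close>)
  obtain n\<^sub>0 where n0: "1 / real (Suc n\<^sub>0) < b' - b" using nat_approx_posE[of "b' - b"] b' by auto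
  define step where "step n = 1 / real (Suc n)" for n
  have step: "0 < step n" for n by (simp add: step_def)
  have step_lim: "step \<longlonglongrightarrow> 0" unfolding step_def[abs_def] using LIMSEQ_Suc[OF lim_const_over_n[of "1::real"]] by simp
  have step0: "step (n + n\<^sub>0) < b' - b" for n
  proof -
    have "step (n + n\<^sub>0) \<le> 1 / real (Suc n\<^sub>0)" unfolding step_def by (intro divide_left_mono) auto
    then show ?thesis using n0 by simp
  qed
  have quot: "real (Suc n) * x = x / step n" for n x by (simp add: step_def mult.commute)
  have \<eta>q: "real (Suc n) * (\<eta> t - \<eta> (t + 1 / real (Suc n))) = (minorant t k - minorant (t + step n) k) / step n"
    if "t \<in> {a<..<b}" "step n < b' - b" for t n
    unfolding quot step_def[symmetric] \<eta>_def using that ab step[of n] by (simp add: cl_id)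
  have up: "(minorant t k - minorant (t + step n) k) / step n \<le> payoff k (t + step n) + (G (t + step n) - G t)"
    if "t \<in> {a<..<b}" "step n < b' - b" "glued_R \<mu> \<nu> (t + step n) \<noteq> -\<infinity>" for t n
    using minorant_decrease_upper[of t "t + step n" k] that ab b' step[of n] by (simp add: pos_divide_le_eq mult.commute)
  have lo: "payoff k t - (G (t + step n) - G t) \<le> (minorant t k - minorant (t + step n) k) / step n"
    if "t \<in> {a<..<b}" "step n < b' - b" "glued_R \<mu> \<nu> t \<noteq> -\<infinity>" for t n
    using minorant_decrease_lower[of t "t + step n" k] that ab b' step[of n] by (simp add: pos_le_divide_eq mult.commute)
  have nn: "0 \<le> (minorant t k - minorant (t + step n) k) / step n"
    if "t \<in> {a<..<b}" "step n < b' - b" for t n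
    using minorant_antimono[of t "t + step n" k] that ab b' step[of n] by simp
  define W where "W = {u. 0 < u \<and> u < 1 \<and> glued_R \<mu> \<nu> u = -\<infinity>}"
  obtain w where w: "W \<subseteq> {w}"
  proof (cases "W = {}")
    case False
    then obtain w where "w \<in> W" by blast
    then have "W \<subseteq> {w}" using glued_R_minus_infinity_unique by (auto simp: W_def)
    then show ?thesis by (rule that)
  qed (use that in blast)
  have notW: "glued_R \<mu> \<nu> u \<noteq> -\<infinity>" if "0 < u" "u < 1" "u \<noteq> w" for u using w that by (auto simp: W_def)
  define C where "C = max (k - G a) 0 + (upper b' - G a) + (G b' - G a)"
  have bound: "AE t in lborel. t \<in> {a<..<b} \<longrightarrow> \<bar>real (Suc (n + n\<^sub>0)) * (\<eta> t - \<eta> (t + 1 / real (Suc (n + n\<^sub>0))))\<bar> \<le> C" for n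
    using AE_lborel_singleton[of "w - step (n + n\<^sub>0)"]
  proof eventually_elim
    case (elim t)
    show ?case
    proof
      assume t: "t \<in> {a<..<b}"
      let ?v = "t + step (n + n\<^sub>0)"
      have v: "0 < ?v" "?v < 1" "a \<le> ?v" "?v \<le> b'" using t ab b' step[of "n + n\<^sub>0"] step0[of n] by auto
      have fin: "glued_R \<mu> \<nu> ?v \<noteq> -\<infinity>" by (rule notW) (use v elim in auto)
      have "payoff k ?v \<le> max (k - G ?v) 0 + (upper ?v - G ?v)"
        by (rule chord_put_bounds[OF lower_le_G[OF v(1,2) fin] G_le_upper[OF v(1,2)]])
      moreover have G: "G a \<le> G ?v" "G ?v \<le> G b'" "upper ?v \<le> upper b'" "G a \<le> G t"
        using v t ab b' by (auto intro!: G_mono upper_mono)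
      moreover have "max (k - G ?v) 0 \<le> max (k - G a) 0" using G(1) by (intro max.mono) auto
      ultimately have C: "payoff k ?v + (G ?v - G t) \<le> C" unfolding C_def by linarith
      show "\<bar>real (Suc (n + n\<^sub>0)) * (\<eta> t - \<eta> (t + 1 / real (Suc (n + n\<^sub>0))))\<bar> \<le> C"
        unfolding \<eta>q[OF t step0] abs_of_nonneg[OF nn[OF t step0]] by (rule order_trans[OF up[OF t step0 fin] C])
    qed
  qed
  have lim: "AE t in lborel. t \<in> {a<..<b} \<longrightarrow> (\<lambda>n. real (Suc n) * (\<eta> t - \<eta> (t + 1 / real (Suc n)))) \<longlonglongrightarrow> payoff k t"
    using AE_not_in[OF countable_imp_null_set_lborel[OF Z(1)]]
  proof eventually_elim
    case (elim t)
    show ?case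
    proof
      assume t: "t \<in> {a<..<b}"
      then have good: "glued_R \<mu> \<nu> t \<noteq> -\<infinity>" "isCont G t" "isCont (payoff k) t" using Z(2)[of t] elim ab by auto
      have v_lim: "(\<lambda>n. t + step n) \<longlonglongrightarrow> t" using tendsto_add[OF tendsto_const step_lim, of t] by simp
      have Gv: "(\<lambda>n. G (t + step n)) \<longlonglongrightarrow> G t" by (rule isCont_tendsto_compose[OF good(2) v_lim])
      have pv: "(\<lambda>n. payoff k (t + step n)) \<longlonglongrightarrow> payoff k t" by (rule isCont_tendsto_compose[OF good(3) v_lim])
      have ev1: "\<forall>\<^sub>F n in sequentially. step n < b' - b" by (rule order_tendstoD(2)[OF step_lim]) (use b' in simp)
      have ev2: "\<forall>\<^sub>F n in sequentially. t + step n \<noteq> w"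
      proof (cases "w \<le> t")
        case True
        have "t + step n \<noteq> w" for n using True step[of n] by linarith
        then show ?thesis by simp
      next
        case False
        then have "\<forall>\<^sub>F n in sequentially. t + step n < w" by (intro order_tendstoD(2)[OF v_lim]) simp
        then show ?thesis by eventually_elim simp
      qed
      show "(\<lambda>n. real (Suc n) * (\<eta> t - \<eta> (t + 1 / real (Suc n)))) \<longlonglongrightarrow> payoff k t"
      proof (rule tendsto_sandwich)
        show "\<forall>\<^sub>F n in sequentially. payoff k t - (G (t + step n) - G t) \<le> real (Suc n) * (\<eta> t - \<eta> (t + 1 / real (Suc n)))"
          using ev1
        proof eventually_elim
          case (elim n)
          show ?case unfolding \<eta>q[OF t elim] by (rule lo[OF t elim good(1)])
        qed
        show "\<forall>\<^sub>F n in sequentially. real (Suc n) * (\<eta> t - \<eta> (t + 1 / real (Suc n))) \<le> payoff k (t + step n) + (G (t + step n) - G t)"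
          using ev1 ev2
        proof eventually_elim
          case (elim n)
          have "glued_R \<mu> \<nu> (t + step n) \<noteq> -\<infinity>"
            by (rule notW) (use t ab b' step[of n] elim in auto)
          then show ?case unfolding \<eta>q[OF t elim(1)] by (rule up[OF t elim(1)])
        qed
        have "(\<lambda>n. payoff k t - (G (t + step n) - G t)) \<longlonglongrightarrow> payoff k t - (G t - G t)"
          by (intro tendsto_diff tendsto_const Gv)
        then show "(\<lambda>n. payoff k t - (G (t + step n) - G t)) \<longlonglongrightarrow> payoff k t" by simp
        have "(\<lambda>n. payoff k (t + step n) + (G (t + step n) - G t)) \<longlonglongrightarrow> payoff k t + (G t - G t)"
          by (intro tendsto_add tendsto_diff tendsto_const Gv pv)
        then show "(\<lambda>n. payoff k (t + step n) + (G (t + step n) - G t)) \<longlonglongrightarrow> payoff k t" by simp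
      qed
    qed
  qed
  note res = integral_of_right_derivative[OF \<eta>c \<eta>a ab(2) payoff_measurable bound lim]
  show "set_integrable lborel {a<..<b} (payoff k)" by (rule res(1))
  show "(LINT t:{a<..<b}|lborel. payoff k t) = minorant a k - minorant b k"
    using res(2) ab b' by (simp add: \<eta>_def cl_id)
qed

lemma payoff_nonneg_AE: "AE t in lborel. t \<in> {0<..<1} \<longrightarrow> 0 \<le> payoff k t"
proof -
  obtain Z where Z: "countable Z"
    "\<And>t. 0 < t \<Longrightarrow> t < 1 \<Longrightarrow> t \<notin> Z \<Longrightarrow> glued_R \<mu> \<nu> t \<noteq> -\<infinity> \<and> isCont G t \<and> isCont (payoff k) t"
    using payoff_continuity[of k] by blast
  show ?thesis using AE_not_in[OF countable_imp_null_set_lborel[OF Z(1)]]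
  proof eventually_elim
    case (elim t)
    show ?case
    proof
      assume t: "t \<in> {0<..<1}"
      then have "lower t \<le> G t" "G t \<le> upper t" using Z(2)[of t] elim lower_le_G[of t] G_le_upper[of t] by auto
      from chord_put_bounds(1)[OF this, of k] show "0 \<le> payoff k t" by simp
    qed
  qed
qed

text \<open>
  The inner intervals exhaust \<open>(0, u)\<close>, and the boundary terms converge: the minorant is \<open>put \<nu>\<close> at level 0 and
  tends to 0 as the level tends to 1.
\<close>

lemma payoff_nn_integral:
  assumes u: "0 < u" "u \<le> 1" and c: "c = (if u < 1 then minorant u k else 0)"
  shows "(\<integral>\<^sup>+t\<in>{0<..<u}. ennreal (payoff k t) \<partial>lborel) = ennreal (put \<nu> k - c)"
proof -
  define \<rho> where "\<rho> = density lborel (\<lambda>t. ennreal (payoff k t))"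
  have \<rho>: "emeasure \<rho> S = (\<integral>\<^sup>+t\<in>S. ennreal (payoff k t) \<partial>lborel)" if "S \<in> sets borel" for S
    unfolding \<rho>_def by (rule emeasure_density) (use that in auto)
  \<comment> \<open>The shift by 3 ensures \<open>a n < b n\<close> for all \<open>n\<close>.\<close>
  define a where "a n = u / real (n + 3)" for n :: nat
  define b where "b n = u - u / real (n + 3)" for n :: nat
  have a_lim: "a \<longlonglongrightarrow> 0"
    unfolding a_def[abs_def] using LIMSEQ_ignore_initial_segment[OF lim_const_over_n[of u], of 3] by simp
  have b_lim: "b \<longlonglongrightarrow> u"
    using tendsto_diff[OF tendsto_const a_lim, of u] by (simp add: b_def[abs_def] a_def[abs_def])
  have ab: "0 < a n" "a n < b n" "b n < u" for n
  proof -
    have 3: "u / real (n + 3) \<le> u / 3" using u by (intro divide_left_mono) auto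
    show "0 < a n" "b n < u" using u by (auto simp: a_def b_def)
    show "a n < b n" using 3 u unfolding a_def b_def by linarith
  qed
  have inner: "emeasure \<rho> {a n<..<b n} = ennreal (minorant (a n) k - minorant (b n) k)" for n
  proof -
    have b1: "b n < 1" using ab(3)[of n] u by simp
    note i = payoff_integral_inner[OF ab(1,2) b1, of k]
    have "emeasure \<rho> {a n<..<b n} = (\<integral>\<^sup>+t. ennreal (indicator {a n<..<b n} t *\<^sub>R payoff k t) \<partial>lborel)"
      by (subst \<rho>) (auto intro!: nn_integral_cong simp: indicator_def)
    also have "\<dots> = ennreal (\<integral>t. indicator {a n<..<b n} t *\<^sub>R payoff k t \<partial>lborel)"
    proof (rule nn_integral_eq_integral)
      show "integrable lborel (\<lambda>t. indicator {a n<..<b n} t *\<^sub>R payoff k t)" using i(1) by (simp add: set_integrable_def)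
      show "AE t in lborel. 0 \<le> indicator {a n<..<b n} t *\<^sub>R payoff k t"
        using payoff_nonneg_AE[of k]
      proof eventually_elim
        case (elim t)
        then show ?case using ab(1)[of n] b1 by (auto simp: indicator_def)
      qed
    qed
    also have "\<dots> = ennreal (minorant (a n) k - minorant (b n) k)"
      using i(2) by (simp add: set_lebesgue_integral_def)
    finally show ?thesis .
  qed
  have "(\<lambda>n. emeasure \<rho> {a n<..<b n}) \<longlonglongrightarrow> emeasure \<rho> (\<Union>n. {a n<..<b n})"
  proof (rule Lim_emeasure_incseq)
    show "range (\<lambda>n. {a n<..<b n}) \<subseteq> sets \<rho>" by (auto simp: \<rho>_def)
    show "incseq (\<lambda>n. {a n<..<b n})"
    proof (rule incseq_SucI)
      fix n
      have "u / real (Suc n + 3) \<le> u / real (n + 3)" using u by (intro divide_left_mono) auto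
      then show "{a n<..<b n} \<subseteq> {a (Suc n)<..<b (Suc n)}" by (auto simp: a_def b_def)
    qed
  qed
  moreover have "(\<Union>n. {a n<..<b n}) = {0<..<u}"
  proof
    show "(\<Union>n. {a n<..<b n}) \<subseteq> {0<..<u}" using ab less_trans by fastforce
    show "{0<..<u} \<subseteq> (\<Union>n. {a n<..<b n})"
    proof
      fix t assume t: "t \<in> {0<..<u}"
      have "\<forall>\<^sub>F n in sequentially. a n < t" by (rule order_tendstoD(2)[OF a_lim]) (use t in simp)
      moreover have "\<forall>\<^sub>F n in sequentially. t < b n" by (rule order_tendstoD(1)[OF b_lim]) (use t in simp)
      ultimately have "\<forall>\<^sub>F n in sequentially. a n < t \<and> t < b n" by eventually_elim simp
      then obtain n where "a n < t" "t < b n" using eventually_happens[of _ sequentially] by auto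
      then show "t \<in> (\<Union>n. {a n<..<b n})" by auto
    qed
  qed
  ultimately have L1: "(\<lambda>n. ennreal (minorant (a n) k - minorant (b n) k)) \<longlonglongrightarrow> emeasure \<rho> {0<..<u}"
    by (simp add: inner)
  have am: "(\<lambda>n. minorant (a n) k) \<longlonglongrightarrow> put \<nu> k"
  proof -
    have "continuous_on {0..1/2} (\<lambda>u. minorant u k)" by (rule minorant_continuous) auto
    then have "(\<lambda>n. minorant (a n) k) \<longlonglongrightarrow> minorant 0 k"
    proof (rule continuous_on_tendsto_compose[OF _ a_lim])
      show "\<forall>\<^sub>F n in sequentially. a n \<in> {0..1/2}"
      proof (intro always_eventually allI)
        fix n
        have "u / real (n + 3) \<le> u / 3" using u by (intro divide_left_mono) auto
        then show "a n \<in> {0..1/2}" using ab(1)[of n] u by (auto simp: a_def)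
      qed
    qed simp
    then show ?thesis by (simp add: minorant_0)
  qed
  have bm: "(\<lambda>n. minorant (b n) k) \<longlonglongrightarrow> c"
  proof (cases "u < 1")
    case True
    have "continuous_on {0..u} (\<lambda>u. minorant u k)" using u True by (intro minorant_continuous) auto
    then have "(\<lambda>n. minorant (b n) k) \<longlonglongrightarrow> minorant u k"
    proof (rule continuous_on_tendsto_compose[OF _ b_lim])
      show "\<forall>\<^sub>F n in sequentially. b n \<in> {0..u}"
        using ab by (intro always_eventually allI) (meson atLeastAtMost_iff less_imp_le less_trans)
    qed (use u in simp)
    then show ?thesis using True c by simp
  next
    case False
    then have u1: "u = 1" "c = 0" using u c by auto
    show ?thesis unfolding u1(2)
    proof (rule tendstoI)
      fix e :: real assume e: "0 < e"
      obtain d where d: "d < 1" "\<And>u. d < u \<Longrightarrow> u < 1 \<Longrightarrow> minorant u k \<le> e / 2"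
        using minorant_at_1[of "e / 2" k] e by auto
      have "\<forall>\<^sub>F n in sequentially. d < b n" by (rule order_tendstoD(1)[OF b_lim]) (use d u1 in simp)
      then show "\<forall>\<^sub>F n in sequentially. dist (minorant (b n) k) 0 < e"
      proof eventually_elim
        case (elim n)
        have "b n < 1" "0 \<le> b n" using ab[of n] u1 by auto
        then show ?case using d(2)[of "b n"] elim minorant_nonneg[of "b n" k] e by simp
      qed
    qed
  qed
  have L2: "(\<lambda>n. ennreal (minorant (a n) k - minorant (b n) k)) \<longlonglongrightarrow> ennreal (put \<nu> k - c)"
    by (intro tendsto_ennrealI tendsto_diff am bm)
  show ?thesis using LIMSEQ_unique[OF L1 L2] \<rho>[of "{0<..<u}"] by simp
qed

end

section \<open>The coupling\<close>

abbreviation unif :: "real measure" where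
  "unif \<equiv> uniform_measure lborel {0<..<1}"

lemma prob_space_unif: "prob_space unif"
  by (rule prob_space_uniform_measure) auto

lemma nn_integral_unif:
  assumes [measurable]: "f \<in> borel_measurable borel"
  shows "(\<integral>\<^sup>+x. f x \<partial>unif) = (\<integral>\<^sup>+x\<in>{0<..<1}. f x \<partial>lborel)"
  unfolding uniform_measure_def by (subst nn_integral_density) (auto intro!: nn_integral_cong simp: indicator_def)

lemma AE_unif:
  assumes "AE x in lborel. x \<in> {0<..<1} \<longrightarrow> P x"
  shows "AE x in unif. P x"
  using assms by (intro AE_uniform_measureI) auto

lemma emeasure_unif:
  assumes "A \<in> sets borel"
  shows "emeasure unif A = emeasure lborel ({0<..<1} \<inter> A)"
  using assms by (simp add: divide_ennreal_def)

lemma emeasure_unif_split: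
  assumes t: "0 \<le> t" "t \<le> 1"
  shows "emeasure unif {..t} = ennreal t" "emeasure unif {t<..} = ennreal (1 - t)"
proof -
  have "emeasure lborel ({0<..<1} \<inter> {..t}) = ennreal t"
  proof (cases "t < 1")
    case True
    then have "{0<..<1} \<inter> {..t} = {0<..t}" by auto
    then show ?thesis using t by simp
  next
    case False
    then have "t = 1" "{0<..<1} \<inter> {..t} = {0<..<1}" using t by auto
    then show ?thesis by simp
  qed
  then show "emeasure unif {..t} = ennreal t" by (simp only: emeasure_unif borel_closed closed_atMost)
  have "{0<..<1} \<inter> {t<..} = {t<..<1}" using t by auto
  then show "emeasure unif {t<..} = ennreal (1 - t)"
    using t by (simp only: emeasure_unif borel_open open_greaterThan) simp
qed

lemma ennreal_combination:
  assumes "0 \<le> w" "0 \<le> a" "0 \<le> w'" "0 \<le> b"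
  shows "ennreal w * ennreal a + ennreal w' * ennreal b = ennreal (w * a + w' * b)"
  using assms by (simp add: ennreal_mult ennreal_plus)

lemma two_point_nn_integral:
  fixes \<phi> :: "real \<Rightarrow> ennreal"
  assumes t: "0 \<le> t" "t \<le> 1"
  shows "(\<integral>\<^sup>+v. \<phi> (if v \<le> t then r else s) \<partial>unif) = ennreal t * \<phi> r + ennreal (1 - t) * \<phi> s"
proof -
  have "(\<integral>\<^sup>+v. \<phi> (if v \<le> t then r else s) \<partial>unif) = (\<integral>\<^sup>+v. \<phi> r * indicator {..t} v + \<phi> s * indicator {t<..} v \<partial>unif)"
    by (intro nn_integral_cong) (auto simp: indicator_def)
  also have "\<dots> = \<phi> r * emeasure unif {..t} + \<phi> s * emeasure unif {t<..}"
    by (subst nn_integral_add) (auto simp: nn_integral_cmult_indicator simp del: emeasure_uniform_measure)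
  finally show ?thesis by (simp only: emeasure_unif_split[OF t] mult.commute)
qed

lemma two_point_integral:
  fixes r s t :: real
  assumes t: "0 \<le> t" "t \<le> 1"
  shows "(\<integral>v. (if v \<le> t then r else s) \<partial>unif) = t * r + (1 - t) * s"
proof -
  interpret prob_space unif by (rule prob_space_unif)
  have m: "measure unif {..t} = t" "measure unif {t<..} = 1 - t"
    using emeasure_unif_split[OF t] t by (simp_all only: measure_def enn2real_ennreal)
  have i: "integrable unif (\<lambda>v. r * indicator {..t} v)" "integrable unif (\<lambda>v. s * indicator {t<..} v)"
    by (intro integrable_mult_right integrable_real_indicator; simp add: less_top[symmetric] emeasure_eq_measure del: emeasure_uniform_measure)+
  have "(\<integral>v. (if v \<le> t then r else s) \<partial>unif) = (\<integral>v. r * indicator {..t} v + s * indicator {t<..} v \<partial>unif)"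
    by (intro Bochner_Integration.integral_cong) (auto simp: indicator_def)
  also have "\<dots> = (\<integral>v. r * indicator {..t} v \<partial>unif) + (\<integral>v. s * indicator {t<..} v \<partial>unif)"
    by (rule Bochner_Integration.integral_add[OF i])
  also have "\<dots> = t * r + (1 - t) * s" by (simp add: m)
  finally show ?thesis .
qed

locale lifted_coupling = curtain +
  fixes y :: "real \<Rightarrow> real \<Rightarrow> real"
  assumes y_measurable: "\<And>u. y u \<in> borel_measurable borel"
begin

definition Y :: "real \<times> real \<Rightarrow> real" where
  "Y p = coupling_Y \<mu> \<nu> y (fst p) (snd p)"

definition weight :: "real \<Rightarrow> real" where
  "weight u = (upper u - G u) / (upper u - lower u)"

definition infinite_set :: "real set" where
  "infinite_set = {u. \<bar>glued_R \<mu> \<nu> u\<bar> = \<infinity> \<or> \<bar>glued_S \<mu> \<nu> u\<bar> = \<infinity>}"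

lemma infinite_set_single: "\<exists>w. infinite_set \<subseteq> {w}"
proof -
  have *: "0 < u \<and> u < 1 \<and> glued_R \<mu> \<nu> u = -\<infinity>" if u: "u \<in> infinite_set" for u
  proof -
    have "u \<in> {0<..<1}"
    proof (rule ccontr)
      assume "u \<notin> {0<..<1}"
      then have "u \<notin> inside" "u \<notin> gaps" using inside_subset gaps_subset by auto
      then have "glued_R \<mu> \<nu> u = ereal (G u)" "glued_S \<mu> \<nu> u = ereal (G u)"
        by (auto simp: inside_def gaps_def glued_R_def glued_S_def)
      then show False using u by (simp add: infinite_set_def)
    qed
    then have u01: "0 < u" "u < 1" by auto
    have "\<bar>glued_R \<mu> \<nu> u\<bar> = \<infinity>" using u glued_S_upper[OF u01] by (simp add: infinite_set_def)
    moreover have "glued_R \<mu> \<nu> u \<noteq> \<infinity>" using glued_le(1)[OF u01] by auto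
    ultimately have "glued_R \<mu> \<nu> u = -\<infinity>" by (cases "glued_R \<mu> \<nu> u") auto
    then show ?thesis using u01 by simp
  qed
  show ?thesis
  proof (cases "infinite_set = {}")
    case False
    then obtain w where "w \<in> infinite_set" by blast
    then have "infinite_set \<subseteq> {w}" using * glued_R_minus_infinity_unique by blast
    then show ?thesis by blast
  qed blast
qed

lemma Y_eq: "u \<notin> infinite_set \<Longrightarrow>
    Y (u, v) = (if lower u < upper u then (if v \<le> weight u then lower u else upper u) else G u)"
  by (simp add: Y_def coupling_Y_def infinite_set_def lower_def upper_def weight_def Let_def)

text \<open>
  As \<open>R\<close> is infinite at one level at most, only one section of the arbitrary function \<open>y\<close> enters.
\<close>

lemma Y_measurable [measurable]: "Y \<in> borel_measurable (borel \<Otimes>\<^sub>M borel)"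
proof -
  obtain w where w: "infinite_set \<subseteq> {w}" using infinite_set_single by blast
  have [measurable]: "infinite_set \<in> sets borel"
    using w by (metis borel_singleton sets.empty_sets subset_singletonD)
  have [measurable]: "weight \<in> borel_measurable borel" unfolding weight_def[abs_def] by measurable
  note y_measurable[of w, measurable]
  have "Y = (\<lambda>p. if fst p \<in> infinite_set then y w (snd p) else
      if lower (fst p) < upper (fst p) then (if snd p \<le> weight (fst p) then lower (fst p) else upper (fst p)) else G (fst p))"
  proof
    fix p :: "real \<times> real"
    obtain u v where p: "p = (u, v)" by fastforce
    show "Y p = (if fst p \<in> infinite_set then y w (snd p) else
      if lower (fst p) < upper (fst p) then (if snd p \<le> weight (fst p) then lower (fst p) else upper (fst p)) else G (fst p))"
    proof (cases "u \<in> infinite_set")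
      case True
      then have "u = w" using w by blast
      then show ?thesis using True p by (auto simp: Y_def coupling_Y_def infinite_set_def Let_def)
    next
      case False
      then show ?thesis using p by (simp add: Y_eq)
    qed
  qed
  also have "\<dots> \<in> borel_measurable (borel \<Otimes>\<^sub>M borel)" by measurable
  finally show ?thesis .
qed

lemma AE_good: "AE u in unif. 0 < u \<and> u < 1 \<and> u \<notin> infinite_set \<and> lower u \<le> G u \<and> G u \<le> upper u"
proof (rule AE_unif)
  obtain w where w: "infinite_set \<subseteq> {w}" using infinite_set_single by blast
  show "AE u in lborel. u \<in> {0<..<1} \<longrightarrow> 0 < u \<and> u < 1 \<and> u \<notin> infinite_set \<and> lower u \<le> G u \<and> G u \<le> upper u"
    using AE_lborel_singleton[of w]
  proof eventually_elim
    case (elim u)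
    show ?case
    proof
      assume "u \<in> {0<..<1}"
      then have u: "0 < u" "u < 1" by auto
      have n: "u \<notin> infinite_set" using elim w by blast
      then have "glued_R \<mu> \<nu> u \<noteq> -\<infinity>" by (auto simp: infinite_set_def)
      then show "0 < u \<and> u < 1 \<and> u \<notin> infinite_set \<and> lower u \<le> G u \<and> G u \<le> upper u"
        using u n lower_le_G[OF u] G_le_upper[OF u] by blast
    qed
  qed
qed

context
  fixes u assumes good: "u \<notin> infinite_set" "lower u \<le> G u" "G u \<le> upper u"
begin

lemma weight_bounds: "lower u < upper u \<Longrightarrow> 0 \<le> weight u" "lower u < upper u \<Longrightarrow> weight u \<le> 1"
  "lower u < upper u \<Longrightarrow> 1 - weight u = (G u - lower u) / (upper u - lower u)"
  "lower u < upper u \<Longrightarrow> weight u * lower u + (1 - weight u) * upper u = G u"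
proof -
  assume lt: "lower u < upper u"
  show "0 \<le> weight u" "weight u \<le> 1" using lt good by (auto simp: weight_def)
  show eq: "1 - weight u = (G u - lower u) / (upper u - lower u)" using lt by (simp add: weight_def field_simps)
  have "weight u * (upper u - lower u) = upper u - G u" using lt by (simp add: weight_def)
  then show "weight u * lower u + (1 - weight u) * upper u = G u" by (simp add: algebra_simps)
qed

lemma inner_put: "(\<integral>\<^sup>+v. ennreal (max (k - Y (u, v)) 0) \<partial>unif) = ennreal (payoff k u)"
proof (cases "lower u < upper u")
  case True
  have "(\<integral>\<^sup>+v. ennreal (max (k - Y (u, v)) 0) \<partial>unif)
      = (\<integral>\<^sup>+v. (\<lambda>x. ennreal (max (k - x) 0)) (if v \<le> weight u then lower u else upper u) \<partial>unif)"
    using True by (intro nn_integral_cong) (simp add: Y_eq[OF good(1)])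
  also have "\<dots> = ennreal (weight u) * ennreal (max (k - lower u) 0) + ennreal (1 - weight u) * ennreal (max (k - upper u) 0)"
    by (rule two_point_nn_integral) (use weight_bounds True in auto)
  also have "\<dots> = ennreal (weight u * max (k - lower u) 0 + (1 - weight u) * max (k - upper u) 0)"
    by (rule ennreal_combination) (use weight_bounds(1,2) True in auto)
  also have "weight u * max (k - lower u) 0 + (1 - weight u) * max (k - upper u) 0 = payoff k u"
    unfolding weight_bounds(3)[OF True] using True by (simp add: chord_put_def weight_def)
  finally show ?thesis .
next
  case False
  then show ?thesis
    using prob_space.emeasure_space_1[OF prob_space_unif] by (simp add: Y_eq[OF good(1)] chord_put_def)
qed

text \<open>
  This follows from the mean and the put with strike 0, as \<open>\<bar>x\<bar> = x + 2 * max (- x) 0\<close>.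
\<close>

lemma inner_abs: "(\<integral>\<^sup>+v. ennreal \<bar>Y (u, v)\<bar> \<partial>unif) = ennreal (G u + 2 * payoff 0 u)"
proof (cases "lower u < upper u")
  case True
  have "(\<integral>\<^sup>+v. ennreal \<bar>Y (u, v)\<bar> \<partial>unif)
      = (\<integral>\<^sup>+v. (\<lambda>x. ennreal \<bar>x\<bar>) (if v \<le> weight u then lower u else upper u) \<partial>unif)"
    using True by (intro nn_integral_cong) (simp add: Y_eq[OF good(1)])
  also have "\<dots> = ennreal (weight u) * ennreal \<bar>lower u\<bar> + ennreal (1 - weight u) * ennreal \<bar>upper u\<bar>"
    by (rule two_point_nn_integral) (use weight_bounds True in auto)
  also have "\<dots> = ennreal (weight u * \<bar>lower u\<bar> + (1 - weight u) * \<bar>upper u\<bar>)"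
    by (rule ennreal_combination) (use weight_bounds(1,2) True in auto)
  also have "weight u * \<bar>lower u\<bar> + (1 - weight u) * \<bar>upper u\<bar> = G u + 2 * payoff 0 u"
  proof -
    have abs: "\<bar>x\<bar> = x + 2 * max (0 - x) 0" for x :: real by (simp add: max_def abs_if)
    have "payoff 0 u = weight u * max (0 - lower u) 0 + (1 - weight u) * max (0 - upper u) 0"
      unfolding weight_bounds(3)[OF True] using True by (simp add: chord_put_def weight_def)
    then show ?thesis unfolding abs[of "lower u"] abs[of "upper u"]
      using weight_bounds(4)[OF True] by (simp only: distrib_left)
  qed
  finally show ?thesis .
next
  case False
  have "\<bar>G u\<bar> = G u + 2 * max (0 - G u) 0" by (simp add: max_def abs_if)
  then show ?thesis using False
    prob_space.emeasure_space_1[OF prob_space_unif] by (simp add: Y_eq[OF good(1)] chord_put_def)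
qed

lemma inner_mean: "(\<integral>v. Y (u, v) \<partial>unif) = G u"
proof (cases "lower u < upper u")
  case True
  have "(\<integral>v. Y (u, v) \<partial>unif) = (\<integral>v. (if v \<le> weight u then lower u else upper u) \<partial>unif)"
    using True by (intro Bochner_Integration.integral_cong) (simp_all add: Y_eq[OF good(1)])
  also have "\<dots> = G u"
    using two_point_integral[of "weight u"] weight_bounds True by simp
  finally show ?thesis .
next
  case False
  then show ?thesis using prob_space.prob_space[OF prob_space_unif] by (simp add: Y_eq[OF good(1)])
qed

end

abbreviation "\<Lambda> \<equiv> unif \<Otimes>\<^sub>M unif"

lemma sets_Lambda [measurable_cong]: "sets \<Lambda> = sets (borel \<Otimes>\<^sub>M borel)"
  by (intro sets_pair_measure_cong) auto

lemma space_Lambda: "space \<Lambda> = UNIV"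
  by (simp add: space_pair_measure)

lemma put_nu_integral_finite: "(\<integral>\<^sup>+u. ennreal (payoff k u) \<partial>unif) = ennreal (put \<nu> k)"
  using payoff_nn_integral[of 1 0 k] by (simp add: nn_integral_unif)

lemma Y_integrable: "integrable \<Lambda> Y"
proof -
  interpret prob_space unif by (rule prob_space_unif)
  have "(\<integral>\<^sup>+p. ennreal (norm (Y p)) \<partial>\<Lambda>) = (\<integral>\<^sup>+u. \<integral>\<^sup>+v. ennreal \<bar>Y (u, v)\<bar> \<partial>unif \<partial>unif)"
    by (subst nn_integral_fst[symmetric]) simp_all
  also have "\<dots> = (\<integral>\<^sup>+u. ennreal (G u + 2 * payoff 0 u) \<partial>unif)"
    by (rule nn_integral_cong_AE) (use AE_good in eventually_elim, use inner_abs in blast)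
  also have "\<dots> \<le> (\<integral>\<^sup>+u. ennreal \<bar>G u\<bar> + 2 * ennreal (payoff 0 u) \<partial>unif)"
  proof (rule nn_integral_mono_AE, use AE_good in eventually_elim)
    case (elim u)
    have "0 \<le> payoff 0 u" using chord_put_bounds(1)[of "lower u" "G u" "upper u" 0] elim by simp
    then have "ennreal (G u + 2 * payoff 0 u) \<le> ennreal (\<bar>G u\<bar> + 2 * payoff 0 u)" by (intro ennreal_leI) simp
    also have "\<dots> = ennreal \<bar>G u\<bar> + 2 * ennreal (payoff 0 u)"
      using \<open>0 \<le> payoff 0 u\<close> by (simp add: ennreal_mult ennreal_plus)
    finally show ?case .
  qed
  also have "\<dots> = (\<integral>\<^sup>+u. ennreal \<bar>G u\<bar> \<partial>unif) + 2 * (\<integral>\<^sup>+u. ennreal (payoff 0 u) \<partial>unif)"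
    by (subst nn_integral_add) (simp_all add: nn_integral_cmult)
  also have "\<dots> < \<infinity>"
  proof -
    have "(\<integral>\<^sup>+u. ennreal \<bar>G u\<bar> \<partial>unif) = (\<integral>\<^sup>+u. ennreal (norm (indicator {0<..<1} u *\<^sub>R G u)) \<partial>lborel)"
      by (subst nn_integral_unif) (auto intro!: nn_integral_cong simp: indicator_def)
    also have "\<dots> < \<infinity>"
      using G_integrable[of 0 1] unfolding set_integrable_def integrable_iff_bounded by blast
    finally show ?thesis by (simp add: put_nu_integral_finite ennreal_mult_less_top)
  qed
  finally show ?thesis by (intro integrableI_bounded) simp_all
qed

definition partial_law :: "real \<Rightarrow> real measure" where
  "partial_law u = distr (restrict_space \<Lambda> ({..u} \<times> UNIV)) borel Y"

lemma strip_measurable [measurable]: "{..u} \<times> UNIV \<in> sets \<Lambda>"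
  by (simp add: sets_Lambda)

lemma event_measurable:
  assumes [measurable]: "A \<in> sets borel"
  shows "{p. Y p \<in> A} \<in> sets (borel \<Otimes>\<^sub>M borel)" "{p. fst p \<le> u \<and> Y p \<in> A} \<in> sets (borel \<Otimes>\<^sub>M borel)"
proof -
  have "{p \<in> space (borel \<Otimes>\<^sub>M borel). Y p \<in> A} \<in> sets (borel \<Otimes>\<^sub>M borel)"
    "{p \<in> space (borel \<Otimes>\<^sub>M borel). fst p \<le> u \<and> Y p \<in> A} \<in> sets (borel \<Otimes>\<^sub>M borel)"
    by measurable
  then show "{p. Y p \<in> A} \<in> sets (borel \<Otimes>\<^sub>M borel)" "{p. fst p \<le> u \<and> Y p \<in> A} \<in> sets (borel \<Otimes>\<^sub>M borel)"
    by (simp_all add: space_pair_measure)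
qed

lemma emeasure_partial_law:
  assumes A[measurable]: "A \<in> sets borel"
  shows "emeasure (partial_law u) A = emeasure \<Lambda> {p. fst p \<le> u \<and> Y p \<in> A}"
proof -
  have "Y \<in> measurable (restrict_space \<Lambda> ({..u} \<times> UNIV)) borel" by (intro measurable_restrict_space1) simp
  then show ?thesis unfolding partial_law_def
    by (subst emeasure_distr) (auto simp: emeasure_restrict_space space_restrict_space space_Lambda
        intro!: arg_cong[where f = "emeasure \<Lambda>"])
qed

text \<open>
  By Fubini's theorem the put function is the integral over the levels of the payoffs of the two-point laws.
\<close>

lemma partial_law_facts:
  shows fin_moment_partial_law: "fin_moment (partial_law u)"
    and mass_partial_law: "0 < u \<Longrightarrow> u \<le> 1 \<Longrightarrow> mass (partial_law u) = u"
    and put_partial_law: "0 < u \<Longrightarrow> u \<le> 1 \<Longrightarrow> put (partial_law u) k = put \<nu> k - (if u < 1 then minorant u k else 0)"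
proof -
  interpret U: prob_space unif by (rule prob_space_unif)
  interpret L: pair_prob_space unif unif ..
  have m: "Y \<in> measurable (restrict_space \<Lambda> ({..u} \<times> UNIV)) borel" by (intro measurable_restrict_space1) simp
  have tot: "emeasure (partial_law u) UNIV = emeasure unif {..u}"
  proof -
    have "emeasure (partial_law u) UNIV = emeasure \<Lambda> ({..u} \<times> UNIV)"
      by (subst emeasure_partial_law) (auto intro!: arg_cong[where f = "emeasure \<Lambda>"])
    also have "\<dots> = emeasure unif {..u} * emeasure unif UNIV"
      by (rule U.emeasure_pair_measure_Times) auto
    finally show ?thesis using U.emeasure_space_1 by (simp del: emeasure_uniform_measure)
  qed
  have fin: "finite_measure (partial_law u)"
    by (rule finite_measureI) (use tot in \<open>simp add: partial_law_def U.emeasure_finite del: emeasure_uniform_measure\<close>)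
  have int: "integrable (partial_law u) (\<lambda>x. x)"
    unfolding partial_law_def
    using integrable_mult_indicator[OF strip_measurable Y_integrable, of u]
    by (subst integrable_distr_eq[OF m]) (simp_all add: integrable_restrict_space space_Lambda)
  show fm: "fin_moment (partial_law u)"
    unfolding fin_moment_def using fin int by (simp add: partial_law_def)
  assume u: "0 < u" "u \<le> 1"
  show "mass (partial_law u) = u"
    using tot emeasure_unif_split(1)[of u] u by (simp add: measure_def del: emeasure_uniform_measure)
  let ?c = "if u < 1 then minorant u k else 0"
  have "ennreal (put (partial_law u) k) = (\<integral>\<^sup>+x. ennreal (max (k - x) 0) \<partial>partial_law u)"
    unfolding put_def by (rule nn_integral_eq_integral[symmetric, OF fin_momentD(6)[OF fm]]) simp
  also have "\<dots> = (\<integral>\<^sup>+p. ennreal (max (k - Y p) 0) * indicator ({..u} \<times> UNIV) p \<partial>\<Lambda>)"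
    unfolding partial_law_def by (subst nn_integral_distr[OF m]) (auto simp: nn_integral_restrict_space space_Lambda)
  also have "\<dots> = (\<integral>\<^sup>+a. \<integral>\<^sup>+b. ennreal (max (k - Y (a, b)) 0) * indicator ({..u} \<times> UNIV) (a, b) \<partial>unif \<partial>unif)"
    by (subst U.nn_integral_fst[symmetric]) simp_all
  also have "\<dots> = (\<integral>\<^sup>+a. ennreal (payoff k a) * indicator {..u} a \<partial>unif)"
  proof (rule nn_integral_cong_AE, use AE_good in eventually_elim)
    case (elim a)
    have "(\<integral>\<^sup>+b. ennreal (max (k - Y (a, b)) 0) * indicator ({..u} \<times> UNIV) (a, b) \<partial>unif)
        = (\<integral>\<^sup>+b. ennreal (max (k - Y (a, b)) 0) * indicator {..u} a \<partial>unif)"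
      by (intro nn_integral_cong) (simp add: indicator_def)
    also have "\<dots> = (\<integral>\<^sup>+b. ennreal (max (k - Y (a, b)) 0) \<partial>unif) * indicator {..u} a"
      by (rule nn_integral_multc) simp
    finally show ?case using inner_put[of a k] elim by simp
  qed
  also have "\<dots> = (\<integral>\<^sup>+a\<in>{0<..<u}. ennreal (payoff k a) \<partial>lborel)"
  proof (subst nn_integral_unif, simp, rule nn_integral_cong_AE, use AE_lborel_singleton[of u] in eventually_elim)
    case (elim a)
    then show ?case using u by (auto simp: indicator_def)
  qed
  also have "\<dots> = ennreal (put \<nu> k - ?c)" by (rule payoff_nn_integral[OF u refl])
  finally have "ennreal (put (partial_law u) k) = ennreal (put \<nu> k - ?c)" .
  moreover have "0 \<le> put \<nu> k - ?c"
    using minorant_le[of u k] J_nonneg[of 0 u k] u put_nonneg[of \<nu> k] by (auto simp: E_def)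
  ultimately show "put (partial_law u) k = put \<nu> k - ?c" using put_nonneg[of "partial_law u" k] by simp
qed

lemma partial_law_1: "partial_law 1 = \<nu>"
  by (rule measure_eqI_put[OF fin_moment_partial_law fin_moments(2)]) (simp_all add: mass_partial_law put_partial_law)

text \<open>
  The measures \<open>partial_law u\<close> increase with \<open>u\<close>, so the identification of the last one with \<open>\<nu>\<close> gives the
  domination that the shadow requires.
\<close>

lemma partial_law_le: "u \<le> 1 \<Longrightarrow> partial_law u \<le> \<nu>"
proof -
  assume u: "u \<le> 1"
  have "emeasure (partial_law u) A \<le> emeasure (partial_law 1) A" if [measurable]: "A \<in> sets borel" for A
    unfolding emeasure_partial_law[OF that] using u by (intro emeasure_mono) (auto simp: sets_Lambda event_measurable[OF that])
  then show ?thesis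
    by (subst le_measure) (auto simp: partial_law_1 borels, auto simp: partial_law_def)
qed

lemma shadow_quantile_part:
  assumes u: "0 < u" "u < 1"
  shows "shadow \<nu> (quantile_part \<mu> u) = partial_law u"
proof -
  have q: "quantile_part \<mu> u = segment_law G 0 u"
    using quantile_part_eq_segment_law[OF finites(1) borels(1), of u] u by simp
  have u': "0 \<le> u" "u \<le> 1" using u by auto
  show ?thesis unfolding q
  proof (rule shadow_eqI)
    show "fin_moment (segment_law G 0 u)" "fin_moment \<nu>" "fin_moment (partial_law u)"
      using fin_moment_G u fin_moments fin_moment_partial_law by auto
    show "mass (partial_law u) = mass (segment_law G 0 u)"
      using u by (simp add: mass_partial_law mass_segment_law)
    show "partial_law u \<le> \<nu>" using u by (intro partial_law_le) simp
    show "put (segment_law G 0 u) k \<le> put (partial_law u) k" for k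
      using minorant_le[OF u', of k] u by (simp add: put_partial_law E_def J_eq_put)
    show "g k \<le> put \<nu> k - put (partial_law u) k"
      if "convex_on UNIV g" "\<And>x. g x \<le> put \<nu> x - put (segment_law G 0 u) x" for g k
      using minorant_greatest[OF u' that(1), of k] that(2) u by (simp add: put_partial_law E_def J_eq_put)
  qed
qed

lemma coupling_properties:
  assumes M: "prob_space M" and indep: "prob_space.indep_var M borel U borel V"
    and U: "distr M lborel U = unif" and V: "distr M lborel V = unif"
  shows "two_step_martingale M
        (vimage_algebra (space M) U borel)
        (vimage_algebra (space M) (\<lambda>\<omega>. (U \<omega>, V \<omega>)) (borel \<Otimes>\<^sub>M borel))
        (\<lambda>\<omega>. G (U \<omega>)) (\<lambda>\<omega>. coupling_Y \<mu> \<nu> y (U \<omega>) (V \<omega>))" (is "two_step_martingale M ?F1 ?F2 ?X ?Y")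
    and "distr M borel (\<lambda>\<omega>. G (U \<omega>)) = \<mu>"
    and "distr M borel (\<lambda>\<omega>. coupling_Y \<mu> \<nu> y (U \<omega>) (V \<omega>)) = \<nu>"
    and "\<And>u B. 0 < u \<Longrightarrow> u < 1 \<Longrightarrow> B \<in> sets borel \<Longrightarrow>
        emeasure M {\<omega> \<in> space M. U \<omega> \<le> u \<and> coupling_Y \<mu> \<nu> y (U \<omega>) (V \<omega>) \<in> B} =
        emeasure (shadow \<nu> (quantile_part \<mu> u)) B"
proof -
  interpret M: prob_space M by (rule M)
  interpret U1: prob_space unif by (rule prob_space_unif)
  interpret L: pair_prob_space unif unif ..
  have Um[measurable]: "U \<in> borel_measurable M" and Vm[measurable]: "V \<in> borel_measurable M"
    using M.indep_var_rv1[OF indep] M.indep_var_rv2[OF indep] by auto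
  have dU: "distr M borel U = unif" and dV: "distr M borel V = unif"
    using U V by (simp_all cong: distr_cong)
  define Z where "Z \<omega> = (U \<omega>, V \<omega>)" for \<omega>
  have Zm[measurable]: "Z \<in> measurable M (borel \<Otimes>\<^sub>M borel)" unfolding Z_def[abs_def] by measurable
  have dZ: "distr M (borel \<Otimes>\<^sub>M borel) Z = \<Lambda>"
    using indep unfolding M.indep_var_distribution_eq dU dV Z_def by simp
  have YZ: "coupling_Y \<mu> \<nu> y (U \<omega>) (V \<omega>) = Y (Z \<omega>)" for \<omega> by (simp add: Y_def Z_def)
  have em: "emeasure M {\<omega> \<in> space M. P (Z \<omega>)} = emeasure \<Lambda> {p. P p}" if "{p. P p} \<in> sets (borel \<Otimes>\<^sub>M borel)" for P
  proof -
    have "emeasure \<Lambda> {p. P p} = emeasure M (Z -` {p. P p} \<inter> space M)"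
      unfolding dZ[symmetric] by (rule emeasure_distr[OF Zm that])
    also have "Z -` {p. P p} \<inter> space M = {\<omega> \<in> space M. P (Z \<omega>)}" by auto
    finally show ?thesis by simp
  qed
  show law_X: "distr M borel (\<lambda>\<omega>. G (U \<omega>)) = \<mu>"
  proof -
    have "distr M borel (\<lambda>\<omega>. G (U \<omega>)) = distr (distr M borel U) borel G"
      by (subst distr_distr) (auto simp: comp_def)
    also have "\<dots> = segment_law G 0 1"
    proof (rule measure_eqI)
      fix A assume "A \<in> sets (distr (distr M borel U) borel G)"
      then have [measurable]: "A \<in> sets borel" by simp
      have "emeasure (distr unif borel G) A = emeasure unif (G -` A)"
        by (subst emeasure_distr) auto
      also have "\<dots> = emeasure lborel {t \<in> {0<..<1}. G t \<in> A}"
      proof -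
        have "G -` A \<in> sets borel" using measurable_sets[OF G_measurable, of A] by simp
        then have "emeasure unif (G -` A) = emeasure lborel ({0<..<1} \<inter> G -` A)" by (rule emeasure_unif)
        also have "{0<..<1} \<inter> G -` A = {t \<in> {0<..<1}. G t \<in> A}" by auto
        finally show ?thesis .
      qed
      finally show "emeasure (distr (distr M borel U) borel G) A = emeasure (segment_law G 0 1) A"
        by (simp add: dU emeasure_segment_law)
    qed simp
    finally show ?thesis by (simp add: laws)
  qed
  show law_Y: "distr M borel (\<lambda>\<omega>. coupling_Y \<mu> \<nu> y (U \<omega>) (V \<omega>)) = \<nu>"
  proof (rule measure_eqI)
    fix A assume "A \<in> sets (distr M borel ?Y)"
    then have A[measurable]: "A \<in> sets borel" by simp
    have "emeasure (distr M borel ?Y) A = emeasure M {\<omega> \<in> space M. Y (Z \<omega>) \<in> A}"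
      unfolding YZ by (subst emeasure_distr) (auto intro!: arg_cong[where f = "emeasure M"])
    also have "\<dots> = emeasure \<Lambda> {p. Y p \<in> A}" by (rule em[OF event_measurable(1)[OF A]])
    also have "\<dots> = emeasure \<Lambda> {p. fst p \<le> 1 \<and> Y p \<in> A}"
    proof (rule emeasure_eq_AE)
      have "AE a in unif. a \<le> 1" using AE_good by eventually_elim simp
      then have "AE a in unif. AE b in unif. fst (a, b) \<le> 1" by eventually_elim simp
      moreover have "{p \<in> space \<Lambda>. fst p \<le> 1} \<in> sets \<Lambda>"
      proof -
        have "{p \<in> space \<Lambda>. fst p \<le> 1} = {..1} \<times> UNIV" by (auto simp: space_Lambda)
        then show ?thesis using strip_measurable[of 1] by simp
      qed
      ultimately have "AE p in \<Lambda>. fst p \<le> 1"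
        by (intro L.AE_pair_measure)
      then show "AE p in \<Lambda>. p \<in> {p. Y p \<in> A} \<longleftrightarrow> p \<in> {p. fst p \<le> 1 \<and> Y p \<in> A}" by eventually_elim simp
    qed (simp_all add: sets_Lambda event_measurable[OF A])
    also have "\<dots> = emeasure \<nu> A" using emeasure_partial_law[OF A, of 1] by (simp add: partial_law_1)
    finally show "emeasure (distr M borel ?Y) A = emeasure \<nu> A" .
  qed (simp add: borels)
  show "emeasure M {\<omega> \<in> space M. U \<omega> \<le> u \<and> coupling_Y \<mu> \<nu> y (U \<omega>) (V \<omega>) \<in> B} =
      emeasure (shadow \<nu> (quantile_part \<mu> u)) B" if u: "0 < u" "u < 1" and B[measurable]: "B \<in> sets borel" for u B
  proof -
    have "emeasure M {\<omega> \<in> space M. fst (Z \<omega>) \<le> u \<and> Y (Z \<omega>) \<in> B} = emeasure \<Lambda> {p. fst p \<le> u \<and> Y p \<in> B}"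
      by (rule em[OF event_measurable(2)[OF B]])
    then show ?thesis
      unfolding YZ shadow_quantile_part[OF u] emeasure_partial_law[OF B] by (simp add: Z_def)
  qed
  have Xint: "integrable M ?X"
  proof -
    have "integrable (distr M borel ?X) (\<lambda>x. x)" unfolding law_X by (rule fin_momentD(4)[OF fin_moments(1)])
    then show ?thesis by (subst (asm) integrable_distr_eq) auto
  qed
  have Yint: "integrable M (\<lambda>\<omega>. Y (Z \<omega>))"
  proof -
    have "integrable (distr M (borel \<Otimes>\<^sub>M borel) Z) Y" unfolding dZ by (rule Y_integrable)
    then show ?thesis by (subst (asm) integrable_distr_eq) auto
  qed
  have Z_F2: "Z \<in> measurable ?F2 (borel \<Otimes>\<^sub>M borel)"
    unfolding Z_def[abs_def] by (rule measurable_vimage_algebra1) (simp add: space_pair_measure)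
  have U_F1: "U \<in> measurable ?F1 borel" by (rule measurable_vimage_algebra1) simp
  have U_F2: "U \<in> measurable ?F2 borel"
    using measurable_compose[OF Z_F2 measurable_fst] by (simp add: Z_def)
  have sub2: "subalgebra M ?F2"
    unfolding subalgebra_def using sets_image_in_sets[of M "space M" "\<lambda>\<omega>. (U \<omega>, V \<omega>)" "borel \<Otimes>\<^sub>M borel"] by simp
  have sub12: "subalgebra ?F2 ?F1"
    unfolding subalgebra_def using sets_image_in_sets[of ?F2 "space M" U borel] U_F2 by simp
  have sub1: "subalgebra M ?F1"
    unfolding subalgebra_def using sets_image_in_sets[of M "space M" U borel] by simp
  have XF1: "?X \<in> borel_measurable ?F1" by (rule measurable_compose[OF U_F1 G_measurable])
  have YF2: "(\<lambda>\<omega>. Y (Z \<omega>)) \<in> borel_measurable ?F2" by (rule measurable_compose[OF Z_F2 Y_measurable])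
  interpret F: sigma_finite_subalgebra M ?F1
    by (rule finite_measure_subalgebra_is_sigma_finite)
      (simp add: finite_measure_subalgebra_def finite_measure_subalgebra_axioms_def M.finite_measure_axioms sub1)
  have cond: "AE \<omega> in M. real_cond_exp M ?F1 (\<lambda>\<omega>. Y (Z \<omega>)) \<omega> = ?X \<omega>"
  proof (rule F.real_cond_exp_charact[OF _ Yint Xint XF1])
    fix A assume "A \<in> sets ?F1"
    then obtain C where C[measurable]: "C \<in> sets borel" and A: "A = U -` C \<inter> space M"
      by (subst (asm) sets_vimage_algebra2) auto
    have "(\<integral>\<omega>\<in>A. Y (Z \<omega>) \<partial>M) = (\<integral>\<omega>. indicator C (fst (Z \<omega>)) * Y (Z \<omega>) \<partial>M)"
      unfolding set_lebesgue_integral_def A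
      by (intro Bochner_Integration.integral_cong) (auto simp: indicator_def Z_def)
    also have "\<dots> = (\<integral>p. indicator C (fst p) * Y p \<partial>\<Lambda>)"
      unfolding dZ[symmetric] by (rule integral_distr[symmetric]) measurable
    also have "\<dots> = (\<integral>a. \<integral>b. indicator C (fst (a, b)) * Y (a, b) \<partial>unif \<partial>unif)"
    proof (rule L.integral_fst'[symmetric])
      have "integrable \<Lambda> (\<lambda>p. indicator (C \<times> UNIV) p *\<^sub>R Y p)"
        by (rule integrable_mult_indicator[OF _ Y_integrable]) (simp add: sets_Lambda)
      moreover have "(\<lambda>p. indicator (C \<times> UNIV) p *\<^sub>R Y p) = (\<lambda>p. indicator C (fst p) * Y p)"
        by (auto simp: indicator_def mem_Times_iff)
      ultimately show "integrable \<Lambda> (\<lambda>p. indicator C (fst p) * Y p)" by (simp only:)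
    qed
    also have "\<dots> = (\<integral>a. indicator C a * G a \<partial>unif)"
    proof (rule integral_cong_AE)
      show "AE a in unif. (\<integral>b. indicator C (fst (a, b)) * Y (a, b) \<partial>unif) = indicator C a * G a"
        using AE_good by eventually_elim (simp add: inner_mean)
    qed measurable
    also have "\<dots> = (\<integral>\<omega>. indicator C (U \<omega>) * G (U \<omega>) \<partial>M)"
      unfolding dU[symmetric] by (rule integral_distr) measurable
    also have "\<dots> = (\<integral>\<omega>\<in>A. G (U \<omega>) \<partial>M)"
      unfolding set_lebesgue_integral_def A
      by (intro Bochner_Integration.integral_cong) (auto simp: indicator_def)
    finally show "(\<integral>\<omega>\<in>A. Y (Z \<omega>) \<partial>M) = (\<integral>\<omega>\<in>A. G (U \<omega>) \<partial>M)" .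
  qed
  show "two_step_martingale M ?F1 ?F2 ?X ?Y"
    unfolding two_step_martingale_def YZ using sub2 sub12 XF1 YF2 Xint Yint cond by blast
qed

end

theorem theorem4p1:
  fixes \<mu> \<nu> :: "real measure"
  assumes "prob_fin_moment \<mu>" and "prob_fin_moment \<nu>" and "le_c \<mu> \<nu>"
  shows
    "second_order_left_monotone (glued_R \<mu> \<nu>) (glued_S \<mu> \<nu>) (quantile \<mu>) {0<..<1} \<and>
     (\<forall>(M :: 'w measure) (U :: 'w \<Rightarrow> real) (V :: 'w \<Rightarrow> real) (y :: real \<Rightarrow> real \<Rightarrow> real).
        prob_space M \<and> prob_space.indep_var M borel U borel V \<and>
        distr M lborel U = uniform_measure lborel {0<..<1} \<and>
        distr M lborel V = uniform_measure lborel {0<..<1} \<and>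
        (\<forall>u. y u \<in> borel_measurable borel) \<longrightarrow>
          two_step_martingale M
            (vimage_algebra (space M) U borel)
            (vimage_algebra (space M) (\<lambda>\<omega>. (U \<omega>, V \<omega>)) (borel \<Otimes>\<^sub>M borel))
            (\<lambda>\<omega>. quantile \<mu> (U \<omega>))
            (\<lambda>\<omega>. coupling_Y \<mu> \<nu> y (U \<omega>) (V \<omega>)) \<and>
          distr M borel (\<lambda>\<omega>. quantile \<mu> (U \<omega>)) = \<mu> \<and>
          distr M borel (\<lambda>\<omega>. coupling_Y \<mu> \<nu> y (U \<omega>) (V \<omega>)) = \<nu> \<and>
          (\<forall>u\<in>{0<..<1}. \<forall>B\<in>sets borel.
             emeasure M {\<omega> \<in> space M. U \<omega> \<le> u \<and> coupling_Y \<mu> \<nu> y (U \<omega>) (V \<omega>) \<in> B} =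
             emeasure (shadow \<nu> (quantile_part \<mu> u)) B))"
proof (intro conjI allI impI ballI; (elim conjE)?)
  interpret curtain \<mu> \<nu> using assms by unfold_locales
  show "second_order_left_monotone (glued_R \<mu> \<nu>) (glued_S \<mu> \<nu>) (quantile \<mu>) {0<..<1}"
    by (rule glued_left_monotone)
  fix M :: "'w measure" and U V :: "'w \<Rightarrow> real" and y :: "real \<Rightarrow> real \<Rightarrow> real"
  assume M: "prob_space M" "prob_space.indep_var M borel U borel V"
    "distr M lborel U = uniform_measure lborel {0<..<1}" "distr M lborel V = uniform_measure lborel {0<..<1}"
    and y: "\<forall>u. y u \<in> borel_measurable borel"
  interpret lifted_coupling \<mu> \<nu> y using y by unfold_locales blast
  note props = coupling_properties[OF M]
  show "two_step_martingale M (vimage_algebra (space M) U borel)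
      (vimage_algebra (space M) (\<lambda>\<omega>. (U \<omega>, V \<omega>)) (borel \<Otimes>\<^sub>M borel))
      (\<lambda>\<omega>. quantile \<mu> (U \<omega>)) (\<lambda>\<omega>. coupling_Y \<mu> \<nu> y (U \<omega>) (V \<omega>))" by (rule props(1))
  show "distr M borel (\<lambda>\<omega>. quantile \<mu> (U \<omega>)) = \<mu>" by (rule props(2))
  show "distr M borel (\<lambda>\<omega>. coupling_Y \<mu> \<nu> y (U \<omega>) (V \<omega>)) = \<nu>" by (rule props(3))
  show "emeasure M {\<omega> \<in> space M. U \<omega> \<le> u \<and> coupling_Y \<mu> \<nu> y (U \<omega>) (V \<omega>) \<in> B} =
      emeasure (shadow \<nu> (quantile_part \<mu> u)) B" if "u \<in> {0<..<1}" "B \<in> sets borel" for u B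
    using props(4)[of u B] that by simp
qed

end
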